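(* There is an absolute constant $C>0$ such that the following holds. Let $x_1,\dots,x_n\in\mathbb{R}^d$, $\gamma>0$, let each $l_j:\mathbb{R}\to\mathbb{R}$ be convex and twice differentiable, and let $F(w)=\frac1n\sum_{j=1}^n l_j(x_j^Tw)+\frac{\gamma}{2}\|w\|_2^2$ with unique minimizer $w^\star$. For an iterate $w_t$ let $g_t=\nabla F(w_t)$, let $A_t\in\mathbb{R}^{n\times d}$ have $j$-th row $\sqrt{l_j''(x_j^Tw_t)}\,x_j^T$, and let $H_t=\nabla^2F(w_t)=\frac1nA_t^TA_t+\gamma I_d$. Let $\widetilde H_t=\frac1s\widetilde A_t^T\widetilde A_t+\gamma I_d$, where $\widetilde A_t\in\mathbb{R}^{s\times d}$ consists of $s$ uniformly sampled rows of $A_t$, let $\widetilde p_t=\widetilde H_t^{-1}g_t$ be the exact solution of $\widetilde H_tp=g_t$, and let $\widetilde p_t'$ be an inexact solution satisfying $$ \big\|\widetilde H_t^{1/2}(\widetilde p_t-\widetilde p_t')\big\|_2\ \le\ \frac{\varepsilon_0}{2}\big\|\widetilde H_t^{1/2}\widetilde p_t\big\|_2 $$ for some $\varepsilon_0\in(0,1)$. Consider the inexact Sub-Sampled Newton update $w_{t+1}=w_t-\widetilde p_t'$. Let $\varepsilon\in(0,\frac14)$, $\delta\in(0,1)$, let $d_{\mathrm{eff}}^\gamma$ and $\mu^\gamma$ denote the $\gamma$-effective dimension and row $\gamma$-ridge coherence of $A_t$, and suppose $s\ge C\frac{\mu^\gamma d_{\mathrm{eff}}^\gamma}{\varepsilon^2}\log\frac{d_{\mathrm{eff}}^\gamma}{\delta}$.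 (i) If all $l_j$ are quadratic (so $A_t\equiv A$, $H_t\equiv H$ are constant, and one sample is used for all iterations), and the inexactness condition holds at every iteration, then with probability at least $1-\delta$, for all $t\ge0$, $\|w_t-w^\star\|_2\le(\varepsilon+\varepsilon_0)^t\sqrt\kappa\,\|w_0-w^\star\|_2$, where $\kappa=\sigma_{\max}(H)/\sigma_{\min}(H)$. (ii) If $\|\nabla^2F(w)-\nabla^2F(w')\|_2\le L\|w-w'\|_2$ for all $w,w'\in\mathbb{R}^d$, then for given $w_t$, with probability at least $1-\delta$, $$ \|w_{t+1}-w^\star\|_2\le(\varepsilon+\varepsilon_0)\sqrt{\kappa_t}\,\|w_t-w^\star\|_2+\frac{L}{\sigma_{\min}(H_t)}\|w_t-w^\star\|_2^2,\qquad \kappa_t=\frac{\sigma_{\max}(H_t)}{\sigma_{\min}(H_t)} . $$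
   Context: For $A=[a_1^T;\dots;a_n^T]\in\mathbb{R}^{n\times d}$ and $\gamma\ge0$, the row $\gamma$-ridge leverage scores are $l_j^\gamma=a_j^T(A^TA+n\gamma I_d)^\dagger a_j$, $j=1,\dots,n$. The $\gamma$-effective dimension is $d_{\mathrm{eff}}^\gamma(A)=\sum_{j=1}^n l_j^\gamma=\sum_{k=1}^d\frac{\sigma_k^2}{\sigma_k^2+n\gamma}$, where $\sigma_1,\dots,\sigma_d$ are the singular values of $A$. The row $\gamma$-ridge coherence is $\mu^\gamma(A)=\frac{n}{d_{\mathrm{eff}}^\gamma}\max_{i}l_i^\gamma$. Uniform sampling: $s$ row indices are drawn independently and uniformly from $\{1,\dots,n\}$; $\widetilde A_t$ consists of the corresponding rows of $A_t$. $\sigma_{\max},\sigma_{\min}$ denote largest and smallest singular values.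
   Formalization: The sample-size condition uses log(1 + d_eff/δ) instead of log(d_eff/δ), since the latter can be zero or negative and the claim then fails for every C (e.g. d=1, n=2, d_eff<δ, s=1); for d_eff/δ ≥ 2 the two conditions agree up to the absolute constant. *)

theory Defs
  imports
    "HOL-Probability.Product_PMF"
    "Jordan_Normal_Form.Char_Poly"
begin

unbundle no vec_syntax
unbundle no inner_syntax
hide_const (open) Finite_Cartesian_Product.vec Finite_Cartesian_Product.mat
  Finite_Cartesian_Product.row Determinants.det

text \<open>
  The constant in the theorem must not depend on the dimensions n, d, s, so these are natural
  numbers quantified inside the statement and vectors and matrices are the carrier-based ones
  of Jordan_Normal_Form. Those types carry no norm, derivative or pseudoinverse.
\<close>

subsection \<open>Linear algebra\<close>

definition norm2 :: "real vec \<Rightarrow> real" where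
  "norm2 v = sqrt (v \<bullet> v)"

definition spec_norm :: "real mat \<Rightarrow> real" where
  "spec_norm M = (SUP v \<in> {v \<in> carrier_vec (dim_col M). norm2 v \<le> 1}. norm2 (M *\<^sub>v v))"

definition singular_values :: "real mat \<Rightarrow> real set" where
  "singular_values M = {\<sigma>. \<sigma> \<ge> 0 \<and> eigenvalue (transpose_mat M * M) (\<sigma>\<^sup>2)}"

definition sigma_max :: "real mat \<Rightarrow> real" where
  "sigma_max M = Max (singular_values M)"

definition sigma_min :: "real mat \<Rightarrow> real" where
  "sigma_min M = Min (singular_values M)"

definition cond_number :: "real mat \<Rightarrow> real" where
  "cond_number M = sigma_max M / sigma_min M"

definition is_psd :: "real mat \<Rightarrow> bool" where
  "is_psd M \<longleftrightarrow> square_mat M \<and> transpose_mat M = M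
     \<and> (\<forall>v \<in> carrier_vec (dim_row M). v \<bullet> (M *\<^sub>v v) \<ge> 0)"

text \<open>The unique positive semidefinite square root; only meaningful for positive semidefinite M.\<close>

definition mat_sqrt :: "real mat \<Rightarrow> real mat" where
  "mat_sqrt M = (THE R. R \<in> carrier_mat (dim_row M) (dim_row M) \<and> is_psd R \<and> R * R = M)"

text \<open>The Moore-Penrose inverse, as the unique solution of the four Penrose equations.\<close>

definition pinv :: "real mat \<Rightarrow> real mat" where
  "pinv M = (THE X. X \<in> carrier_mat (dim_col M) (dim_row M)
     \<and> M * X * M = M \<and> X * M * X = X
     \<and> transpose_mat (M * X) = M * X \<and> transpose_mat (X * M) = X * M)"

subsection \<open>Gradient and Hessian\<close>

definition partial_deriv :: "nat \<Rightarrow> (real vec \<Rightarrow> real) \<Rightarrow> real vec \<Rightarrow> real" where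
  "partial_deriv i f w = deriv (\<lambda>h. f (w + h \<cdot>\<^sub>v unit_vec (dim_vec w) i)) 0"

definition gradient :: "(real vec \<Rightarrow> real) \<Rightarrow> real vec \<Rightarrow> real vec" where
  "gradient f w = Matrix.vec (dim_vec w) (\<lambda>i. partial_deriv i f w)"

definition hessian :: "(real vec \<Rightarrow> real) \<Rightarrow> real vec \<Rightarrow> real mat" where
  "hessian f w = Matrix.mat (dim_vec w) (dim_vec w)
     (\<lambda>(i, j). partial_deriv i (\<lambda>v. partial_deriv j f v) w)"

subsection \<open>Ridge leverage scores\<close>

definition ridge_leverage :: "real \<Rightarrow> real mat \<Rightarrow> nat \<Rightarrow> real" where
  "ridge_leverage \<gamma> A j = Matrix.row A j \<bullet>
     (pinv (transpose_mat A * A + (real (dim_row A) * \<gamma>) \<cdot>\<^sub>m 1\<^sub>m (dim_col A)) *\<^sub>v Matrix.row A j)"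

definition eff_dim :: "real \<Rightarrow> real mat \<Rightarrow> real" where
  "eff_dim \<gamma> A = (\<Sum>j<dim_row A. ridge_leverage \<gamma> A j)"

definition ridge_coherence :: "real \<Rightarrow> real mat \<Rightarrow> real" where
  "ridge_coherence \<gamma> A =
     real (dim_row A) / eff_dim \<gamma> A * Max (ridge_leverage \<gamma> A ` {..<dim_row A})"

subsection \<open>Regularized empirical risk and sub-sampled Newton steps\<close>

definition erm_objective ::
  "nat \<Rightarrow> (nat \<Rightarrow> real vec) \<Rightarrow> (nat \<Rightarrow> real \<Rightarrow> real) \<Rightarrow> real \<Rightarrow> real vec \<Rightarrow> real" where
  "erm_objective n x l \<gamma> w = (1 / real n) * (\<Sum>j<n. l j (x j \<bullet> w)) + \<gamma> / 2 * (norm2 w)\<^sup>2"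

definition scaled_data ::
  "nat \<Rightarrow> (nat \<Rightarrow> real vec) \<Rightarrow> (nat \<Rightarrow> real \<Rightarrow> real) \<Rightarrow> real vec \<Rightarrow> real mat" where
  "scaled_data n x l w = Matrix.mat n (dim_vec w)
     (\<lambda>(j, k). sqrt (deriv (deriv (l j)) (x j \<bullet> w)) * x j $ k)"

text \<open>Independent uniform draws (with replacement) of row indices, the i-th draw being \<omega> i.\<close>

definition uniform_sample :: "nat \<Rightarrow> nat \<Rightarrow> (nat \<Rightarrow> nat) pmf" where
  "uniform_sample n s = Pi_pmf {..<s} 0 (\<lambda>_. pmf_of_set {..<n})"

definition subsample_rows :: "nat \<Rightarrow> (nat \<Rightarrow> nat) \<Rightarrow> real mat \<Rightarrow> real mat" where
  "subsample_rows s \<omega> A = Matrix.mat s (dim_col A) (\<lambda>(i, k). A $$ (\<omega> i, k))"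

definition subsampled_hessian ::
  "nat \<Rightarrow> (nat \<Rightarrow> real vec) \<Rightarrow> (nat \<Rightarrow> real \<Rightarrow> real) \<Rightarrow> real \<Rightarrow> nat \<Rightarrow> (nat \<Rightarrow> nat)
     \<Rightarrow> real vec \<Rightarrow> real mat" where
  "subsampled_hessian n x l \<gamma> s \<omega> w =
     (let B = subsample_rows s \<omega> (scaled_data n x l w)
      in (1 / real s) \<cdot>\<^sub>m (transpose_mat B * B) + \<gamma> \<cdot>\<^sub>m 1\<^sub>m (dim_vec w))"

text \<open>
  From w, the exact direction p and an inexact direction p' within the relative tolerance lead
  to w'. The step is a relation because p' is any vector meeting the tolerance.
\<close>

definition inexact_ssn_step ::
  "nat \<Rightarrow> (nat \<Rightarrow> real vec) \<Rightarrow> (nat \<Rightarrow> real \<Rightarrow> real) \<Rightarrow> real \<Rightarrow> nat \<Rightarrow> real \<Rightarrow> (nat \<Rightarrow> nat)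
     \<Rightarrow> real vec \<Rightarrow> real vec \<Rightarrow> bool" where
  "inexact_ssn_step n x l \<gamma> s \<epsilon>0 \<omega> w w' \<longleftrightarrow>
     (\<exists>p \<in> carrier_vec (dim_vec w). \<exists>p' \<in> carrier_vec (dim_vec w).
        let H = subsampled_hessian n x l \<gamma> s \<omega> w in
        H *\<^sub>v p = gradient (erm_objective n x l \<gamma>) w \<and>
        norm2 (mat_sqrt H *\<^sub>v (p - p')) \<le> \<epsilon>0 / 2 * norm2 (mat_sqrt H *\<^sub>v p) \<and>
        w' = w - p')"

text \<open>
  The lower bound on s in the theorem takes the logarithm of 1 + d/\<delta>, where d is the effective
  dimension. Since d can be smaller than \<delta>, log (d/\<delta>) may be zero or negative, and a bound
  of that form would then not restrict s at all; for d/\<delta> \<ge> 2 the two logarithms differ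
  by at most a factor 2.
\<close>

end

theory Submission
  imports Defs
begin

text \<open>
  Whiten the rows of the scaled data matrix by the inverse square root of the Hessian H. The
  deviation of the sub-sampled Hessian then becomes a sum Z of s independent centred rank-one
  matrices, whose squared norms are at most m (the product of coherence and effective dimension)
  and whose mean has trace equal to the effective dimension D.

  A bound depending on D instead of the ambient dimension comes from the even moments
  E tr Z^(2p). Exchanging one draw with an independent copy and comparing the traces of powers of
  the two matrices (both simultaneously expanded in their eigenbases) gives
  E tr Z^(2p) \<le> (2p-1) m E tr ((Z + 2 s M) Z^(2p-2)), where M is the mean. For p = 1 the right-hand
  side is 2 m s D, and for larger p it is bounded by a multiple of the preceding even moment.
  Markov's inequality finishes: p = 1 suffices when D/\<delta> is bounded, and otherwise p is about
  ln (1 + D/\<delta>).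

  On the good event the quadratic forms of H and the sub-sampled Hessian agree up to the relative
  error \<epsilon>/2. In the norm induced by H, the inexact direction then differs from the exact Newton
  direction by at most the factor \<epsilon> + \<epsilon>0, while the exact Newton step leaves the Taylor remainder
  of the gradient, of size L/2 times the squared error, which vanishes in the quadratic case.
\<close>

subsection \<open>Spectral theory of real symmetric matrices\<close>

text \<open>Matrix inequalities are stated throughout as inequalities between quadratic forms, and
  the trace of a matrix power is a sum of powers of eigenvalues in a chosen eigenbasis. Z and its
  perturbed copy need not commute, so their eigenbases differ; the squared overlaps of the two bases
  form a doubly stochastic array, and this is what turns trace inequalities into scalar ones. Until
  the very end, expectations are unnormalised sums over the finite set of index sequences and
  probabilities are cardinalities. The ambient dimension would enter through the number of
  eigenvalues; instead the trace of M enters the moments once, through the second one, and every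
  further moment step uses only that M is at most the identity. The contraction factor of a step is
  kept below 1 as well as below \<epsilon> + \<epsilon>0, which may exceed 1: in this way the Taylor
  remainder is counted at most twice, and its factor L/2 becomes the L of the quadratic
  term.\<close>

lemma scalar_prod_sum:
  "x \<in> carrier_vec d \<Longrightarrow> y \<in> carrier_vec d \<Longrightarrow> x \<bullet> y = (\<Sum>a<d. x $ a * y $ a)"
  by (simp add: scalar_prod_def lessThan_atLeast0)

lemma scalar_prod_self_nonneg: "0 \<le> x \<bullet> (x :: real vec)"
  by (simp add: scalar_prod_def sum_nonneg)

lemma scalar_prod_self_eq_0_iff:
  fixes x :: "real vec"
  assumes "x \<in> carrier_vec d"
  shows "x \<bullet> x = 0 \<longleftrightarrow> x = 0\<^sub>v d"
proof
  assume "x \<bullet> x = 0"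
  hence "(\<Sum>a<d. x $ a * x $ a) = 0" using scalar_prod_sum[OF assms assms] by simp
  hence "\<forall>a\<in>{..<d}. x $ a * x $ a = 0" by (subst (asm) sum_nonneg_eq_0_iff) auto
  thus "x = 0\<^sub>v d" using assms by (intro eq_vecI) auto
qed (use assms in simp)

lemma scalar_prod_self_pos:
  fixes x :: "real vec"
  assumes "x \<in> carrier_vec d" "x \<noteq> 0\<^sub>v d"
  shows "0 < x \<bullet> x"
  using scalar_prod_self_nonneg[of x] scalar_prod_self_eq_0_iff[OF assms(1)] assms(2) by linarith

lemma norm2_sq: "(norm2 x)\<^sup>2 = x \<bullet> x"
  by (simp add: norm2_def scalar_prod_self_nonneg)

lemma norm2_nonneg: "0 \<le> norm2 x"
  by (simp add: norm2_def scalar_prod_self_nonneg)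

lemma mult_mat_vec_nth:
  "A \<in> carrier_mat d e \<Longrightarrow> y \<in> carrier_vec e \<Longrightarrow> a < d \<Longrightarrow>
    (A *\<^sub>v y) $ a = (\<Sum>b<e. A $$ (a, b) * y $ b)"
  by (simp add: scalar_prod_def lessThan_atLeast0)

lemma mat_mult_nth:
  "A \<in> carrier_mat d e \<Longrightarrow> B \<in> carrier_mat e f \<Longrightarrow> a < d \<Longrightarrow> b < f \<Longrightarrow>
    (A * B) $$ (a, b) = (\<Sum>c<e. A $$ (a, c) * B $$ (c, b))"
  by (simp add: scalar_prod_def lessThan_atLeast0)

lemma bilinear_sum:
  "A \<in> carrier_mat d d \<Longrightarrow> x \<in> carrier_vec d \<Longrightarrow> y \<in> carrier_vec d \<Longrightarrow>
    x \<bullet> (A *\<^sub>v y) = (\<Sum>a<d. \<Sum>b<d. x $ a * A $$ (a, b) * y $ b)"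
  by (subst scalar_prod_sum[where d = d])
     (auto simp: mult_mat_vec_nth sum_distrib_left mult.assoc simp del: index_mult_mat_vec)

lemma symmetric_bilinear:
  fixes A :: "real mat"
  assumes "A \<in> carrier_mat d d" "transpose_mat A = A" "x \<in> carrier_vec d" "y \<in> carrier_vec d"
  shows "x \<bullet> (A *\<^sub>v y) = (A *\<^sub>v x) \<bullet> y"
  using transpose_vec_mult_scalar[of A d d y x] assms by simp

section \<open>Orthonormal systems and the spectral theorem\<close>

definition orthonormal :: "nat \<Rightarrow> nat \<Rightarrow> (nat \<Rightarrow> real vec) \<Rightarrow> bool" where
  "orthonormal d m u \<longleftrightarrow> (\<forall>k<m. u k \<in> carrier_vec d)
     \<and> (\<forall>k<m. \<forall>j<m. u k \<bullet> u j = (if k = j then 1 else 0))"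

definition eigenbasis :: "nat \<Rightarrow> real mat \<Rightarrow> (nat \<Rightarrow> real vec) \<Rightarrow> (nat \<Rightarrow> real) \<Rightarrow> bool" where
  "eigenbasis d A u \<mu> \<longleftrightarrow> orthonormal d d u \<and> (\<forall>k<d. A *\<^sub>v u k = \<mu> k \<cdot>\<^sub>v u k)"

text \<open>A left inverse of a square matrix is also a right inverse, so orthonormal columns
  \<open>u k\<close> force orthonormal rows. The row relations are the completeness relations that
  collapse the double sum.\<close>

lemma parseval:
  assumes u: "orthonormal d d u" and x: "x \<in> carrier_vec d" and y: "y \<in> carrier_vec d"
  shows "x \<bullet> y = (\<Sum>k<d. (x \<bullet> u k) * (u k \<bullet> y))"
proof -
  define U where "U = Matrix.mat d d (\<lambda>(a, k). u k $ a)"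
  have uc: "u k \<in> carrier_vec d" if "k < d" for k using u that by (simp add: orthonormal_def)
  have U: "U \<in> carrier_mat d d" "transpose_mat U \<in> carrier_mat d d" by (auto simp: U_def)
  have "transpose_mat U * U = 1\<^sub>m d"
  proof (rule eq_matI)
    fix i j assume "i < dim_row (1\<^sub>m d)" "j < dim_col (1\<^sub>m d)"
    hence ij: "i < d" "j < d" by auto
    have "(transpose_mat U * U) $$ (i, j) = u i \<bullet> u j"
      using ij uc by (subst mat_mult_nth[OF U(2,1)], simp_all add: scalar_prod_sum[where d = d] U_def)
    thus "(transpose_mat U * U) $$ (i, j) = 1\<^sub>m d $$ (i, j)"
      using ij u by (simp add: orthonormal_def)
  qed (auto simp: U_def)
  hence UU: "U * transpose_mat U = 1\<^sub>m d"
    using mat_mult_left_right_inverse[OF U(2,1)] by simp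
  have complete: "(\<Sum>k<d. u k $ a * u k $ b) = (if a = b then 1 else 0)" if "a < d" "b < d" for a b
  proof -
    have "(U * transpose_mat U) $$ (a, b) = (\<Sum>k<d. u k $ a * u k $ b)"
      using that by (subst mat_mult_nth[OF U], simp_all add: U_def)
    thus ?thesis using UU that by simp
  qed
  have "(\<Sum>k<d. (x \<bullet> u k) * (u k \<bullet> y))
      = (\<Sum>k<d. \<Sum>a<d. \<Sum>b<d. (x $ a * y $ b) * (u k $ a * u k $ b))"
    using x y uc
    by (intro sum.cong) (auto simp: scalar_prod_sum[where d = d] sum_product mult_ac)
  also have "\<dots> = (\<Sum>a<d. \<Sum>k<d. \<Sum>b<d. (x $ a * y $ b) * (u k $ a * u k $ b))"
    by (rule sum.swap)
  also have "\<dots> = (\<Sum>a<d. \<Sum>b<d. \<Sum>k<d. (x $ a * y $ b) * (u k $ a * u k $ b))"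
    by (intro sum.cong refl sum.swap)
  also have "\<dots> = (\<Sum>a<d. \<Sum>b<d. (x $ a * y $ b) * (if a = b then 1 else 0))"
    using complete by (intro sum.cong refl) (simp only: sum_distrib_left[symmetric] lessThan_iff)
  also have "\<dots> = (\<Sum>a<d. x $ a * y $ a)"
    by (intro sum.cong refl) (simp add: if_distrib[where f = "\<lambda>z. _ * z"] cong: if_cong)
  finally show ?thesis using scalar_prod_sum[OF x y] by simp
qed

text \<open>A trace count replaces basis extension: the squared distances of the d coordinate
  vectors from the span of the \<open>u i\<close> add up to d - m > 0, so some coordinate vector
  lies outside the span, and its normalised residual works.\<close>

lemma exists_unit_orthogonal:
  assumes u: "orthonormal d m u" and m: "m < d"
  shows "\<exists>x \<in> carrier_vec d. x \<bullet> x = 1 \<and> (\<forall>i<m. x \<bullet> u i = 0)"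
proof -
  have uc: "u k \<in> carrier_vec d" if "k < m" for k using u that by (simp add: orthonormal_def)
  have "(\<Sum>a<d. 1 - (\<Sum>i<m. (u i $ a)\<^sup>2)) = real d - (\<Sum>i<m. u i \<bullet> u i)"
  proof -
    have "(\<Sum>a<d. \<Sum>i<m. (u i $ a)\<^sup>2) = (\<Sum>i<m. \<Sum>a<d. (u i $ a)\<^sup>2)" by (rule sum.swap)
    also have "\<dots> = (\<Sum>i<m. u i \<bullet> u i)"
      using uc by (intro sum.cong refl) (simp add: scalar_prod_sum[where d = d] power2_eq_square)
    finally show ?thesis by (simp add: sum_subtractf)
  qed
  also have "(\<Sum>i<m. u i \<bullet> u i) = real m" using u by (simp add: orthonormal_def)
  finally have "0 < (\<Sum>a<d. 1 - (\<Sum>i<m. (u i $ a)\<^sup>2))" using m by simp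
  then obtain a where a: "a < d" "0 < 1 - (\<Sum>i<m. (u i $ a)\<^sup>2)"
    by (metis (no_types, lifting) lessThan_iff not_le sum_nonpos)
  \<comment> \<open>The residual of the coordinate vector number \<open>a\<close> after projection
    onto the span of the \<open>u i\<close>.\<close>
  define p where "p = Matrix.vec d (\<lambda>b. (if b = a then 1 else 0) - (\<Sum>i<m. u i $ a * u i $ b))"
  have p: "p \<in> carrier_vec d" by (simp add: p_def)
  have pu: "p \<bullet> y = y $ a - (\<Sum>i<m. u i $ a * (u i \<bullet> y))" if y: "y \<in> carrier_vec d" for y
  proof -
    have "p \<bullet> y = (\<Sum>b<d. (if b = a then 1 else 0) * y $ b) - (\<Sum>b<d. \<Sum>i<m. u i $ a * (u i $ b * y $ b))"
      unfolding scalar_prod_sum[OF p y]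
      by (simp add: p_def left_diff_distrib sum_subtractf sum_distrib_right mult.assoc)
    also have "(\<Sum>b<d. (if b = a then 1 else 0) * y $ b) = y $ a"
      using a by (simp add: if_distrib[where f = "\<lambda>z. z * _"] cong: if_cong)
    also have "(\<Sum>b<d. \<Sum>i<m. u i $ a * (u i $ b * y $ b)) = (\<Sum>i<m. u i $ a * (u i \<bullet> y))"
      by (subst sum.swap) (use uc y in \<open>simp add: scalar_prod_sum[where d = d] sum_distrib_left\<close>)
    finally show ?thesis .
  qed
  have orth: "p \<bullet> u j = 0" if "j < m" for j
  proof -
    have "(\<Sum>i<m. u i $ a * (u i \<bullet> u j)) = (\<Sum>i<m. u i $ a * (if i = j then 1 else 0))"
      using u that by (intro sum.cong) (auto simp: orthonormal_def)
    also have "\<dots> = u j $ a"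
      using that by (simp add: if_distrib[where f = "\<lambda>z. _ * z"] cong: if_cong)
    finally show ?thesis using pu[OF uc[OF that]] by simp
  qed
  have "p \<bullet> p = p $ a - (\<Sum>i<m. u i $ a * (u i \<bullet> p))" using pu[OF p] .
  also have "(\<Sum>i<m. u i $ a * (u i \<bullet> p)) = 0"
    using orth uc p by (intro sum.neutral) (auto simp: comm_scalar_prod[of _ d])
  also have "p $ a = 1 - (\<Sum>i<m. (u i $ a)\<^sup>2)" using a by (simp add: p_def power2_eq_square)
  finally have pp: "0 < p \<bullet> p" using a by simp
  define x where "x = (1 / sqrt (p \<bullet> p)) \<cdot>\<^sub>v p"
  have "x \<in> carrier_vec d" using p by (simp add: x_def)
  moreover have "x \<bullet> x = 1" using pp p by (simp add: x_def field_simps)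
  moreover have "\<forall>i<m. x \<bullet> u i = 0" using orth uc p by (auto simp: x_def smult_scalar_prod_distrib[OF p])
  ultimately show ?thesis by blast
qed

text \<open>Compactness is taken from the product topology on \<open>nat \<Rightarrow> real\<close>:
  unit vectors have coordinates in [-1,1], and the constraints are closed conditions on finitely
  many coordinates.\<close>

lemma rayleigh_maximum_exists:
  assumes A: "A \<in> carrier_mat d d" and u: "\<And>i. i < m \<Longrightarrow> u i \<in> carrier_vec d"
    and S: "S = {x \<in> carrier_vec d. x \<bullet> x = 1 \<and> (\<forall>i<m. x \<bullet> u i = 0)}" and ne: "S \<noteq> {}"
  shows "\<exists>x \<in> S. \<forall>y \<in> S. y \<bullet> (A *\<^sub>v y) \<le> x \<bullet> (A *\<^sub>v (x :: real vec))"
proof -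
  \<comment> \<open>Coordinates from d on are pinned to 0, which makes the box a product of compact
    sets over all of the naturals.\<close>
  let ?P = "PiE UNIV (\<lambda>a::nat. if a < d then {-1..1::real} else {0})"
  let ?c = "\<lambda>a. \<lambda>f::nat\<Rightarrow>real. f a"
  define K where "K = ?P \<inter> {f. (\<Sum>a<d. f a * f a) = 1} \<inter> (\<Inter>i\<in>{..<m}. {f. (\<Sum>a<d. f a * u i $ a) = 0})"
  have "compactin (product_topology (\<lambda>_. euclidean) UNIV) ?P"
    by (subst compactin_PiE) auto
  hence P: "compact ?P" by (simp add: euclidean_product_topology)
  have c: "continuous_on UNIV (?c a)" for a
    by (rule continuous_on_product_coordinates)
  have "closed {f. (\<Sum>a<d. f a * f a) = (1::real)}"
    by (intro closed_Collect_eq continuous_intros c)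
  moreover have "closed (\<Inter>i\<in>{..<m}. {f. (\<Sum>a<d. f a * u i $ a) = 0})"
    by (intro closed_INT ballI closed_Collect_eq continuous_intros c)
  ultimately have cK: "compact K" unfolding K_def by (intro compact_Int_closed P)
  have toK: "(\<lambda>a. if a < d then x $ a else 0) \<in> K" if "x \<in> S" for x
  proof -
    have x: "x \<in> carrier_vec d" "x \<bullet> x = 1" "\<And>i. i < m \<Longrightarrow> x \<bullet> u i = 0" using that S by auto
    have s: "(\<Sum>a<d. x $ a * x $ a) = 1" using scalar_prod_sum[OF x(1,1)] x(2) by simp
    have "\<bar>x $ a\<bar> \<le> 1" if "a < d" for a
    proof -
      have "x $ a * x $ a \<le> (\<Sum>a<d. x $ a * x $ a)"
        using that by (intro member_le_sum) auto
      thus ?thesis using s by (simp add: abs_square_le_1[symmetric] power2_eq_square)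
    qed
    thus ?thesis using s x(3) scalar_prod_sum[OF x(1) u] by (auto simp: K_def abs_le_iff minus_le_iff)
  qed
  have fromK: "Matrix.vec d f \<in> S" if "f \<in> K" for f
    using that u by (auto simp: S K_def scalar_prod_sum[where d = d])
  have val: "Matrix.vec d f \<bullet> (A *\<^sub>v Matrix.vec d f) = (\<Sum>a<d. \<Sum>b<d. f a * A $$ (a, b) * f b)" for f
    by (subst bilinear_sum[OF A]) auto
  have "K \<noteq> {}" using ne toK by auto
  moreover have "continuous_on K (\<lambda>f. \<Sum>a<d. \<Sum>b<d. f a * A $$ (a, b) * f b)"
    by (intro continuous_intros continuous_on_subset[OF c]) auto
  ultimately obtain f where f: "f \<in> K" "\<And>g. g \<in> K \<Longrightarrow>
      (\<Sum>a<d. \<Sum>b<d. g a * A $$ (a, b) * g b) \<le> (\<Sum>a<d. \<Sum>b<d. f a * A $$ (a, b) * f b)"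
    using continuous_attains_sup[OF cK] by meson
  have "y \<bullet> (A *\<^sub>v y) \<le> Matrix.vec d f \<bullet> (A *\<^sub>v Matrix.vec d f)" if "y \<in> S" for y
  proof -
    have y: "y \<in> carrier_vec d" using that S by simp
    have "y = Matrix.vec d (\<lambda>a. if a < d then y $ a else 0)" using y by (intro eq_vecI) auto
    thus ?thesis using f(2)[OF toK[OF that]] val by metis
  qed
  thus ?thesis using fromK[OF f(1)] by blast
qed

lemma orthonormal_carrier: "orthonormal d m u \<Longrightarrow> k < m \<Longrightarrow> u k \<in> carrier_vec d"
  by (simp add: orthonormal_def)

text \<open>The complement of the known eigenvectors is invariant because A is symmetric, so the
  residual r = A x - c x of a maximiser x of the Rayleigh quotient is itself an admissible
  direction. Moving along it would raise the quotient to first order unless r vanishes.\<close>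

lemma eigenvector_in_orthogonal_complement:
  fixes A :: "real mat"
  assumes A: "A \<in> carrier_mat d d" "transpose_mat A = A"
    and u: "orthonormal d m u" and ev: "\<And>k. k < m \<Longrightarrow> A *\<^sub>v u k = \<mu> k \<cdot>\<^sub>v u k" and m: "m < d"
  shows "\<exists>x \<in> carrier_vec d. \<exists>c. x \<bullet> x = 1 \<and> (\<forall>i<m. x \<bullet> u i = 0) \<and> A *\<^sub>v x = c \<cdot>\<^sub>v x"
proof -
  note uc = orthonormal_carrier[OF u]
  define S where "S = {x \<in> carrier_vec d. x \<bullet> x = 1 \<and> (\<forall>i<m. x \<bullet> u i = 0)}"
  have "S \<noteq> {}" using exists_unit_orthogonal[OF u m] by (auto simp: S_def)
  then obtain x where x: "x \<in> S" and max: "\<And>y. y \<in> S \<Longrightarrow> y \<bullet> (A *\<^sub>v y) \<le> x \<bullet> (A *\<^sub>v x)"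
    using rayleigh_maximum_exists[OF A(1) uc S_def] by blast
  have xc: "x \<in> carrier_vec d" and xx: "x \<bullet> x = 1" and xu: "\<And>i. i < m \<Longrightarrow> x \<bullet> u i = 0"
    using x by (auto simp: S_def)
  define c where "c = x \<bullet> (A *\<^sub>v x)"
  have Axc: "A *\<^sub>v x \<in> carrier_vec d" using A xc by simp
  define r where "r = A *\<^sub>v x - c \<cdot>\<^sub>v x"
  have rc: "r \<in> carrier_vec d" using Axc xc by (simp add: r_def)
  have Ax: "A *\<^sub>v x = r + c \<cdot>\<^sub>v x" using A Axc xc unfolding r_def by (intro eq_vecI) auto
  have Arc: "A *\<^sub>v r \<in> carrier_vec d" using A rc by simp
  have ru: "r \<bullet> u i = 0" if "i < m" for i
  proof -
    have "(A *\<^sub>v x) \<bullet> u i = x \<bullet> (A *\<^sub>v u i)" using symmetric_bilinear[OF A xc uc[OF that]] by simp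
    also have "\<dots> = 0" using ev[OF that] xu[OF that] xc uc[OF that] by simp
    finally show ?thesis using xu[OF that] Axc xc uc[OF that]
      by (simp add: r_def minus_scalar_prod_distrib[of _ d])
  qed
  have rx: "r \<bullet> x = 0"
    using Axc xc xx comm_scalar_prod[OF Axc xc] by (simp add: r_def c_def minus_scalar_prod_distrib[of _ d])
  have general: "y \<bullet> (A *\<^sub>v y) \<le> c * (y \<bullet> y)"
    if y: "y \<in> carrier_vec d" "\<And>i. i < m \<Longrightarrow> y \<bullet> u i = 0" for y
  proof (cases "y = 0\<^sub>v d")
    case True thus ?thesis using A by simp
  next
    case False
    hence yy: "0 < y \<bullet> y" using scalar_prod_self_pos y by blast
    define z where "z = (1 / sqrt (y \<bullet> y)) \<cdot>\<^sub>v y"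
    have "z \<in> S" using y yy uc by (auto simp: S_def z_def field_simps)
    hence "z \<bullet> (A *\<^sub>v z) \<le> c" using max by (simp add: c_def)
    moreover have "z \<bullet> (A *\<^sub>v z) = (y \<bullet> (A *\<^sub>v y)) / (y \<bullet> y)"
      using y yy A by (simp add: z_def mult_mat_vec[of A d d] smult_scalar_prod_distrib[of _ d] scalar_prod_smult_distrib[of _ d])
    ultimately show ?thesis using yy by (simp add: field_simps)
  qed
  \<comment> \<open>First-order optimality of x in the direction of the residual r.\<close>
  have quad: "2 * t * (r \<bullet> r) \<le> t\<^sup>2 * (c * (r \<bullet> r) - r \<bullet> (A *\<^sub>v r))" for t
  proof -
    define y where "y = x + t \<cdot>\<^sub>v r"
    have yc: "y \<in> carrier_vec d" using xc rc by (simp add: y_def)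
    have "y \<bullet> u i = 0" if "i < m" for i
      using xu[OF that] ru[OF that] xc rc uc[OF that] by (simp add: y_def add_scalar_prod_distrib[of _ d])
    from general[OF yc this] have le: "y \<bullet> (A *\<^sub>v y) \<le> c * (y \<bullet> y)" .
    have yy: "y \<bullet> y = 1 + t\<^sup>2 * (r \<bullet> r)"
      using xc rc xx rx comm_scalar_prod[OF xc rc]
      by (simp add: y_def add_scalar_prod_distrib[of _ d] scalar_prod_add_distrib[of _ d] power2_eq_square)
    have rAx: "r \<bullet> (A *\<^sub>v x) = r \<bullet> r"
      using rx rc xc by (simp add: Ax scalar_prod_add_distrib[of _ d])
    have xAr: "x \<bullet> (A *\<^sub>v r) = r \<bullet> r"
      using rAx symmetric_bilinear[OF A xc rc] comm_scalar_prod[OF Axc rc] by simp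
    have "A *\<^sub>v y = A *\<^sub>v x + t \<cdot>\<^sub>v (A *\<^sub>v r)"
      using A xc rc by (simp add: y_def mult_add_distrib_mat_vec[of A d d] mult_mat_vec[of A d d])
    hence "y \<bullet> (A *\<^sub>v y) = c + 2 * t * (r \<bullet> r) + t\<^sup>2 * (r \<bullet> (A *\<^sub>v r))"
      using xc rc Axc Arc rAx xAr
      by (simp add: y_def add_scalar_prod_distrib[of _ d] scalar_prod_add_distrib[of _ d] c_def power2_eq_square algebra_simps)
    with le yy show ?thesis by (simp add: algebra_simps)
  qed
  have "r \<bullet> r = 0"
  proof (rule ccontr)
    assume "r \<bullet> r \<noteq> 0"
    hence rr: "0 < r \<bullet> r" using scalar_prod_self_nonneg[of r] by linarith
    define q where "q = c * (r \<bullet> r) - r \<bullet> (A *\<^sub>v r)"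
    \<comment> \<open>Short enough for t * q \<le> r \<bullet> r, against the lower bound 2 * (r
      \<bullet> r); the added 1 guards against q = 0.\<close>
    define t where "t = (r \<bullet> r) / (\<bar>q\<bar> + 1)"
    have t: "0 < t" using rr by (simp add: t_def add_nonneg_pos)
    have "t * (2 * (r \<bullet> r)) \<le> t * (t * q)" using quad[of t] by (simp add: q_def power2_eq_square mult_ac)
    hence "2 * (r \<bullet> r) \<le> t * q" using t by simp
    also have "t * q \<le> t * (\<bar>q\<bar> + 1)" using t by (intro mult_left_mono) auto
    also have "\<dots> = r \<bullet> r" by (simp add: t_def add_nonneg_pos[THEN less_imp_neq, symmetric])
    finally show False using rr by simp
  qed
  hence "r = 0\<^sub>v d" using scalar_prod_self_eq_0_iff[OF rc] by simp
  hence "A *\<^sub>v x = c \<cdot>\<^sub>v x" using Ax xc by simp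
  thus ?thesis using xc xx xu by blast
qed

text \<open>The induction runs over the number m of eigenvectors already found, with d fixed; each
  step takes one more from their orthogonal complement.\<close>

theorem symmetric_eigenbasis_exists:
  fixes A :: "real mat"
  assumes A: "A \<in> carrier_mat d d" "transpose_mat A = A"
  shows "\<exists>u \<mu>. eigenbasis d A u \<mu>"
proof -
  have "\<exists>u \<mu>. orthonormal d m u \<and> (\<forall>k<m. A *\<^sub>v u k = \<mu> k \<cdot>\<^sub>v u k)" if "m \<le> d" for m
    using that
  proof (induction m)
    case 0 thus ?case by (auto simp: orthonormal_def)
  next
    case (Suc m)
    then obtain u \<mu> where u: "orthonormal d m u" and ev: "\<And>k. k < m \<Longrightarrow> A *\<^sub>v u k = \<mu> k \<cdot>\<^sub>v u k"
      by auto
    obtain x c where x: "x \<in> carrier_vec d" "x \<bullet> x = 1" "\<And>i. i < m \<Longrightarrow> x \<bullet> u i = 0" "A *\<^sub>v x = c \<cdot>\<^sub>v x"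
      using eigenvector_in_orthogonal_complement[OF A u ev] Suc.prems by auto
    have "u i \<bullet> x = 0" if "i < m" for i
      using x that comm_scalar_prod[OF x(1) orthonormal_carrier[OF u that]] by simp
    hence "orthonormal d (Suc m) (u(m := x)) \<and> (\<forall>k<Suc m. A *\<^sub>v (u(m := x)) k = (\<mu>(m := c)) k \<cdot>\<^sub>v (u(m := x)) k)"
      using u ev x by (auto simp: orthonormal_def less_Suc_eq)
    thus ?case by blast
  qed
  from this[of d] show ?thesis by (auto simp: eigenbasis_def)
qed

lemma eigenbasis_mult:
  assumes A: "A \<in> carrier_mat d d" "transpose_mat A = A" and e: "eigenbasis d A u \<mu>"
    and "x \<in> carrier_vec d" "k < d"
  shows "u k \<bullet> (A *\<^sub>v x) = \<mu> k * (u k \<bullet> x)"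
proof -
  have uk: "u k \<in> carrier_vec d" "A *\<^sub>v u k = \<mu> k \<cdot>\<^sub>v u k"
    using e assms by (auto simp: eigenbasis_def orthonormal_def)
  show ?thesis using symmetric_bilinear[OF A uk(1)] assms uk by simp
qed

lemma eigenbasis_form:
  assumes A: "A \<in> carrier_mat d d" "transpose_mat A = A" and e: "eigenbasis d A u \<mu>"
    and x: "x \<in> carrier_vec d" and y: "y \<in> carrier_vec d"
  shows "x \<bullet> (A *\<^sub>v y) = (\<Sum>k<d. \<mu> k * (x \<bullet> u k) * (u k \<bullet> y))"
proof -
  have "orthonormal d d u" using e by (simp add: eigenbasis_def)
  moreover have "A *\<^sub>v y \<in> carrier_vec d" using A y by simp
  ultimately have "x \<bullet> (A *\<^sub>v y) = (\<Sum>k<d. (x \<bullet> u k) * (u k \<bullet> (A *\<^sub>v y)))" using parseval x by blast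
  also have "\<dots> = (\<Sum>k<d. \<mu> k * (x \<bullet> u k) * (u k \<bullet> y))"
    using eigenbasis_mult[OF A e y] by (intro sum.cong) auto
  finally show ?thesis .
qed

lemma eigenbasis_diag:
  assumes A: "A \<in> carrier_mat d d" "transpose_mat A = A" and e: "eigenbasis d A u \<mu>" and "k < d"
  shows "u k \<bullet> (A *\<^sub>v u k) = \<mu> k"
  using e assms by (auto simp: eigenbasis_def orthonormal_def)

lemma eigenbasis_quadratic:
  assumes A: "A \<in> carrier_mat d d" "transpose_mat A = A" and e: "eigenbasis d A u \<mu>"
    and x: "x \<in> carrier_vec d"
  shows "x \<bullet> (A *\<^sub>v x) = (\<Sum>k<d. \<mu> k * (x \<bullet> u k)\<^sup>2)"
  unfolding eigenbasis_form[OF A e x x]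
proof (intro sum.cong refl)
  fix k assume "k \<in> {..<d}"
  hence "u k \<in> carrier_vec d" using e by (simp add: eigenbasis_def orthonormal_def)
  thus "\<mu> k * (x \<bullet> u k) * (u k \<bullet> x) = \<mu> k * (x \<bullet> u k)\<^sup>2"
    using comm_scalar_prod[OF x] by (simp add: power2_eq_square)
qed

lemma parseval_square:
  assumes u: "orthonormal d d u" and x: "x \<in> carrier_vec d"
  shows "x \<bullet> x = (\<Sum>k<d. (x \<bullet> u k)\<^sup>2)"
  unfolding parseval[OF u x x]
proof (intro sum.cong refl)
  fix k assume "k \<in> {..<d}"
  hence "u k \<in> carrier_vec d" using u by (simp add: orthonormal_def)
  thus "(x \<bullet> u k) * (u k \<bullet> x) = (x \<bullet> u k)\<^sup>2"
    using comm_scalar_prod[OF x] by (simp add: power2_eq_square)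
qed

lemma vec_eq_from_inner:
  fixes x y :: "real vec"
  assumes "x \<in> carrier_vec d" "y \<in> carrier_vec d" "\<And>z. z \<in> carrier_vec d \<Longrightarrow> z \<bullet> x = z \<bullet> y"
  shows "x = y"
proof (intro eq_vecI)
  fix i assume "i < dim_vec y"
  thus "x $ i = y $ i" using assms(1,2) assms(3)[of "unit_vec d i"] by auto
qed (use assms in auto)

lemma mat_eq_from_mult_vec:
  fixes A B :: "real mat"
  assumes "A \<in> carrier_mat d d" "B \<in> carrier_mat d d"
    "\<And>z. z \<in> carrier_vec d \<Longrightarrow> A *\<^sub>v z = B *\<^sub>v z"
  shows "A = B"
proof (intro eq_matI)
  fix i j assume "i < dim_row B" "j < dim_col B"
  thus "A $$ (i, j) = B $$ (i, j)" using assms(1,2) arg_cong[OF assms(3)[of "unit_vec d j"], of "\<lambda>v. v $ i"] by auto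
qed (use assms in auto)

section \<open>Functional calculus in an eigenbasis, and square roots\<close>

definition spectral_mat :: "nat \<Rightarrow> (nat \<Rightarrow> real vec) \<Rightarrow> (nat \<Rightarrow> real) \<Rightarrow> real mat" where
  "spectral_mat d u r = Matrix.mat d d (\<lambda>(a, b). \<Sum>k<d. r k * u k $ a * u k $ b)"

lemma spectral_mat_carrier [simp]: "spectral_mat d u r \<in> carrier_mat d d"
  by (simp add: spectral_mat_def)

lemma spectral_mat_sym: "transpose_mat (spectral_mat d u r) = spectral_mat d u r"
  by (intro eq_matI) (auto simp: spectral_mat_def intro!: sum.cong)

lemma spectral_mat_eigenbasis:
  assumes u: "orthonormal d d u"
  shows "eigenbasis d (spectral_mat d u r) u r"
  unfolding eigenbasis_def
proof (intro conjI allI impI u)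
  fix k assume k: "k < d"
  note uc = orthonormal_carrier[OF u]
  show "spectral_mat d u r *\<^sub>v u k = r k \<cdot>\<^sub>v u k"
  proof (intro eq_vecI)
    fix a assume "a < dim_vec (r k \<cdot>\<^sub>v u k)"
    hence a: "a < d" using uc[OF k] by simp
    have "(spectral_mat d u r *\<^sub>v u k) $ a = (\<Sum>b<d. \<Sum>j<d. r j * u j $ a * (u j $ b * u k $ b))"
      unfolding mult_mat_vec_nth[OF spectral_mat_carrier uc[OF k] a]
      using a by (intro sum.cong refl) (simp add: spectral_mat_def sum_distrib_right mult.assoc)
    also have "\<dots> = (\<Sum>j<d. r j * u j $ a * (u j \<bullet> u k))"
      by (subst sum.swap) (use uc k in \<open>simp add: scalar_prod_sum[where d = d] sum_distrib_left\<close>)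
    also have "\<dots> = (\<Sum>j<d. r j * u j $ a * (if j = k then 1 else 0))"
      using u k by (intro sum.cong) (auto simp: orthonormal_def)
    also have "\<dots> = r k * u k $ a" using k by (simp add: if_distrib[where f = "\<lambda>z. _ * z"] cong: if_cong)
    finally show "(spectral_mat d u r *\<^sub>v u k) $ a = (r k \<cdot>\<^sub>v u k) $ a" using a uc[OF k] by simp
  qed (use uc[OF k] in \<open>simp add: spectral_mat_def\<close>)
qed

lemma spectral_mat_form:
  assumes "orthonormal d d u" "y \<in> carrier_vec d" "z \<in> carrier_vec d"
  shows "y \<bullet> (spectral_mat d u r *\<^sub>v z) = (\<Sum>k<d. r k * (y \<bullet> u k) * (u k \<bullet> z))"
  by (rule eigenbasis_form[OF spectral_mat_carrier spectral_mat_sym spectral_mat_eigenbasis]) (use assms in auto)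

lemma mat_eq_from_form:
  fixes A B :: "real mat"
  assumes A: "A \<in> carrier_mat d d" and B: "B \<in> carrier_mat d d"
    and eq: "\<And>y z. y \<in> carrier_vec d \<Longrightarrow> z \<in> carrier_vec d \<Longrightarrow> y \<bullet> (A *\<^sub>v z) = y \<bullet> (B *\<^sub>v z)"
  shows "A = B"
  using A B by (intro mat_eq_from_mult_vec[OF A B] vec_eq_from_inner[where d = d] eq mult_mat_vec_carrier)

lemma mult_mult_vec:
  "A \<in> carrier_mat d d \<Longrightarrow> B \<in> carrier_mat d d \<Longrightarrow> z \<in> carrier_vec d \<Longrightarrow>
    (A * B) *\<^sub>v z = A *\<^sub>v (B *\<^sub>v (z :: real vec))"
  by (rule assoc_mult_mat_vec)

text \<open>Functions of one matrix multiply pointwise on its spectrum; square roots and inverse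
  square roots are read off from this.\<close>

lemma spectral_mat_mult:
  assumes u: "orthonormal d d u"
  shows "spectral_mat d u r * spectral_mat d u q = spectral_mat d u (\<lambda>k. r k * q k)"
proof (rule mat_eq_from_form[where d = d])
  fix y z :: "real vec" assume y: "y \<in> carrier_vec d" and z: "z \<in> carrier_vec d"
  have qz: "spectral_mat d u q *\<^sub>v z \<in> carrier_vec d" by (rule mult_mat_vec_carrier[OF spectral_mat_carrier z])
  have "y \<bullet> ((spectral_mat d u r * spectral_mat d u q) *\<^sub>v z)
      = (\<Sum>k<d. r k * (y \<bullet> u k) * (u k \<bullet> (spectral_mat d u q *\<^sub>v z)))"
    unfolding mult_mult_vec[OF spectral_mat_carrier spectral_mat_carrier z]
    by (rule spectral_mat_form[OF u y qz])
  also have "\<dots> = (\<Sum>k<d. r k * q k * (y \<bullet> u k) * (u k \<bullet> z))"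
    using eigenbasis_mult[OF spectral_mat_carrier spectral_mat_sym spectral_mat_eigenbasis[OF u] z]
    by (intro sum.cong) auto
  finally show "y \<bullet> ((spectral_mat d u r * spectral_mat d u q) *\<^sub>v z)
      = y \<bullet> (spectral_mat d u (\<lambda>k. r k * q k) *\<^sub>v z)"
    using spectral_mat_form[OF u y z] by simp
qed (auto intro: mult_carrier_mat[of _ d d])

lemma spectral_mat_eq:
  assumes A: "A \<in> carrier_mat d d" "transpose_mat A = A" and e: "eigenbasis d A u \<mu>"
  shows "A = spectral_mat d u \<mu>"
proof (rule mat_eq_from_form[OF A(1) spectral_mat_carrier])
  fix y z :: "real vec" assume "y \<in> carrier_vec d" "z \<in> carrier_vec d"
  thus "y \<bullet> (A *\<^sub>v z) = y \<bullet> (spectral_mat d u \<mu> *\<^sub>v z)"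
    using eigenbasis_form[OF A e] spectral_mat_form e by (auto simp: eigenbasis_def)
qed

lemma is_psd_eigenvalues_nonneg:
  assumes "is_psd A" "A \<in> carrier_mat d d" "eigenbasis d A u \<mu>" "k < d"
  shows "0 \<le> \<mu> k"
proof -
  have "u k \<in> carrier_vec d" using assms by (simp add: eigenbasis_def orthonormal_def)
  moreover have "transpose_mat A = A" using assms by (simp add: is_psd_def)
  ultimately show ?thesis using eigenbasis_diag[OF assms(2) _ assms(3,4)] assms(1,2)
    by (metis carrier_matD(1) is_psd_def)
qed

text \<open>Applying the common square between \<open>w j\<close> and \<open>u k\<close> shows
  \<open>(t j)\<^sup>2 = (r k)\<^sup>2\<close> wherever the overlap \<open>w j \<bullet> u k\<close>
  is nonzero, and nonnegativity removes the squares. The forms of R and S, expanded in both bases,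
  then agree term by term, without simultaneous diagonalisation.\<close>

lemma psd_square_root_unique:
  assumes R: "R \<in> carrier_mat d d" "is_psd R" and S: "S \<in> carrier_mat d d" "is_psd S"
    and RS: "R * R = S * S"
  shows "R = S"
proof -
  have Rt: "transpose_mat R = R" and St: "transpose_mat S = S" using R S by (auto simp: is_psd_def)
  obtain u r where eR: "eigenbasis d R u r" using symmetric_eigenbasis_exists[OF R(1) Rt] by blast
  obtain w t where eS: "eigenbasis d S w t" using symmetric_eigenbasis_exists[OF S(1) St] by blast
  have on: "orthonormal d d u" "orthonormal d d w" using eR eS by (auto simp: eigenbasis_def)
  note uc = orthonormal_carrier[OF on(1)] and wc = orthonormal_carrier[OF on(2)]
  have key: "t j * (w j \<bullet> u k) = r k * (w j \<bullet> u k)" if jk: "j < d" "k < d" for j k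
  proof -
    have Ru: "R *\<^sub>v u k = r k \<cdot>\<^sub>v u k" using eR jk by (simp add: eigenbasis_def)
    have "w j \<bullet> ((R * R) *\<^sub>v u k) = r k * (w j \<bullet> (R *\<^sub>v u k))"
      unfolding mult_mult_vec[OF R(1) R(1) uc[OF jk(2)]] Ru
      using R(1) uc[OF jk(2)] wc[OF jk(1)] by (simp add: mult_mat_vec[of _ d d] Ru)
    also have "\<dots> = r k * (r k * (w j \<bullet> u k))" using Ru uc[OF jk(2)] wc[OF jk(1)] by simp
    finally have 1: "w j \<bullet> ((R * R) *\<^sub>v u k) = (r k)\<^sup>2 * (w j \<bullet> u k)" by (simp add: power2_eq_square)
    have Su: "S *\<^sub>v u k \<in> carrier_vec d" using S(1) uc[OF jk(2)] by simp
    have "w j \<bullet> ((S * S) *\<^sub>v u k) = (t j)\<^sup>2 * (w j \<bullet> u k)"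
      unfolding mult_mult_vec[OF S(1) S(1) uc[OF jk(2)]]
      using eigenbasis_mult[OF S(1) St eS Su jk(1)] eigenbasis_mult[OF S(1) St eS uc[OF jk(2)] jk(1)]
      by (simp add: power2_eq_square)
    with 1 RS have "(t j)\<^sup>2 * (w j \<bullet> u k) = (r k)\<^sup>2 * (w j \<bullet> u k)" by simp
    moreover have "0 \<le> t j" "0 \<le> r k" using is_psd_eigenvalues_nonneg R S eR eS jk by blast+
    ultimately show ?thesis by auto
  qed
  show ?thesis
  proof (rule mat_eq_from_form[OF R(1) S(1)])
    fix y z :: "real vec" assume y: "y \<in> carrier_vec d" and z: "z \<in> carrier_vec d"
    have "y \<bullet> (R *\<^sub>v z) = (\<Sum>k<d. \<Sum>j<d. (y \<bullet> w j) * (r k * (w j \<bullet> u k)) * (u k \<bullet> z))"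
      unfolding eigenbasis_form[OF R(1) Rt eR y z]
      using parseval[OF on(2) y uc] by (intro sum.cong refl) (simp add: sum_distrib_left sum_distrib_right mult_ac)
    also have "\<dots> = (\<Sum>j<d. \<Sum>k<d. (y \<bullet> w j) * (t j * (w j \<bullet> u k)) * (u k \<bullet> z))"
      by (subst sum.swap) (auto simp: key intro!: sum.cong)
    also have "\<dots> = y \<bullet> (S *\<^sub>v z)"
      unfolding eigenbasis_form[OF S(1) St eS y z]
      using parseval[OF on(1) wc z] by (intro sum.cong refl) (simp add: sum_distrib_left sum_distrib_right mult_ac)
    finally show "y \<bullet> (R *\<^sub>v z) = y \<bullet> (S *\<^sub>v z)" .
  qed
qed

text \<open>Resolves the definite description: square roots of the eigenvalues give existence,
  \<open>psd_square_root_unique\<close> gives uniqueness.\<close>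

lemma mat_sqrt:
  assumes H: "H \<in> carrier_mat d d" "is_psd H"
  shows "mat_sqrt H \<in> carrier_mat d d" "transpose_mat (mat_sqrt H) = mat_sqrt H"
    "mat_sqrt H * mat_sqrt H = H"
proof -
  have Ht: "transpose_mat H = H" using H by (simp add: is_psd_def)
  obtain u \<mu> where e: "eigenbasis d H u \<mu>" using symmetric_eigenbasis_exists[OF H(1) Ht] by blast
  have on: "orthonormal d d u" using e by (simp add: eigenbasis_def)
  have nn: "0 \<le> \<mu> k" if "k < d" for k using is_psd_eigenvalues_nonneg[OF H(2,1) e that] .
  define R where "R = spectral_mat d u (\<lambda>k. sqrt (\<mu> k))"
  have Rc: "R \<in> carrier_mat d d" by (simp add: R_def)
  have "is_psd R"
    unfolding is_psd_def
  proof (intro conjI ballI)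
    show "square_mat R" using Rc by simp
    show Rt: "transpose_mat R = R" by (simp add: R_def spectral_mat_sym)
    fix v :: "real vec" assume "v \<in> carrier_vec (dim_row R)"
    hence v: "v \<in> carrier_vec d" using Rc by simp
    show "0 \<le> v \<bullet> (R *\<^sub>v v)"
      unfolding eigenbasis_quadratic[OF Rc Rt spectral_mat_eigenbasis[OF on, of "\<lambda>k. sqrt (\<mu> k)", folded R_def] v]
      using nn by (intro sum_nonneg) auto
  qed
  moreover have "R * R = H"
  proof -
    have "R * R = spectral_mat d u (\<lambda>k. sqrt (\<mu> k) * sqrt (\<mu> k))"
      unfolding R_def by (rule spectral_mat_mult[OF on])
    also have "\<dots> = spectral_mat d u \<mu>"
      unfolding spectral_mat_def using nn by (intro cong_mat) (auto intro!: sum.cong)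
    also have "\<dots> = H" using spectral_mat_eq[OF H(1) Ht e] by simp
    finally show ?thesis .
  qed
  ultimately have "\<exists>!R. R \<in> carrier_mat (dim_row H) (dim_row H) \<and> is_psd R \<and> R * R = H"
    using psd_square_root_unique[where d = d] H(1) Rc by (intro ex1I[of _ R]) auto
  from theI'[OF this, folded mat_sqrt_def] show "mat_sqrt H \<in> carrier_mat d d" "transpose_mat (mat_sqrt H) = mat_sqrt H"
    "mat_sqrt H * mat_sqrt H = H"
    using H(1) by (auto simp: is_psd_def)
qed

lemma norm2_mat_sqrt:
  assumes H: "H \<in> carrier_mat d d" "is_psd H" and x: "x \<in> carrier_vec d"
  shows "(norm2 (mat_sqrt H *\<^sub>v x))\<^sup>2 = x \<bullet> (H *\<^sub>v x)"
proof -
  note R = mat_sqrt[OF H]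
  have "x \<bullet> (H *\<^sub>v x) = x \<bullet> (mat_sqrt H *\<^sub>v (mat_sqrt H *\<^sub>v x))"
    using mult_mult_vec[OF R(1) R(1) x] R(3) by simp
  also have "\<dots> = (mat_sqrt H *\<^sub>v x) \<bullet> (mat_sqrt H *\<^sub>v x)"
    using R(1) x by (intro symmetric_bilinear[OF R(1,2) x]) simp
  finally show ?thesis by (simp add: norm2_sq)
qed

section \<open>Positive definite matrices, singular values, pseudoinverse and spectral norm\<close>

definition pos_def :: "nat \<Rightarrow> real mat \<Rightarrow> bool" where
  "pos_def d H \<longleftrightarrow> H \<in> carrier_mat d d \<and> transpose_mat H = H
     \<and> (\<forall>x \<in> carrier_vec d. x \<noteq> 0\<^sub>v d \<longrightarrow> 0 < x \<bullet> (H *\<^sub>v x))"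

lemma pos_def_nonneg: "pos_def d H \<Longrightarrow> x \<in> carrier_vec d \<Longrightarrow> 0 \<le> x \<bullet> (H *\<^sub>v x)"
  by (cases "x = 0\<^sub>v d") (auto simp: pos_def_def intro: less_imp_le)

lemma pos_def_is_psd: "pos_def d H \<Longrightarrow> is_psd H"
  using pos_def_nonneg[of d H] by (auto simp: is_psd_def pos_def_def)

lemma finite_eigenvalues:
  assumes "A \<in> carrier_mat d d"
  shows "finite {k :: real. eigenvalue A k}"
proof -
  have "char_poly A \<noteq> 0" using degree_monic_char_poly[OF assms] by auto
  thus ?thesis using poly_roots_finite eigenvalue_root_char_poly[OF assms] by auto
qed

text \<open>Each eigenvalue of the symmetric H is a singular value, because
  \<open>transpose_mat H * H\<close> acts on \<open>u k\<close> as its square; it therefore lies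
  between the minimum and the maximum of a finite set, nonempty as d \<ge> 1. A smallest singular
  value 0 would put a nonzero vector into the kernel of H.\<close>

lemma sigma_bounds:
  assumes H: "pos_def d H" and d: "1 \<le> d"
  shows "0 < sigma_min H"
    "\<And>x. x \<in> carrier_vec d \<Longrightarrow> sigma_min H * (x \<bullet> x) \<le> x \<bullet> (H *\<^sub>v x)"
    "\<And>x. x \<in> carrier_vec d \<Longrightarrow> x \<bullet> (H *\<^sub>v x) \<le> sigma_max H * (x \<bullet> x)"
proof -
  have Hc: "H \<in> carrier_mat d d" and Ht: "transpose_mat H = H" using H by (auto simp: pos_def_def)
  have HHc: "transpose_mat H * H \<in> carrier_mat d d" using Hc by simp
  obtain u \<mu> where e: "eigenbasis d H u \<mu>" using symmetric_eigenbasis_exists[OF Hc Ht] by blast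
  have on: "orthonormal d d u" using e by (simp add: eigenbasis_def)
  note uc = orthonormal_carrier[OF on]
  let ?V = "singular_values H"
  have "?V \<subseteq> sqrt ` {k. eigenvalue (transpose_mat H * H) k}"
  proof
    fix \<sigma> assume "\<sigma> \<in> ?V"
    hence "\<sigma> = sqrt (\<sigma>\<^sup>2)" "eigenvalue (transpose_mat H * H) (\<sigma>\<^sup>2)" by (simp_all add: singular_values_def)
    thus "\<sigma> \<in> sqrt ` {k. eigenvalue (transpose_mat H * H) k}" by blast
  qed
  hence fin: "finite ?V" using finite_eigenvalues[OF HHc] finite_subset by blast
  have mem: "\<mu> k \<in> ?V" if k: "k < d" for k
  proof -
    have Hu: "H *\<^sub>v u k = \<mu> k \<cdot>\<^sub>v u k" using e k by (simp add: eigenbasis_def)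
    have uu: "u k \<bullet> u k = 1" using on k by (simp add: orthonormal_def)
    hence "u k \<noteq> 0\<^sub>v d" using uc[OF k] by auto
    moreover have "(transpose_mat H * H) *\<^sub>v u k = (\<mu> k)\<^sup>2 \<cdot>\<^sub>v u k"
      unfolding Ht mult_mult_vec[OF Hc Hc uc[OF k]] Hu
      using Hc uc[OF k] by (simp add: mult_mat_vec[of _ d d] Hu smult_smult_assoc power2_eq_square)
    ultimately have "eigenvalue (transpose_mat H * H) ((\<mu> k)\<^sup>2)"
      using uc[OF k] Hc by (auto simp: eigenvalue_def eigenvector_def intro!: exI[of _ "u k"])
    moreover have "0 \<le> \<mu> k" using is_psd_eigenvalues_nonneg[OF pos_def_is_psd[OF H] Hc e k] .
    ultimately show ?thesis by (simp add: singular_values_def)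
  qed
  have "?V \<noteq> {}" using mem[of 0] d by auto
  hence "sigma_min H \<in> ?V" using fin unfolding sigma_min_def by (intro Min_in)
  then obtain x where sn: "0 \<le> sigma_min H" and x: "x \<in> carrier_vec d" "x \<noteq> 0\<^sub>v d"
      "(transpose_mat H * H) *\<^sub>v x = (sigma_min H)\<^sup>2 \<cdot>\<^sub>v x"
    using Hc by (auto simp: singular_values_def eigenvalue_def eigenvector_def)
  have "sigma_min H \<noteq> 0"
  proof
    assume s0: "sigma_min H = 0"
    have Hx: "H *\<^sub>v x \<in> carrier_vec d" using Hc x by simp
    have "(H *\<^sub>v x) \<bullet> (H *\<^sub>v x) = x \<bullet> (H *\<^sub>v (H *\<^sub>v x))"
      using symmetric_bilinear[OF Hc Ht x(1) Hx] by simp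
    also have "\<dots> = 0" using x s0 mult_mult_vec[OF Hc Hc x(1)] by (simp add: Ht)
    finally have "H *\<^sub>v x = 0\<^sub>v d" using scalar_prod_self_eq_0_iff[OF Hx] by simp
    hence "x \<bullet> (H *\<^sub>v x) = 0" using x by simp
    thus False using H x by (auto simp: pos_def_def)
  qed
  thus "0 < sigma_min H" using sn by simp
  fix x :: "real vec" assume x: "x \<in> carrier_vec d"
  show "sigma_min H * (x \<bullet> x) \<le> x \<bullet> (H *\<^sub>v x)" "x \<bullet> (H *\<^sub>v x) \<le> sigma_max H * (x \<bullet> x)"
    unfolding eigenbasis_quadratic[OF Hc Ht e x] parseval_square[OF on x] sum_distrib_left
    using mem fin by (auto intro!: sum_mono mult_right_mono simp: sigma_min_def sigma_max_def)
qed

text \<open>An inverse satisfies the Penrose equations, and multiplying \<open>M * X * M = M\<close>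
  by N on the right and then on the left gives X = N.\<close>

lemma pinv_eq_inverse:
  assumes M: "M \<in> carrier_mat d d" and N: "N \<in> carrier_mat d d" and MN: "M * N = 1\<^sub>m d"
  shows "pinv M = N"
proof -
  have NM: "N * M = 1\<^sub>m d" using mat_mult_left_right_inverse[OF M N MN] .
  have "X = N" if X: "X \<in> carrier_mat d d" "M * X * M = M" for X
  proof -
    have MX: "M * X \<in> carrier_mat d d" using M X by simp
    have "M * X = M * X * (M * N)" using right_mult_one_mat[OF MX] by (simp only: MN)
    also have "\<dots> = M * X * M * N" using assoc_mult_mat[OF MX M N] by simp
    also have "\<dots> = 1\<^sub>m d" using X MN by simp
    finally have MX1: "M * X = 1\<^sub>m d" .
    have "X = N * M * X" using NM X by simp
    also have "\<dots> = N * (M * X)" using assoc_mult_mat[OF N M X(1)] by simp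
    finally show ?thesis using MX1 N by simp
  qed
  note unique = this
  have "M * N * M = M" "N * M * N = N" using M N MN NM by simp_all
  thus ?thesis
    unfolding pinv_def carrier_matD[OF M]
    using N MN NM by (intro the_equality) (simp, blast intro: unique)
qed

lemma cauchy_schwarz_vec:
  assumes "x \<in> carrier_vec d" "y \<in> carrier_vec d"
  shows "\<bar>x \<bullet> y\<bar> \<le> norm2 x * norm2 y"
proof -
  have "(x \<bullet> y)\<^sup>2 \<le> (x \<bullet> x) * (y \<bullet> y)"
    using Cauchy_Schwarz_ineq_sum[of "\<lambda>a. x $ a" "\<lambda>a. y $ a" "{..<d}"] assms
    by (simp add: scalar_prod_sum[where d = d] power2_eq_square)
  also have "\<dots> = (norm2 x * norm2 y)\<^sup>2" by (simp add: power_mult_distrib norm2_sq)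
  finally show ?thesis by (simp add: abs_le_square_iff[symmetric] abs_mult norm2_nonneg)
qed

text \<open>The supremum defining \<open>spec_norm\<close> says something only for a bounded set;
  the sum of the absolute eigenvalues of \<open>transpose_mat M * M\<close> provides a crude but
  finite bound. The rest is scaling to a unit vector.\<close>

lemma norm2_mult_le_spec_norm:
  assumes M: "M \<in> carrier_mat d d" and x: "x \<in> carrier_vec d"
  shows "norm2 (M *\<^sub>v x) \<le> spec_norm M * norm2 x"
proof -
  let ?N = "transpose_mat M * M"
  have N: "?N \<in> carrier_mat d d" "transpose_mat ?N = ?N"
    using M by (simp, subst transpose_mult[of _ d d _ d], simp_all)
  obtain u \<mu> where e: "eigenbasis d ?N u \<mu>" using symmetric_eigenbasis_exists[OF N] by blast
  have on: "orthonormal d d u" using e by (simp add: eigenbasis_def)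
  have sq: "(norm2 (M *\<^sub>v y))\<^sup>2 \<le> (\<Sum>k<d. \<bar>\<mu> k\<bar>) * (y \<bullet> y)" if y: "y \<in> carrier_vec d" for y
  proof -
    have My: "M *\<^sub>v y \<in> carrier_vec d" using M y by simp
    have "y \<bullet> (?N *\<^sub>v y) = y \<bullet> (transpose_mat M *\<^sub>v (M *\<^sub>v y))"
      using mult_mult_vec[OF _ M y, of "transpose_mat M"] M by simp
    also have "\<dots> = (M *\<^sub>v y) \<bullet> (M *\<^sub>v y)"
      using transpose_vec_mult_scalar[OF _ My y, of "transpose_mat M"] M by simp
    finally have "(norm2 (M *\<^sub>v y))\<^sup>2 = (\<Sum>k<d. \<mu> k * (y \<bullet> u k)\<^sup>2)"
      using eigenbasis_quadratic[OF N e y] by (simp add: norm2_sq)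
    also have "\<dots> \<le> (\<Sum>k<d. (\<Sum>j<d. \<bar>\<mu> j\<bar>) * (y \<bullet> u k)\<^sup>2)"
    proof (intro sum_mono mult_right_mono)
      fix k assume "k \<in> {..<d}"
      hence "\<bar>\<mu> k\<bar> \<le> (\<Sum>j<d. \<bar>\<mu> j\<bar>)" by (intro member_le_sum) auto
      thus "\<mu> k \<le> (\<Sum>j<d. \<bar>\<mu> j\<bar>)" by linarith
    qed auto
    also have "\<dots> = (\<Sum>k<d. \<bar>\<mu> k\<bar>) * (y \<bullet> y)"
      unfolding parseval_square[OF on y] by (simp add: sum_distrib_left)
    finally show ?thesis .
  qed
  have bdd: "bdd_above ((\<lambda>v. norm2 (M *\<^sub>v v)) ` {v \<in> carrier_vec (dim_col M). norm2 v \<le> 1})"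
  proof (rule bdd_aboveI2)
    fix v assume v: "v \<in> {v \<in> carrier_vec (dim_col M). norm2 v \<le> 1}"
    hence vc: "v \<in> carrier_vec d" using M by simp
    have "v \<bullet> v \<le> 1" using v power_le_one[OF norm2_nonneg[of v], of 2] by (simp add: norm2_sq)
    hence "(\<Sum>k<d. \<bar>\<mu> k\<bar>) * (v \<bullet> v) \<le> (\<Sum>k<d. \<bar>\<mu> k\<bar>)"
      by (intro mult_left_le) (auto intro!: sum_nonneg)
    with sq[OF vc] show "norm2 (M *\<^sub>v v) \<le> sqrt (\<Sum>k<d. \<bar>\<mu> k\<bar>)"
      by (intro real_le_rsqrt) linarith
  qed
  show ?thesis
  proof (cases "x = 0\<^sub>v d")
    case True
    have "M *\<^sub>v 0\<^sub>v d = 0\<^sub>v d" using M by (intro eq_vecI) auto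
    thus ?thesis using True by (simp add: norm2_def)
  next
    case False
    hence nx: "0 < norm2 x" using scalar_prod_self_pos[OF x] by (simp add: norm2_def)
    let ?y = "(1 / norm2 x) \<cdot>\<^sub>v x"
    have ny: "norm2 (c \<cdot>\<^sub>v v) = c * norm2 v" if "v \<in> carrier_vec d" "0 \<le> c" for c v
      using that by (simp add: norm2_def real_sqrt_mult)
    have "?y \<in> {v \<in> carrier_vec (dim_col M). norm2 v \<le> 1}"
      using x M nx ny[OF x, of "1 / norm2 x"] by simp
    from cSUP_upper[OF this bdd] have "norm2 (M *\<^sub>v ?y) \<le> spec_norm M" by (simp add: spec_norm_def)
    moreover have "M *\<^sub>v ?y = (1 / norm2 x) \<cdot>\<^sub>v (M *\<^sub>v x)" using mult_mat_vec[OF M x] .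
    ultimately show ?thesis using nx ny[of "M *\<^sub>v x" "1 / norm2 x"] M x by (simp add: field_simps)
  qed
qed

subsection \<open>Moments of sums of uniformly sampled rank-one matrices\<close>

text \<open>In a^(N+1) - b^(N+1) = (a - b) * T the sum T is symmetrised under q \<mapsto> N - q, and
  each of the N + 1 symmetrised terms is at most a^N + b^N. Evenness of N identifies powers of
  absolute values with powers.\<close>

lemma power_difference_bound:
  fixes a b :: real
  assumes N: "even N"
  shows "(a - b) * (a ^ Suc N - b ^ Suc N) \<le> real (Suc N) / 2 * ((a - b)\<^sup>2 * (a ^ N + b ^ N))"
proof -
  have pair: "a ^ q * b ^ (N - q) + a ^ (N - q) * b ^ q \<le> a ^ N + b ^ N" if q: "q \<le> N" for q
  proof -
    \<comment> \<open>Rearrangement: both powers are monotone in the absolute value, so the two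
      differences have the same sign.\<close>
    have "0 \<le> (\<bar>a\<bar> ^ q - \<bar>b\<bar> ^ q) * (\<bar>a\<bar> ^ (N - q) - \<bar>b\<bar> ^ (N - q))"
    proof (cases "\<bar>a\<bar> \<le> \<bar>b\<bar>")
      case True thus ?thesis by (intro mult_nonpos_nonpos) (auto intro: power_mono)
    next
      case False thus ?thesis by (intro mult_nonneg_nonneg) (auto intro: power_mono)
    qed
    moreover have "\<bar>c\<bar> ^ q * \<bar>c\<bar> ^ (N - q) = c ^ N" for c :: real
      using q N by (simp add: power_add[symmetric] power_even_abs)
    moreover have "a ^ q * b ^ (N - q) \<le> \<bar>a\<bar> ^ q * \<bar>b\<bar> ^ (N - q)"
      "a ^ (N - q) * b ^ q \<le> \<bar>a\<bar> ^ (N - q) * \<bar>b\<bar> ^ q"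
      by (metis abs_ge_self abs_mult power_abs)+
    ultimately show ?thesis by (simp add: algebra_simps)
  qed
  define T where "T = (\<Sum>q<Suc N. a ^ q * b ^ (N - q))"
  have "a ^ Suc N - b ^ Suc N = (a - b) * T"
    unfolding T_def by (subst power_diff_sumr2) (simp add: mult_ac)
  moreover have "T = (\<Sum>q<Suc N. a ^ (N - q) * b ^ q)"
    unfolding T_def by (subst sum.nat_diff_reindex[symmetric]) (auto intro!: sum.cong)
  hence "2 * T = (\<Sum>q<Suc N. a ^ q * b ^ (N - q) + a ^ (N - q) * b ^ q)"
    by (simp add: T_def sum.distrib)
  moreover have "\<dots> \<le> (\<Sum>q<Suc N. a ^ N + b ^ N)" by (intro sum_mono pair) simp
  ultimately have T: "2 * T \<le> real (Suc N) * (a ^ N + b ^ N)" by simp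
  have "(a - b) * (a ^ Suc N - b ^ Suc N) = (a - b)\<^sup>2 * (2 * T) / 2"
    using \<open>a ^ Suc N - b ^ Suc N = (a - b) * T\<close> by (simp add: power2_eq_square)
  also have "\<dots> \<le> (a - b)\<^sup>2 * (real (Suc N) * (a ^ N + b ^ N)) / 2"
    using T by (intro divide_right_mono mult_left_mono) auto
  finally show ?thesis by (simp add: mult_ac)
qed

text \<open>Expanding both sides in the products of the two eigenbases reduces the trace inequality
  to the scalar one, with the nonnegative weights \<open>(u k \<bullet> w j)\<^sup>2\<close>.\<close>

lemma trace_power_difference_bound:
  assumes X: "X \<in> carrier_mat d d" "transpose_mat X = X" and Y: "Y \<in> carrier_mat d d" "transpose_mat Y = Y"
    and eX: "eigenbasis d X u \<mu>" and eY: "eigenbasis d Y w \<nu>" and N: "even N"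
    and K: "\<And>x. x \<in> carrier_vec d \<Longrightarrow> K x = X *\<^sub>v x - Y *\<^sub>v x"
  shows "(\<Sum>k<d. \<mu> k ^ Suc N * (u k \<bullet> (X *\<^sub>v u k) - u k \<bullet> (Y *\<^sub>v u k)))
       - (\<Sum>j<d. \<nu> j ^ Suc N * (w j \<bullet> (X *\<^sub>v w j) - w j \<bullet> (Y *\<^sub>v w j)))
     \<le> real (Suc N) / 2 * ((\<Sum>k<d. \<mu> k ^ N * (K (u k) \<bullet> K (u k))) + (\<Sum>j<d. \<nu> j ^ N * (K (w j) \<bullet> K (w j))))"
proof -
  have on: "orthonormal d d u" "orthonormal d d w" using eX eY by (auto simp: eigenbasis_def)
  note uc = orthonormal_carrier[OF on(1)] and wc = orthonormal_carrier[OF on(2)]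
  \<comment> \<open>Parseval in either basis gives row and column sums 1, so a sum over one spectrum
    can be spread over all pairs of eigenvalues.\<close>
  define c where "c = (\<lambda>k j. (u k \<bullet> w j)\<^sup>2)"
  have c': "c k j = (w j \<bullet> u k)\<^sup>2" if "k < d" "j < d" for k j
    using comm_scalar_prod[OF uc wc] that by (simp add: c_def)
  have uu: "u k \<bullet> u k = 1" "w k \<bullet> w k = 1" if "k < d" for k using on that by (auto simp: orthonormal_def)
  have sumc: "(\<Sum>j<d. c k j) = 1" if "k < d" for k
    using parseval_square[OF on(2) uc[OF that]] uu[OF that] by (simp add: c_def)
  have sumc': "(\<Sum>k<d. c k j) = 1" if "j < d" for j
    using parseval_square[OF on(1) wc[OF that]] uu[OF that] c'[OF _ that] by simp
  have L1: "u k \<bullet> (X *\<^sub>v u k) - u k \<bullet> (Y *\<^sub>v u k) = (\<Sum>j<d. (\<mu> k - \<nu> j) * c k j)" if k: "k < d" for k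
    unfolding eigenbasis_diag[OF X eX k] eigenbasis_quadratic[OF Y eY uc[OF k]]
    using sumc[OF k] by (simp add: c_def left_diff_distrib sum_subtractf sum_distrib_left[symmetric])
  have L2: "w j \<bullet> (X *\<^sub>v w j) - w j \<bullet> (Y *\<^sub>v w j) = (\<Sum>k<d. (\<mu> k - \<nu> j) * c k j)" if j: "j < d" for j
    unfolding eigenbasis_diag[OF Y eY j] eigenbasis_quadratic[OF X eX wc[OF j]]
    using sumc'[OF j] c'[OF _ j]
    by (simp add: left_diff_distrib sum_subtractf sum_distrib_left[symmetric])
  have Kc: "K x \<in> carrier_vec d" if "x \<in> carrier_vec d" for x using K X Y that by simp
  \<comment> \<open>The matrix of X - Y between the two eigenbases: the overlap times the difference
    of the eigenvalues.\<close>
  have Kuw: "(u k \<bullet> K (w j)) = (\<mu> k - \<nu> j) * (u k \<bullet> w j)" "(K (u k) \<bullet> w j) = (\<mu> k - \<nu> j) * (u k \<bullet> w j)"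
    if kj: "k < d" "j < d" for k j
  proof -
    note uk = uc[OF kj(1)] and wj = wc[OF kj(2)]
    have m: "X *\<^sub>v x \<in> carrier_vec d" "Y *\<^sub>v x \<in> carrier_vec d" if "x \<in> carrier_vec d" for x
      using X(1) Y(1) that by simp_all
    have Xu: "X *\<^sub>v u k = \<mu> k \<cdot>\<^sub>v u k" and Yw: "Y *\<^sub>v w j = \<nu> j \<cdot>\<^sub>v w j"
      using eX eY kj by (auto simp: eigenbasis_def)
    have "u k \<bullet> K (w j) = u k \<bullet> (X *\<^sub>v w j) - u k \<bullet> (Y *\<^sub>v w j)"
      unfolding K[OF wj] by (rule scalar_prod_minus_distrib[OF uk m(1)[OF wj] m(2)[OF wj]])
    also have "u k \<bullet> (X *\<^sub>v w j) = \<mu> k * (u k \<bullet> w j)" using eigenbasis_mult[OF X eX wj kj(1)] .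
    also have "u k \<bullet> (Y *\<^sub>v w j) = \<nu> j * (u k \<bullet> w j)" unfolding Yw using uk wj by simp
    finally show "u k \<bullet> K (w j) = (\<mu> k - \<nu> j) * (u k \<bullet> w j)" by (simp add: algebra_simps)
    have "K (u k) \<bullet> w j = (X *\<^sub>v u k) \<bullet> w j - (Y *\<^sub>v u k) \<bullet> w j"
      unfolding K[OF uk] by (rule minus_scalar_prod_distrib[OF m(1)[OF uk] m(2)[OF uk] wj])
    also have "(X *\<^sub>v u k) \<bullet> w j = \<mu> k * (u k \<bullet> w j)" unfolding Xu using uk wj by simp
    also have "(Y *\<^sub>v u k) \<bullet> w j = \<nu> j * (u k \<bullet> w j)"
      using symmetric_bilinear[OF Y uk wj] Yw uk wj by simp
    finally show "K (u k) \<bullet> w j = (\<mu> k - \<nu> j) * (u k \<bullet> w j)" by (simp add: algebra_simps)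
  qed
  have R1: "K (u k) \<bullet> K (u k) = (\<Sum>j<d. (\<mu> k - \<nu> j)\<^sup>2 * c k j)" if k: "k < d" for k
    unfolding parseval_square[OF on(2) Kc[OF uc[OF k]]]
    by (intro sum.cong refl) (use Kuw(2) k in \<open>simp add: c_def power_mult_distrib\<close>)
  have R2: "K (w j) \<bullet> K (w j) = (\<Sum>k<d. (\<mu> k - \<nu> j)\<^sup>2 * c k j)" if j: "j < d" for j
    unfolding parseval_square[OF on(1) Kc[OF wc[OF j]]]
    by (intro sum.cong refl)
       (use Kuw(1) j comm_scalar_prod[OF Kc[OF wc[OF j]] uc] in \<open>simp add: c_def power_mult_distrib\<close>)
  have "(\<Sum>k<d. \<mu> k ^ Suc N * (u k \<bullet> (X *\<^sub>v u k) - u k \<bullet> (Y *\<^sub>v u k)))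
       - (\<Sum>j<d. \<nu> j ^ Suc N * (w j \<bullet> (X *\<^sub>v w j) - w j \<bullet> (Y *\<^sub>v w j)))
     = (\<Sum>k<d. \<Sum>j<d. \<mu> k ^ Suc N * ((\<mu> k - \<nu> j) * c k j)) - (\<Sum>j<d. \<Sum>k<d. \<nu> j ^ Suc N * ((\<mu> k - \<nu> j) * c k j))"
    by (intro arg_cong2[where f = "(-)"] sum.cong refl) (simp_all add: L1 L2 sum_distrib_left)
  also have "(\<Sum>j<d. \<Sum>k<d. \<nu> j ^ Suc N * ((\<mu> k - \<nu> j) * c k j)) = (\<Sum>k<d. \<Sum>j<d. \<nu> j ^ Suc N * ((\<mu> k - \<nu> j) * c k j))"
    by (rule sum.swap)
  also have "(\<Sum>k<d. \<Sum>j<d. \<mu> k ^ Suc N * ((\<mu> k - \<nu> j) * c k j)) - \<dots>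
      = (\<Sum>k<d. \<Sum>j<d. c k j * ((\<mu> k - \<nu> j) * (\<mu> k ^ Suc N - \<nu> j ^ Suc N)))"
    by (simp add: sum_subtractf[symmetric] algebra_simps del: power_Suc)
  also have "\<dots> \<le> (\<Sum>k<d. \<Sum>j<d. c k j * (real (Suc N) / 2 * ((\<mu> k - \<nu> j)\<^sup>2 * (\<mu> k ^ N + \<nu> j ^ N))))"
    by (intro sum_mono mult_left_mono power_difference_bound N) (simp add: c_def)
  also have "\<dots> = real (Suc N) / 2 * ((\<Sum>k<d. \<Sum>j<d. \<mu> k ^ N * ((\<mu> k - \<nu> j)\<^sup>2 * c k j))
      + (\<Sum>k<d. \<Sum>j<d. \<nu> j ^ N * ((\<mu> k - \<nu> j)\<^sup>2 * c k j)))"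
    unfolding sum.distrib[symmetric] sum_distrib_left
    by (intro sum.cong refl) (simp only: distrib_left distrib_right mult_ac)
  also have "(\<Sum>k<d. \<Sum>j<d. \<nu> j ^ N * ((\<mu> k - \<nu> j)\<^sup>2 * c k j)) = (\<Sum>j<d. \<Sum>k<d. \<nu> j ^ N * ((\<mu> k - \<nu> j)\<^sup>2 * c k j))"
    by (rule sum.swap)
  finally show ?thesis
    by (simp add: R1 R2 sum_distrib_left[symmetric] del: power_Suc)
qed

text \<open>The weight c is 1 for the sampled sum, s / n for s times the mean, and 1 / n or 1 / s
  for the part of the exact or sub-sampled Hessian without ridge term.\<close>

definition gram_mat :: "nat \<Rightarrow> nat \<Rightarrow> real \<Rightarrow> (nat \<Rightarrow> real vec) \<Rightarrow> real mat" where
  "gram_mat d m c v = Matrix.mat d d (\<lambda>(a, b). \<Sum>i<m. c * (v i $ a * v i $ b))"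

lemma gram_mat_carrier [simp]: "gram_mat d m c v \<in> carrier_mat d d"
  by (simp add: gram_mat_def)

lemma gram_mat_sym: "transpose_mat (gram_mat d m c v) = gram_mat d m c v"
  by (intro eq_matI) (auto simp: gram_mat_def mult.commute intro!: sum.cong)

lemma gram_mat_form:
  assumes v: "\<And>i. i < m \<Longrightarrow> v i \<in> carrier_vec d" and x: "x \<in> carrier_vec d" and y: "y \<in> carrier_vec d"
  shows "x \<bullet> (gram_mat d m c v *\<^sub>v y) = (\<Sum>i<m. c * ((v i \<bullet> x) * (v i \<bullet> y)))"
proof -
  have "x \<bullet> (gram_mat d m c v *\<^sub>v y) = (\<Sum>a<d. \<Sum>b<d. \<Sum>i<m. c * ((v i $ a * x $ a) * (v i $ b * y $ b)))"
    unfolding bilinear_sum[OF gram_mat_carrier x y]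
    by (intro sum.cong refl) (simp add: gram_mat_def sum_distrib_left sum_distrib_right mult_ac)
  also have "\<dots> = (\<Sum>a<d. \<Sum>i<m. \<Sum>b<d. c * ((v i $ a * x $ a) * (v i $ b * y $ b)))"
    by (intro sum.cong refl sum.swap)
  also have "\<dots> = (\<Sum>i<m. \<Sum>a<d. \<Sum>b<d. c * ((v i $ a * x $ a) * (v i $ b * y $ b)))"
    by (rule sum.swap)
  also have "\<dots> = (\<Sum>i<m. c * ((v i \<bullet> x) * (v i \<bullet> y)))"
    using v x y
    by (intro sum.cong refl) (simp add: scalar_prod_sum[where d = d] sum_distrib_left[symmetric] sum_distrib_right[symmetric])
  finally show ?thesis .
qed


text \<open>The setting after whitening: \<open>cov_le\<close> says that the mean outer product M of
  the \<open>v j\<close> is at most the identity, and m will be n times the largest ridge leverage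
  score.\<close>

locale row_sampling =
  fixes d n s :: nat and v :: "nat \<Rightarrow> real vec" and m :: real
  assumes n: "0 < n" and s: "0 < s"
    and v: "\<And>j. j < n \<Longrightarrow> v j \<in> carrier_vec d"
    and v_le: "\<And>j. j < n \<Longrightarrow> v j \<bullet> v j \<le> m"
    and cov_le: "\<And>x. x \<in> carrier_vec d \<Longrightarrow> (\<Sum>j<n. (v j \<bullet> x)\<^sup>2) \<le> real n * (x \<bullet> x)"
begin

text \<open>The support of the sampling law; entries from s on carry the default value 0.\<close>

definition samples :: "(nat \<Rightarrow> nat) set" where
  "samples = PiE_dflt {..<s} 0 (\<lambda>_. {..<n})"

text \<open>The quadratic form of the mean M.\<close>

definition cov :: "real vec \<Rightarrow> real" where
  "cov x = (\<Sum>j<n. (v j \<bullet> x)\<^sup>2) / real n"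

text \<open>The trace of M, which whitening turns into the effective dimension.\<close>

definition mean_sq_norm :: real where
  "mean_sq_norm = (\<Sum>j<n. v j \<bullet> v j) / real n"

text \<open>The matrix Z, not divided by s; thresholds below therefore carry a factor
  \<open>real s\<close>.\<close>

definition deviation :: "(nat \<Rightarrow> nat) \<Rightarrow> real mat" where
  "deviation \<xi> = gram_mat d s 1 (\<lambda>i. v (\<xi> i)) - gram_mat d n (real s / real n) v"

definition evec :: "(nat \<Rightarrow> nat) \<Rightarrow> nat \<Rightarrow> real vec" where
  "evec \<xi> = (SOME u. \<exists>\<mu>. eigenbasis d (deviation \<xi>) u \<mu>)"

definition evalue :: "(nat \<Rightarrow> nat) \<Rightarrow> nat \<Rightarrow> real" where
  "evalue \<xi> = (SOME \<mu>. eigenbasis d (deviation \<xi>) (evec \<xi>) \<mu>)"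

text \<open>The trace of Z^p summed over all index sequences, hence \<open>card samples\<close>
  times its expectation.\<close>

definition moment :: "nat \<Rightarrow> real" where
  "moment p = (\<Sum>\<xi>\<in>samples. \<Sum>k<d. evalue \<xi> k ^ p)"

lemma m_nonneg: "0 \<le> m"
  using v_le[OF n] scalar_prod_self_nonneg[of "v 0"] by linarith

lemma mean_sq_norm_nonneg: "0 \<le> mean_sq_norm"
  by (simp add: mean_sq_norm_def sum_nonneg scalar_prod_self_nonneg)

lemma finite_samples: "finite samples"
  unfolding samples_def by (rule finite_PiE_dflt) auto

lemma sample_less: "\<xi> \<in> samples \<Longrightarrow> i < s \<Longrightarrow> \<xi> i < n"
  by (auto simp: samples_def PiE_dflt_def)

lemma sample_update: "\<xi> \<in> samples \<Longrightarrow> i < s \<Longrightarrow> j < n \<Longrightarrow> \<xi>(i := j) \<in> samples"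
  by (auto simp: samples_def PiE_dflt_def)

text \<open>Exchangeability: a drawn index and an independent copy of it can be swapped.\<close>

lemma sum_swap_draw:
  assumes i: "i < s"
  shows "(\<Sum>\<xi>\<in>samples. \<Sum>j<n. f \<xi> j) = (\<Sum>\<xi>\<in>samples. \<Sum>j<n. f (\<xi>(i := j)) (\<xi> i) :: real)"
  unfolding sum.cartesian_product
  by (rule sum.reindex_bij_witness[where i = "\<lambda>(\<xi>, j). (\<xi>(i := j), \<xi> i)" and j = "\<lambda>(\<xi>, j). (\<xi>(i := j), \<xi> i)"])
     (use i in \<open>auto simp: sample_less sample_update\<close>)

lemma deviation_carrier: "deviation \<xi> \<in> carrier_mat d d"
  unfolding deviation_def by (rule minus_carrier_mat) simp

lemma deviation_sym: "transpose_mat (deviation \<xi>) = deviation \<xi>"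
  unfolding deviation_def by (subst transpose_minus[of _ d d]) (simp_all add: gram_mat_sym)

lemma eigenbasis_deviation: "eigenbasis d (deviation \<xi>) (evec \<xi>) (evalue \<xi>)"
proof -
  have "\<exists>\<mu>. eigenbasis d (deviation \<xi>) (evec \<xi>) \<mu>"
    unfolding evec_def
    by (rule someI_ex[where P = "\<lambda>u. \<exists>\<mu>. eigenbasis d (deviation \<xi>) u \<mu>"])
       (rule symmetric_eigenbasis_exists[OF deviation_carrier deviation_sym])
  thus ?thesis unfolding evalue_def by (rule someI_ex)
qed

lemma orthonormal_evec: "orthonormal d d (evec \<xi>)"
  using eigenbasis_deviation by (simp add: eigenbasis_def)

lemmas evec_carrier = orthonormal_carrier[OF orthonormal_evec]

lemma deviation_form:
  assumes \<xi>: "\<xi> \<in> samples" and x: "x \<in> carrier_vec d" and y: "y \<in> carrier_vec d"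
  shows "x \<bullet> (deviation \<xi> *\<^sub>v y)
    = (\<Sum>i<s. (v (\<xi> i) \<bullet> x) * (v (\<xi> i) \<bullet> y)) - real s / real n * (\<Sum>j<n. (v j \<bullet> x) * (v j \<bullet> y))"
proof -
  have "x \<bullet> (deviation \<xi> *\<^sub>v y)
      = x \<bullet> (gram_mat d s 1 (\<lambda>i. v (\<xi> i)) *\<^sub>v y) - x \<bullet> (gram_mat d n (real s / real n) v *\<^sub>v y)"
    unfolding deviation_def minus_mult_distrib_mat_vec[OF gram_mat_carrier gram_mat_carrier y]
    by (rule scalar_prod_minus_distrib[OF x])
       (rule mult_mat_vec_carrier[OF gram_mat_carrier y])+
  also have "\<dots> = (\<Sum>i<s. (v (\<xi> i) \<bullet> x) * (v (\<xi> i) \<bullet> y)) - real s / real n * (\<Sum>j<n. (v j \<bullet> x) * (v j \<bullet> y))"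
    using v sample_less[OF \<xi>] by (subst (1 2) gram_mat_form) (auto simp: x y sum_distrib_left)
  finally show ?thesis .
qed

lemma deviation_quadratic:
  assumes "\<xi> \<in> samples" "x \<in> carrier_vec d"
  shows "x \<bullet> (deviation \<xi> *\<^sub>v x) = (\<Sum>i<s. (v (\<xi> i) \<bullet> x)\<^sup>2) - real s * cov x"
  using deviation_form[OF assms(1,2,2)] by (simp add: cov_def power2_eq_square)

lemma deviation_update:
  assumes \<xi>: "\<xi> \<in> samples" and i: "i < s" and j: "j < n" and x: "x \<in> carrier_vec d" and y: "y \<in> carrier_vec d"
  shows "x \<bullet> (deviation \<xi> *\<^sub>v y) - x \<bullet> (deviation (\<xi>(i := j)) *\<^sub>v y)
    = (v (\<xi> i) \<bullet> x) * (v (\<xi> i) \<bullet> y) - (v j \<bullet> x) * (v j \<bullet> y)"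
proof -
  have "(\<Sum>l<s. (v ((\<xi>(i := j)) l) \<bullet> x) * (v ((\<xi>(i := j)) l) \<bullet> y))
      = (v j \<bullet> x) * (v j \<bullet> y) + (\<Sum>l\<in>{..<s} - {i}. (v (\<xi> l) \<bullet> x) * (v (\<xi> l) \<bullet> y))"
    using i by (subst sum.remove[of _ i]) (auto intro!: sum.cong)
  moreover have "(\<Sum>l<s. (v (\<xi> l) \<bullet> x) * (v (\<xi> l) \<bullet> y))
      = (v (\<xi> i) \<bullet> x) * (v (\<xi> i) \<bullet> y) + (\<Sum>l\<in>{..<s} - {i}. (v (\<xi> l) \<bullet> x) * (v (\<xi> l) \<bullet> y))"
    using i by (subst sum.remove[of _ i]) auto
  ultimately show ?thesis
    unfolding deviation_form[OF \<xi> x y] deviation_form[OF sample_update[OF \<xi> i j] x y] by simp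
qed

text \<open>In matrix terms, the square of a a^T - b b^T is at most 2 (|a|^2 a a^T + |b|^2 b b^T).
  Here the bound m on the squared norms enters, and what remains are quadratic forms of single rows,
  which can be averaged.\<close>

lemma deviation_update_norm:
  assumes \<xi>: "\<xi> \<in> samples" and i: "i < s" and j: "j < n" and x: "x \<in> carrier_vec d"
  defines "K \<equiv> deviation \<xi> *\<^sub>v x - deviation (\<xi>(i := j)) *\<^sub>v x"
  shows "K \<bullet> K \<le> 2 * m * ((v (\<xi> i) \<bullet> x)\<^sup>2 + (v j \<bullet> x)\<^sup>2)"
proof -
  let ?a = "v (\<xi> i)" and ?b = "v j"
  have a: "?a \<in> carrier_vec d" "?a \<bullet> ?a \<le> m" and b: "?b \<in> carrier_vec d" "?b \<bullet> ?b \<le> m"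
    using v v_le sample_less[OF \<xi> i] j by auto
  have mv: "deviation \<xi> *\<^sub>v x \<in> carrier_vec d" for \<xi> by (rule mult_mat_vec_carrier[OF deviation_carrier x])
  have Kc: "K \<in> carrier_vec d" by (simp add: K_def mv)
  have yK: "y \<bullet> K = (?a \<bullet> x) * (?a \<bullet> y) - (?b \<bullet> x) * (?b \<bullet> y)" if y: "y \<in> carrier_vec d" for y
    unfolding K_def scalar_prod_minus_distrib[OF y mv mv] deviation_update[OF \<xi> i j y x] by simp
  have "K \<bullet> K = (?a \<bullet> x) * (?a \<bullet> K) - (?b \<bullet> x) * (?b \<bullet> K)" by (rule yK[OF Kc])
  also have "?a \<bullet> K = (?a \<bullet> x) * (?a \<bullet> ?a) - (?b \<bullet> x) * (?b \<bullet> ?a)" by (rule yK[OF a(1)])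
  also have "?b \<bullet> K = (?a \<bullet> x) * (?a \<bullet> ?b) - (?b \<bullet> x) * (?b \<bullet> ?b)" by (rule yK[OF b(1)])
  also have "?a \<bullet> ?b = ?b \<bullet> ?a" by (rule comm_scalar_prod[OF a(1) b(1)])
  finally have KK: "K \<bullet> K = (?a \<bullet> x)\<^sup>2 * (?a \<bullet> ?a) + (?b \<bullet> x)\<^sup>2 * (?b \<bullet> ?b) - 2 * ((?a \<bullet> x) * (?b \<bullet> x) * (?b \<bullet> ?a))"
    by (simp add: algebra_simps power2_eq_square)
  \<comment> \<open>Parallelogram law: K has the norm of a difference of two vectors, and p is their sum.\<close>
  define p where "p = (?a \<bullet> x) \<cdot>\<^sub>v ?a + (?b \<bullet> x) \<cdot>\<^sub>v ?b"
  have "0 \<le> p \<bullet> p" by (rule scalar_prod_self_nonneg)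
  also have "p \<bullet> p = (?a \<bullet> x)\<^sup>2 * (?a \<bullet> ?a) + (?b \<bullet> x)\<^sup>2 * (?b \<bullet> ?b) + 2 * ((?a \<bullet> x) * (?b \<bullet> x) * (?b \<bullet> ?a))"
    using a(1) b(1) comm_scalar_prod[OF a(1) b(1)]
    by (simp add: p_def add_scalar_prod_distrib[of _ d] scalar_prod_add_distrib[of _ d] algebra_simps power2_eq_square)
  finally have pp: "0 \<le> (?a \<bullet> x)\<^sup>2 * (?a \<bullet> ?a) + (?b \<bullet> x)\<^sup>2 * (?b \<bullet> ?b) + 2 * ((?a \<bullet> x) * (?b \<bullet> x) * (?b \<bullet> ?a))" .
  have "B \<le> 2 * (A + A')" if "0 \<le> A + A' + 2 * C" "B = A + A' - 2 * C" for A A' B C :: real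
    using that by simp
  from this[OF pp KK] have "K \<bullet> K \<le> 2 * ((?a \<bullet> x)\<^sup>2 * (?a \<bullet> ?a) + (?b \<bullet> x)\<^sup>2 * (?b \<bullet> ?b))" .
  also have "\<dots> \<le> 2 * ((?a \<bullet> x)\<^sup>2 * m + (?b \<bullet> x)\<^sup>2 * m)"
    using a b by (intro mult_left_mono add_mono) auto
  finally show ?thesis by (simp add: algebra_simps)
qed

text \<open>Z tested on its own eigenvector; this converts sums of row forms back into
  eigenvalues.\<close>

lemma evalue_eq:
  assumes "\<xi> \<in> samples" "k < d"
  shows "evalue \<xi> k = (\<Sum>i<s. (v (\<xi> i) \<bullet> evec \<xi> k)\<^sup>2) - real s * cov (evec \<xi> k)"
  using eigenbasis_diag[OF deviation_carrier deviation_sym eigenbasis_deviation[of \<xi>] assms(2)]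
    deviation_quadratic[OF assms(1) evec_carrier[OF assms(2), of \<xi>]] by simp

text \<open>Z^(N+2) is split into Z^(N+1) times the sum of the centred draws. Replacing draw i by an
  independent copy j changes Z to Z', and the four-term difference of \<tau> is the trace of
  (Z^(N+1) - Z'^(N+1)) (Z - Z'), to which \<open>trace_power_difference_bound\<close>
  applies.\<close>

lemma moment_step:
  assumes N: "even N"
  shows "moment (Suc (Suc N)) \<le> real (Suc N) * m *
    (\<Sum>\<xi>\<in>samples. \<Sum>k<d. evalue \<xi> k ^ N * (evalue \<xi> k + 2 * real s * cov (evec \<xi> k)))"
proof -
  \<comment> \<open>\<open>\<tau> \<xi> a\<close> is the trace of Z^(N+1) against the centred outer
    product of row a. Below, \<open>q \<xi> a\<close> is the form of Z^N at row a, and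
    \<open>r \<xi>\<close> its mean over a.\<close>
  define \<tau> where "\<tau> = (\<lambda>\<xi> a. \<Sum>k<d. evalue \<xi> k ^ Suc N * ((v a \<bullet> evec \<xi> k)\<^sup>2 - cov (evec \<xi> k)))"
  define q where "q = (\<lambda>\<xi> a. \<Sum>k<d. evalue \<xi> k ^ N * (v a \<bullet> evec \<xi> k)\<^sup>2)"
  define r where "r = (\<lambda>\<xi>. \<Sum>k<d. evalue \<xi> k ^ N * cov (evec \<xi> k))"
  have sum_\<tau>: "(\<Sum>j<n. \<tau> \<xi> j) = 0" for \<xi>
  proof -
    have "(\<Sum>j<n. \<tau> \<xi> j) = (\<Sum>k<d. evalue \<xi> k ^ Suc N * ((\<Sum>j<n. (v j \<bullet> evec \<xi> k)\<^sup>2) - real n * cov (evec \<xi> k)))"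
      unfolding \<tau>_def by (subst sum.swap) (simp add: sum_distrib_left[symmetric] sum_subtractf del: power_Suc)
    thus ?thesis using n by (simp add: cov_def)
  qed
  have sum_q: "(\<Sum>j<n. q \<xi> j) = real n * r \<xi>" for \<xi>
  proof -
    have "(\<Sum>j<n. q \<xi> j) = (\<Sum>k<d. evalue \<xi> k ^ N * (\<Sum>j<n. (v j \<bullet> evec \<xi> k)\<^sup>2))"
      unfolding q_def by (subst sum.swap) (simp add: sum_distrib_left)
    also have "\<dots> = (\<Sum>k<d. evalue \<xi> k ^ N * (real n * cov (evec \<xi> k)))" using n by (simp add: cov_def)
    finally show ?thesis by (simp add: r_def sum_distrib_left mult_ac)
  qed
  have draw: "(\<Sum>\<xi>\<in>samples. \<tau> \<xi> (\<xi> i)) \<le> real (Suc N) * m * (\<Sum>\<xi>\<in>samples. q \<xi> (\<xi> i) + r \<xi>)" if i: "i < s" for i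
  proof -
    have pointwise: "\<tau> \<xi> (\<xi> i) - \<tau> \<xi> j - \<tau> (\<xi>(i := j)) (\<xi> i) + \<tau> (\<xi>(i := j)) j
        \<le> real (Suc N) * m * (q \<xi> (\<xi> i) + q \<xi> j + q (\<xi>(i := j)) (\<xi> i) + q (\<xi>(i := j)) j)"
      if \<xi>: "\<xi> \<in> samples" and j: "j < n" for \<xi> j
    proof -
      let ?\<xi>' = "\<xi>(i := j)"
      define K where "K = (\<lambda>x. deviation \<xi> *\<^sub>v x - deviation ?\<xi>' *\<^sub>v x)"
      have up: "x \<bullet> (deviation \<xi> *\<^sub>v x) - x \<bullet> (deviation ?\<xi>' *\<^sub>v x) = (v (\<xi> i) \<bullet> x)\<^sup>2 - (v j \<bullet> x)\<^sup>2"
        if "x \<in> carrier_vec d" for x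
        using deviation_update[OF \<xi> i j that that] by (simp add: power2_eq_square)
      \<comment> \<open>The mean cancels between the two rows and leaves Z - Z', whichever sample
        \<xi>'' supplies the eigenbasis.\<close>
      have \<tau>_diff: "\<tau> \<xi>'' (\<xi> i) - \<tau> \<xi>'' j = (\<Sum>k<d. evalue \<xi>'' k ^ Suc N *
          (evec \<xi>'' k \<bullet> (deviation \<xi> *\<^sub>v evec \<xi>'' k) - evec \<xi>'' k \<bullet> (deviation ?\<xi>' *\<^sub>v evec \<xi>'' k)))" for \<xi>''
        unfolding \<tau>_def sum_subtractf[symmetric]
        by (intro sum.cong refl) (simp add: up evec_carrier right_diff_distrib[symmetric] del: power_Suc)
      have q_le: "(\<Sum>k<d. evalue \<xi>'' k ^ N * (K (evec \<xi>'' k) \<bullet> K (evec \<xi>'' k))) \<le> 2 * m * (q \<xi>'' (\<xi> i) + q \<xi>'' j)" for \<xi>''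
      proof -
        have "(\<Sum>k<d. evalue \<xi>'' k ^ N * (K (evec \<xi>'' k) \<bullet> K (evec \<xi>'' k)))
            \<le> (\<Sum>k<d. evalue \<xi>'' k ^ N * (2 * m * ((v (\<xi> i) \<bullet> evec \<xi>'' k)\<^sup>2 + (v j \<bullet> evec \<xi>'' k)\<^sup>2)))"
          unfolding K_def using N
          by (intro sum_mono mult_left_mono deviation_update_norm \<xi> i j) (simp_all add: evec_carrier zero_le_even_power)
        also have "\<dots> = 2 * m * (q \<xi>'' (\<xi> i) + q \<xi>'' j)"
          by (simp add: q_def sum_distrib_left sum.distrib[symmetric] algebra_simps)
        finally show ?thesis .
      qed
      have "(\<tau> \<xi> (\<xi> i) - \<tau> \<xi> j) - (\<tau> ?\<xi>' (\<xi> i) - \<tau> ?\<xi>' j)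
          \<le> real (Suc N) / 2 * ((\<Sum>k<d. evalue \<xi> k ^ N * (K (evec \<xi> k) \<bullet> K (evec \<xi> k)))
              + (\<Sum>k<d. evalue ?\<xi>' k ^ N * (K (evec ?\<xi>' k) \<bullet> K (evec ?\<xi>' k))))"
        unfolding \<tau>_diff
        by (rule trace_power_difference_bound[OF deviation_carrier deviation_sym deviation_carrier deviation_sym
              eigenbasis_deviation eigenbasis_deviation N]) (simp only: K_def)
      also have "\<dots> \<le> real (Suc N) / 2 * (2 * m * (q \<xi> (\<xi> i) + q \<xi> j) + 2 * m * (q ?\<xi>' (\<xi> i) + q ?\<xi>' j))"
        by (intro mult_left_mono add_mono q_le) simp
      also have "\<dots> = real (Suc N) * m * (q \<xi> (\<xi> i) + q \<xi> j + q ?\<xi>' (\<xi> i) + q ?\<xi>' j)"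
        by (simp add: field_simps)
      finally show ?thesis by linarith
    qed
    define S where "S = (\<lambda>f. \<Sum>\<xi>\<in>samples. \<Sum>j<n. f \<xi> j :: real)"
    have S_swap: "S (\<lambda>\<xi> j. f (\<xi>(i := j)) (\<xi> i)) = S f" for f
      unfolding S_def using sum_swap_draw[OF i, of f] by simp
    have S_swap': "S (\<lambda>\<xi> j. f (\<xi>(i := j)) j) = S (\<lambda>\<xi> j. f \<xi> (\<xi> i))" for f
      using S_swap[of "\<lambda>\<xi> j. f \<xi> (\<xi> i)"] by simp
    have S_const: "S (\<lambda>\<xi> j. f \<xi>) = real n * (\<Sum>\<xi>\<in>samples. f \<xi>)" for f
      by (simp add: S_def sum_distrib_left)
    have S\<tau>: "S \<tau> = 0" by (simp add: S_def sum_\<tau>)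
    have Sq: "S q = real n * (\<Sum>\<xi>\<in>samples. r \<xi>)" by (simp add: S_def sum_q sum_distrib_left)
    \<comment> \<open>After summation over \<xi> and j the exchange makes the first and the last
      term equal, while both middle terms become sums of \<tau> over a fresh index, which vanish by
      centring.\<close>
    have "2 * S (\<lambda>\<xi> j. \<tau> \<xi> (\<xi> i))
        = S (\<lambda>\<xi> j. \<tau> \<xi> (\<xi> i)) - S \<tau> - S (\<lambda>\<xi> j. \<tau> (\<xi>(i := j)) (\<xi> i)) + S (\<lambda>\<xi> j. \<tau> (\<xi>(i := j)) j)"
      using S\<tau> by (simp add: S_swap S_swap')
    also have "\<dots> = S (\<lambda>\<xi> j. \<tau> \<xi> (\<xi> i) - \<tau> \<xi> j - \<tau> (\<xi>(i := j)) (\<xi> i) + \<tau> (\<xi>(i := j)) j)"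
      by (simp add: S_def sum.distrib sum_subtractf)
    also have "\<dots> \<le> S (\<lambda>\<xi> j. real (Suc N) * m * (q \<xi> (\<xi> i) + q \<xi> j + q (\<xi>(i := j)) (\<xi> i) + q (\<xi>(i := j)) j))"
      unfolding S_def by (intro sum_mono pointwise) auto
    also have "\<dots> = real (Suc N) * m *
        (S (\<lambda>\<xi> j. q \<xi> (\<xi> i)) + S q + S (\<lambda>\<xi> j. q (\<xi>(i := j)) (\<xi> i)) + S (\<lambda>\<xi> j. q (\<xi>(i := j)) j))"
      by (simp only: S_def sum.distrib sum_distrib_left[symmetric])
    \<comment> \<open>The same exchange matches the four terms in q two by two, giving the factor 2
      that cancels the one on the left.\<close>
    also have "\<dots> = 2 * (real n * (real (Suc N) * m * (\<Sum>\<xi>\<in>samples. q \<xi> (\<xi> i) + r \<xi>)))"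
      by (simp add: S_swap S_swap' S_const Sq sum.distrib algebra_simps)
    finally show ?thesis using n by (simp add: S_const)
  qed
  have "moment (Suc (Suc N)) = (\<Sum>\<xi>\<in>samples. \<Sum>i<s. \<tau> \<xi> (\<xi> i))"
    unfolding moment_def
  proof (rule sum.cong[OF refl])
    fix \<xi> assume \<xi>: "\<xi> \<in> samples"
    have "(\<Sum>i<s. \<tau> \<xi> (\<xi> i)) = (\<Sum>k<d. evalue \<xi> k ^ Suc N * ((\<Sum>i<s. (v (\<xi> i) \<bullet> evec \<xi> k)\<^sup>2) - real s * cov (evec \<xi> k)))"
      unfolding \<tau>_def by (subst sum.swap) (simp add: sum_distrib_left[symmetric] sum_subtractf del: power_Suc)
    also have "\<dots> = (\<Sum>k<d. evalue \<xi> k ^ Suc N * evalue \<xi> k)"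
      by (intro sum.cong refl) (simp add: evalue_eq[OF \<xi>])
    finally show "(\<Sum>k<d. evalue \<xi> k ^ Suc (Suc N)) = (\<Sum>i<s. \<tau> \<xi> (\<xi> i))" by (simp add: mult_ac)
  qed
  also have "\<dots> = (\<Sum>i<s. \<Sum>\<xi>\<in>samples. \<tau> \<xi> (\<xi> i))" by (rule sum.swap)
  also have "\<dots> \<le> (\<Sum>i<s. real (Suc N) * m * (\<Sum>\<xi>\<in>samples. q \<xi> (\<xi> i) + r \<xi>))"
    by (intro sum_mono draw) simp
  also have "\<dots> = real (Suc N) * m * (\<Sum>\<xi>\<in>samples. \<Sum>i<s. q \<xi> (\<xi> i) + r \<xi>)"
    by (subst sum.swap) (simp add: sum_distrib_left)
  also have "(\<Sum>\<xi>\<in>samples. \<Sum>i<s. q \<xi> (\<xi> i) + r \<xi>)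
      = (\<Sum>\<xi>\<in>samples. \<Sum>k<d. evalue \<xi> k ^ N * (evalue \<xi> k + 2 * real s * cov (evec \<xi> k)))"
  proof (rule sum.cong[OF refl])
    fix \<xi> assume \<xi>: "\<xi> \<in> samples"
    have "(\<Sum>i<s. q \<xi> (\<xi> i) + r \<xi>) = (\<Sum>k<d. evalue \<xi> k ^ N * (\<Sum>i<s. (v (\<xi> i) \<bullet> evec \<xi> k)\<^sup>2)) + real s * r \<xi>"
      unfolding sum.distrib q_def by (subst sum.swap) (simp add: sum_distrib_left)
    also have "(\<Sum>k<d. evalue \<xi> k ^ N * (\<Sum>i<s. (v (\<xi> i) \<bullet> evec \<xi> k)\<^sup>2))
        = (\<Sum>k<d. evalue \<xi> k ^ N * (evalue \<xi> k + real s * cov (evec \<xi> k)))"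
      using evalue_eq[OF \<xi>] by (intro sum.cong refl) simp
    also have "\<dots> + real s * r \<xi> = (\<Sum>k<d. evalue \<xi> k ^ N * (evalue \<xi> k + 2 * real s * cov (evec \<xi> k)))"
      unfolding r_def sum_distrib_left sum.distrib[symmetric]
      by (intro sum.cong refl) (simp add: algebra_simps)
    finally show "(\<Sum>i<s. q \<xi> (\<xi> i) + r \<xi>) = (\<Sum>k<d. evalue \<xi> k ^ N * (evalue \<xi> k + 2 * real s * cov (evec \<xi> k)))" .
  qed
  finally show ?thesis .
qed

text \<open>For N = 0 the right-hand side of \<open>moment_step\<close> is a plain trace: the
  sampled squared norms plus s times the trace of M, each with mean s times the trace of M. This is
  how the effective dimension gets into the moment bounds.\<close>

lemma moment_2_le: "moment 2 \<le> 2 * m * real s * mean_sq_norm * real (card samples)"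
proof -
  have trace: "(\<Sum>k<d. evalue \<xi> k + 2 * real s * cov (evec \<xi> k)) = (\<Sum>i<s. v (\<xi> i) \<bullet> v (\<xi> i)) + real s * mean_sq_norm"
    if \<xi>: "\<xi> \<in> samples" for \<xi>
  proof -
    have pv: "(\<Sum>k<d. (v j \<bullet> evec \<xi> k)\<^sup>2) = v j \<bullet> v j" if "j < n" for j
      using parseval_square[OF orthonormal_evec v[OF that]] by simp
    have "(\<Sum>k<d. cov (evec \<xi> k)) = (\<Sum>j<n. \<Sum>k<d. (v j \<bullet> evec \<xi> k)\<^sup>2) / real n"
      unfolding cov_def sum_divide_distrib[symmetric] by (subst sum.swap) simp
    also have "\<dots> = mean_sq_norm" by (simp add: mean_sq_norm_def pv)
    finally have c: "(\<Sum>k<d. cov (evec \<xi> k)) = mean_sq_norm" .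
    have "(\<Sum>k<d. evalue \<xi> k + 2 * real s * cov (evec \<xi> k))
        = (\<Sum>k<d. (\<Sum>i<s. (v (\<xi> i) \<bullet> evec \<xi> k)\<^sup>2) + real s * cov (evec \<xi> k))"
      using evalue_eq[OF \<xi>] by (intro sum.cong refl) simp
    also have "\<dots> = (\<Sum>i<s. \<Sum>k<d. (v (\<xi> i) \<bullet> evec \<xi> k)\<^sup>2) + real s * mean_sq_norm"
      unfolding sum.distrib c[symmetric] sum_distrib_left by (subst sum.swap) simp
    also have "(\<Sum>i<s. \<Sum>k<d. (v (\<xi> i) \<bullet> evec \<xi> k)\<^sup>2) = (\<Sum>i<s. v (\<xi> i) \<bullet> v (\<xi> i))"
      using pv sample_less[OF \<xi>] by (intro sum.cong) auto
    finally show ?thesis .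
  qed
  have draw: "(\<Sum>\<xi>\<in>samples. v (\<xi> i) \<bullet> v (\<xi> i)) = real (card samples) * mean_sq_norm" if i: "i < s" for i
    using sum_swap_draw[OF i, of "\<lambda>\<xi> j. v j \<bullet> v j"] n by (simp add: mean_sq_norm_def sum_distrib_left[symmetric] field_simps)
  have "(\<Sum>\<xi>\<in>samples. \<Sum>k<d. evalue \<xi> k ^ 0 * (evalue \<xi> k + 2 * real s * cov (evec \<xi> k)))
      = (\<Sum>\<xi>\<in>samples. (\<Sum>i<s. v (\<xi> i) \<bullet> v (\<xi> i)) + real s * mean_sq_norm)"
    using trace by (intro sum.cong) auto
  also have "\<dots> = 2 * real s * mean_sq_norm * real (card samples)"
    unfolding sum.distrib by (subst sum.swap) (simp add: draw)
  finally show ?thesis using moment_step[of 0] by (simp add: numeral_2_eq_2 mult_ac)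
qed

text \<open>With \<open>cov\<close> at most 1 on unit vectors, moments are compared with moments
  only, and no further trace of M is picked up. Moving half of the top moment to the left doubles
  the remaining coefficient.\<close>

lemma moment_recursion:
  assumes N: "even N"
  defines "c \<equiv> real (Suc N) * m"
  shows "moment (Suc (Suc N)) \<le> (c\<^sup>2 + 4 * c * real s) * moment N"
proof -
  have c: "0 \<le> c" by (simp add: c_def m_nonneg)
  have cov1: "cov (evec \<xi> k) \<le> 1" if k: "k < d" for \<xi> k
  proof -
    have "(\<Sum>j<n. (v j \<bullet> evec \<xi> k)\<^sup>2) \<le> real n * (evec \<xi> k \<bullet> evec \<xi> k)" by (rule cov_le[OF evec_carrier[OF k]])
    also have "evec \<xi> k \<bullet> evec \<xi> k = 1" using orthonormal_evec k by (simp add: orthonormal_def)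
    finally show ?thesis using n by (simp add: cov_def)
  qed
  \<comment> \<open>AM-GM on the odd power lets the highest moment be absorbed into the left-hand side.\<close>
  have pointwise: "c * (y ^ N * (y + 2 * real s * z)) \<le> y ^ Suc (Suc N) / 2 + (c\<^sup>2 / 2 + 2 * c * real s) * y ^ N"
    if "z \<le> 1" for y z :: real
  proof -
    have "c * (y + 2 * real s * z) \<le> c * y + 2 * c * real s"
      using mult_left_mono[OF mult_right_mono[OF that, of "real s"] c] by (simp add: algebra_simps)
    also have "\<dots> \<le> y\<^sup>2 / 2 + c\<^sup>2 / 2 + 2 * c * real s"
      using zero_le_power2[of "y - c"] by (simp add: power2_diff mult_ac)
    finally have "y ^ N * (c * (y + 2 * real s * z)) \<le> y ^ N * (y\<^sup>2 / 2 + c\<^sup>2 / 2 + 2 * c * real s)"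
      using N by (intro mult_left_mono) (auto simp: zero_le_even_power)
    thus ?thesis by (simp add: algebra_simps power2_eq_square)
  qed
  have "moment (Suc (Suc N)) \<le> c * (\<Sum>\<xi>\<in>samples. \<Sum>k<d. evalue \<xi> k ^ N * (evalue \<xi> k + 2 * real s * cov (evec \<xi> k)))"
    unfolding c_def by (rule moment_step[OF N])
  also have "\<dots> = (\<Sum>\<xi>\<in>samples. \<Sum>k<d. c * (evalue \<xi> k ^ N * (evalue \<xi> k + 2 * real s * cov (evec \<xi> k))))"
    by (simp add: sum_distrib_left)
  also have "\<dots> \<le> (\<Sum>\<xi>\<in>samples. \<Sum>k<d. evalue \<xi> k ^ Suc (Suc N) / 2 + (c\<^sup>2 / 2 + 2 * c * real s) * evalue \<xi> k ^ N)"
    by (intro sum_mono pointwise cov1) simp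
  also have "\<dots> = moment (Suc (Suc N)) / 2 + (c\<^sup>2 / 2 + 2 * c * real s) * moment N"
    by (simp add: moment_def sum.distrib sum_distrib_left sum_divide_distrib del: power_Suc)
  finally show ?thesis by (simp add: algebra_simps)
qed

lemma moment_nonneg: "even N \<Longrightarrow> 0 \<le> moment N"
  by (simp add: moment_def sum_nonneg zero_le_even_power)

text \<open>The recursion factor grows with the order, but the orders up to 2 * p involve only odd
  multiples of m below 2 * p * m. One K serves them all, and the recursion unrolls geometrically
  from the second moment.\<close>

lemma moment_bound:
  assumes K: "(2 * real p * m)\<^sup>2 + 8 * real p * m * real s \<le> K" and q: "q < p"
  shows "moment (2 * Suc q) \<le> 2 * m * real s * mean_sq_norm * real (card samples) * K ^ q"
  using q
proof (induction q)
  case 0 thus ?case using moment_2_le by simp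
next
  case (Suc q)
  define c where "c = real (Suc (2 * Suc q)) * m"
  have c: "0 \<le> c" "c \<le> 2 * real p * m" using m_nonneg Suc.prems by (auto simp: c_def intro!: mult_right_mono)
  have "c\<^sup>2 + 4 * c * real s \<le> (2 * real p * m)\<^sup>2 + 4 * (2 * real p * m) * real s"
    using c by (intro add_mono power_mono mult_right_mono mult_left_mono) auto
  hence cK: "c\<^sup>2 + 4 * c * real s \<le> K" using K by simp
  have "moment (2 * Suc (Suc q)) \<le> (c\<^sup>2 + 4 * c * real s) * moment (2 * Suc q)"
    using moment_recursion[of "2 * Suc q"] by (simp add: c_def)
  also have "\<dots> \<le> K * moment (2 * Suc q)" by (rule mult_right_mono[OF cK]) (simp add: moment_nonneg)
  also have "\<dots> \<le> K * (2 * m * real s * mean_sq_norm * real (card samples) * K ^ q)"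
  proof (rule mult_left_mono)
    have "0 \<le> c\<^sup>2 + 4 * c * real s" using c by simp
    thus "0 \<le> K" using cK by linarith
  qed (use Suc in simp)
  finally show ?case by (simp add: mult_ac)
qed

section \<open>Tail bound by counting bad samples\<close>

definition bad :: "real \<Rightarrow> (nat \<Rightarrow> nat) set" where
  "bad \<eta> = {\<xi> \<in> samples. \<exists>x \<in> carrier_vec d. \<eta> * real s * (x \<bullet> x) < \<bar>x \<bullet> (deviation \<xi> *\<^sub>v x)\<bar>}"

text \<open>A form above the threshold forces an eigenvalue above it in absolute value, and for even
  N the term of that eigenvalue alone bounds the trace from below. Summing over the bad samples is
  Markov's inequality.\<close>

lemma bad_markov:
  assumes \<eta>: "0 < \<eta>" and N: "even N"
  shows "real (card (bad \<eta>)) * (\<eta> * real s) ^ N \<le> moment N"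
proof -
  have large: "(\<eta> * real s) ^ N \<le> (\<Sum>k<d. evalue \<xi> k ^ N)" if \<xi>: "\<xi> \<in> bad \<eta>" for \<xi>
  proof -
    obtain x where x: "x \<in> carrier_vec d" and gt: "\<eta> * real s * (x \<bullet> x) < \<bar>x \<bullet> (deviation \<xi> *\<^sub>v x)\<bar>"
      using \<xi> by (auto simp: bad_def)
    have "\<exists>k<d. \<eta> * real s < \<bar>evalue \<xi> k\<bar>"
    proof (rule ccontr)
      assume "\<not> (\<exists>k<d. \<eta> * real s < \<bar>evalue \<xi> k\<bar>)"
      hence le: "\<bar>evalue \<xi> k\<bar> \<le> \<eta> * real s" if "k < d" for k using that by force
      have "\<bar>x \<bullet> (deviation \<xi> *\<^sub>v x)\<bar> \<le> (\<Sum>k<d. \<bar>evalue \<xi> k * (x \<bullet> evec \<xi> k)\<^sup>2\<bar>)"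
        unfolding eigenbasis_quadratic[OF deviation_carrier deviation_sym eigenbasis_deviation x] by (rule sum_abs)
      also have "\<dots> \<le> (\<Sum>k<d. \<eta> * real s * (x \<bullet> evec \<xi> k)\<^sup>2)"
        unfolding abs_mult by (intro sum_mono mult_mono le) (use \<eta> in auto)
      also have "\<dots> = \<eta> * real s * (x \<bullet> x)"
        unfolding parseval_square[OF orthonormal_evec x, of \<xi>] by (simp add: sum_distrib_left)
      finally show False using gt by simp
    qed
    then obtain k where k: "k < d" "\<eta> * real s < \<bar>evalue \<xi> k\<bar>" by blast
    have "(\<eta> * real s) ^ N \<le> \<bar>evalue \<xi> k\<bar> ^ N" using k \<eta> by (intro power_mono) auto
    also have "\<dots> = evalue \<xi> k ^ N" using N by (simp add: power_even_abs)
    also have "\<dots> \<le> (\<Sum>k<d. evalue \<xi> k ^ N)"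
      using k N by (intro member_le_sum) (auto simp: zero_le_even_power)
    finally show ?thesis .
  qed
  have sub: "bad \<eta> \<subseteq> samples" by (auto simp: bad_def)
  have "real (card (bad \<eta>)) * (\<eta> * real s) ^ N = (\<Sum>\<xi>\<in>bad \<eta>. (\<eta> * real s) ^ N)" by simp
  also have "\<dots> \<le> (\<Sum>\<xi>\<in>bad \<eta>. \<Sum>k<d. evalue \<xi> k ^ N)" by (intro sum_mono large)
  also have "\<dots> \<le> moment N"
    unfolding moment_def using N
    by (intro sum_mono2 finite_samples sub sum_nonneg) (simp add: zero_le_even_power)
  finally show ?thesis .
qed

text \<open>Write D for \<open>mean_sq_norm\<close> and x = D / \<delta>. For large x each of p
  factors K / E is at most 1/3 < 1/e, so p \<ge> ln (1 + x) of them leave at most D / (1 + x) \<le>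
  \<delta>. For small x, rounding p up to an integer costs more than the logarithm pays, and the
  second moment is used. The constant 64 is 2 * 32: p is at most twice the logarithm, and 32 * p * m
  \<le> s * \<eta>^2 suffices for K \<le> E / 3.\<close>

theorem card_bad_le:
  assumes \<eta>: "0 < \<eta>" "\<eta> \<le> 1" and \<delta>: "0 < \<delta>"
    and size: "64 * m * ln (1 + mean_sq_norm / \<delta>) \<le> real s * \<eta>\<^sup>2"
  shows "real (card (bad \<eta>)) \<le> \<delta> * real (card samples)"
proof -
  define x where "x = mean_sq_norm / \<delta>"
  have x: "0 \<le> x" "mean_sq_norm = x * \<delta>" using \<delta> mean_sq_norm_nonneg by (auto simp: x_def)
  show ?thesis
  proof (cases "x \<le> 2")
    case True
    \<comment> \<open>The bound ln z \<le> z - 1 at z = 1 / (1 + x) gives ln (1 + x) \<ge> x / (1 +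
      x), which is at least x / 3 for x \<le> 2.\<close>
    have "- ln (1 + x) \<le> inverse (1 + x) - 1"
      using ln_le_minus_one[of "inverse (1 + x)"] x by (simp add: ln_inverse)
    hence "x / (1 + x) \<le> ln (1 + x)" using x by (simp add: field_simps)
    moreover have "x / 3 \<le> x / (1 + x)" using x True by (intro divide_left_mono) auto
    ultimately have "x / 3 \<le> ln (1 + x)" by linarith
    hence "64 * m * (x / 3) \<le> 64 * m * ln (1 + x)" using m_nonneg by (intro mult_left_mono) auto
    also have "\<dots> \<le> real s * \<eta>\<^sup>2" using size by (simp only: x_def)
    finally have "64 * m * (x / 3) \<le> real s * \<eta>\<^sup>2" .
    moreover have "2 * m * x \<le> 64 * m * (x / 3)" using m_nonneg x by (simp add: field_simps)
    ultimately have mx: "2 * m * x \<le> real s * \<eta>\<^sup>2" by linarith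
    have "real (card (bad \<eta>)) * (\<eta> * real s) ^ 2 \<le> 2 * m * real s * mean_sq_norm * real (card samples)"
      using bad_markov[OF \<eta>(1), of 2] moment_2_le by simp
    also have "\<dots> = (2 * m * x) * (real s * \<delta> * real (card samples))" by (simp add: x mult_ac)
    also have "\<dots> \<le> (real s * \<eta>\<^sup>2) * (real s * \<delta> * real (card samples))"
      using mx \<delta> by (intro mult_right_mono) auto
    also have "\<dots> = \<delta> * real (card samples) * (\<eta> * real s) ^ 2" by (simp add: power2_eq_square mult_ac)
    finally show ?thesis by (rule mult_right_le_imp_le) (use \<eta> s in simp)
  next
    case False
    define y where "y = ln (1 + x)"
    have "exp 1 \<le> 1 + x" using exp_le False by linarith
    hence "ln (exp 1) \<le> y" unfolding y_def using x by (subst ln_le_cancel_iff) auto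
    hence y1: "1 \<le> y" by simp
    \<comment> \<open>Since y \<ge> 1, rounding up at most doubles y.\<close>
    define p where "p = nat \<lceil>y\<rceil>"
    have p: "y \<le> real p" "real p \<le> 2 * y" using y1 by (auto simp: p_def intro: real_nat_ceiling_ge) linarith+
    hence p0: "0 < p" using y1 by (cases p) auto
    have pm: "32 * (real p * m) \<le> real s * \<eta>\<^sup>2"
    proof -
      have "32 * (real p * m) \<le> 32 * (2 * y * m)" using p m_nonneg by (intro mult_left_mono mult_right_mono) auto
      also have "\<dots> \<le> real s * \<eta>\<^sup>2" using size by (simp add: y_def x_def mult_ac)
      finally show ?thesis .
    qed
    define K where "K = (2 * real p * m)\<^sup>2 + 8 * real p * m * real s"
    define E where "E = (\<eta> * real s)\<^sup>2"
    have E0: "0 < E" using \<eta> s by (simp add: E_def)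
    have pm0: "0 \<le> real p * m" using m_nonneg by simp
    have KE: "K \<le> E / 3"
    proof -
      \<comment> \<open>This makes the square in K small: 4 * (p * m)^2 \<le> p * m * s / 8, so K
        \<le> 9 * p * m * s, and 9/32 \<le> 1/3.\<close>
      have "real p * m \<le> real s / 32"
      proof -
        have "real s * \<eta>\<^sup>2 \<le> real s" using \<eta> by (simp add: mult_left_le power_le_one)
        thus ?thesis using pm by linarith
      qed
      hence "(real p * m) * (real p * m) \<le> (real p * m) * (real s / 32)" using pm0 by (rule mult_left_mono)
      moreover have "K = 4 * ((real p * m) * (real p * m)) + 8 * (real p * m * real s)"
        by (simp add: K_def power2_eq_square)
      moreover have "(real p * m) * (real s / 32) = real p * m * real s / 32" by simp
      moreover have "0 \<le> real p * m * real s" using pm0 by simp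
      ultimately have "K \<le> 9 * (real p * m * real s)" by linarith
      also have "\<dots> \<le> 9 * (real s * \<eta>\<^sup>2 / 32 * real s)" using pm by (intro mult_left_mono mult_right_mono) auto
      also have "\<dots> = (9 / 32) * E" by (simp add: E_def power2_eq_square)
      also have "\<dots> \<le> E / 3" using E0 by simp
      finally show ?thesis .
    qed
    have K0: "0 \<le> K" using m_nonneg by (simp add: K_def)
    \<comment> \<open>Trades the prefactor of the second moment for one more factor K, so that the
      full power K^p stands against E^p.\<close>
    have msK: "2 * m * real s \<le> K"
    proof -
      have "1 * (m * real s) \<le> real p * (m * real s)" using p0 m_nonneg by (intro mult_right_mono) auto
      moreover have "0 \<le> m * real s" using m_nonneg by simp
      moreover have "K = (2 * real p * m)\<^sup>2 + 8 * (real p * (m * real s))" by (simp add: K_def)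
      ultimately show ?thesis using zero_le_power2[of "2 * real p * m"] by linarith
    qed
    have "real (card (bad \<eta>)) * E ^ p = real (card (bad \<eta>)) * (\<eta> * real s) ^ (2 * p)"
      by (simp add: E_def power_mult)
    also have "\<dots> \<le> moment (2 * p)" by (rule bad_markov[OF \<eta>(1)]) simp
    also have "\<dots> \<le> 2 * m * real s * mean_sq_norm * real (card samples) * K ^ (p - 1)"
      using moment_bound[of p K "p - 1"] p0 by (simp add: K_def)
    also have "\<dots> = 2 * m * real s * (mean_sq_norm * real (card samples) * K ^ (p - 1))" by (simp add: mult_ac)
    also have "\<dots> \<le> K * (mean_sq_norm * real (card samples) * K ^ (p - 1))"
      using msK K0 mean_sq_norm_nonneg by (intro mult_right_mono) auto
    also have "\<dots> = mean_sq_norm * real (card samples) * K ^ p" using p0 by (cases p) auto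
    also have "\<dots> \<le> mean_sq_norm * real (card samples) * (E / 3) ^ p"
      using KE K0 mean_sq_norm_nonneg by (intro mult_left_mono power_mono) auto
    also have "\<dots> = mean_sq_norm * real (card samples) * (1 / 3) ^ p * E ^ p" by (simp add: power_divide)
    finally have "real (card (bad \<eta>)) \<le> mean_sq_norm * real (card samples) * (1 / 3) ^ p"
      by (rule mult_right_le_imp_le) (use E0 in simp)
    also have "\<dots> \<le> mean_sq_norm * real (card samples) * (1 / (1 + x))"
    proof (rule mult_left_mono)
      have "(1 / 3 :: real) ^ p \<le> exp (- 1) ^ p"
        using exp_le by (intro power_mono) (auto simp: exp_minus field_simps)
      also have "\<dots> = exp (- real p)" by (simp add: exp_of_nat_mult[symmetric])
      also have "\<dots> \<le> exp (- y)" using p by simp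
      also have "\<dots> = 1 / (1 + x)" using x by (simp add: y_def exp_minus field_simps)
      finally show "(1 / 3 :: real) ^ p \<le> 1 / (1 + x)" .
    qed (simp add: mean_sq_norm_nonneg)
    also have "\<dots> \<le> \<delta> * real (card samples)"
    proof -
      have "mean_sq_norm * (1 / (1 + x)) \<le> \<delta>" using x \<delta> by (simp add: field_simps)
      from mult_right_mono[OF this, of "real (card samples)"] show ?thesis by (simp add: mult_ac)
    qed
    finally show ?thesis .
  qed
qed

end

subsection \<open>Calculus of the regularized empirical risk\<close>

lemma mult_vec_carrier:
  "A \<in> carrier_mat d d \<Longrightarrow> y \<in> carrier_vec d \<Longrightarrow> A *\<^sub>v (y :: real vec) \<in> carrier_vec d"
  by (rule mult_mat_vec_carrier)

text \<open>The exact Hessian (m = n, c = 1 / n) and the sub-sampled one (m = s, c = 1 / s) share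
  this shape, so the ridge terms cancel in their difference.\<close>

definition ridge_mat :: "nat \<Rightarrow> real \<Rightarrow> nat \<Rightarrow> real \<Rightarrow> (nat \<Rightarrow> real vec) \<Rightarrow> real mat" where
  "ridge_mat d \<gamma> m c v = gram_mat d m c v + \<gamma> \<cdot>\<^sub>m 1\<^sub>m d"

lemma ridge_mat_carrier [simp]: "ridge_mat d \<gamma> m c v \<in> carrier_mat d d"
  by (simp add: ridge_mat_def)

lemma ridge_mat_sym: "transpose_mat (ridge_mat d \<gamma> m c v) = ridge_mat d \<gamma> m c v"
  unfolding ridge_mat_def by (subst transpose_add[of _ d d]) (auto simp: gram_mat_sym)

lemma ridge_mat_nth:
  "a < d \<Longrightarrow> b < d \<Longrightarrow> ridge_mat d \<gamma> m c v $$ (a, b)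
    = (\<Sum>i<m. c * (v i $ a * v i $ b)) + \<gamma> * (if a = b then 1 else 0)"
  by (simp add: ridge_mat_def gram_mat_def)

lemma ridge_mat_form:
  assumes v: "\<And>i. i < m \<Longrightarrow> v i \<in> carrier_vec d" and x: "x \<in> carrier_vec d" and y: "y \<in> carrier_vec d"
  shows "x \<bullet> (ridge_mat d \<gamma> m c v *\<^sub>v y) = (\<Sum>i<m. c * ((v i \<bullet> x) * (v i \<bullet> y))) + \<gamma> * (x \<bullet> y)"
proof -
  have I: "\<gamma> \<cdot>\<^sub>m 1\<^sub>m d \<in> carrier_mat d d" by simp
  have "(\<gamma> \<cdot>\<^sub>m 1\<^sub>m d) *\<^sub>v y = \<gamma> \<cdot>\<^sub>v y"
    using y by (intro eq_vecI) (auto simp: row_smult)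
  hence "ridge_mat d \<gamma> m c v *\<^sub>v y = gram_mat d m c v *\<^sub>v y + \<gamma> \<cdot>\<^sub>v y"
    unfolding ridge_mat_def by (simp add: add_mult_distrib_mat_vec[OF gram_mat_carrier I y])
  thus ?thesis
    using x y gram_mat_form[of m v d x y c] v mult_vec_carrier[OF gram_mat_carrier y]
    by (simp add: scalar_prod_add_distrib[OF x])
qed

lemma ridge_mat_pos_def:
  assumes v: "\<And>i. i < m \<Longrightarrow> v i \<in> carrier_vec d" and c: "0 \<le> c" and \<gamma>: "0 < \<gamma>"
  shows "pos_def d (ridge_mat d \<gamma> m c v)"
  unfolding pos_def_def
proof (intro conjI ballI impI)
  fix x :: "real vec" assume x: "x \<in> carrier_vec d" "x \<noteq> 0\<^sub>v d"
  have "0 < \<gamma> * (x \<bullet> x)" using \<gamma> scalar_prod_self_pos[OF x] by simp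
  moreover have "0 \<le> (\<Sum>i<m. c * ((v i \<bullet> x) * (v i \<bullet> x)))" using c by (intro sum_nonneg) simp
  moreover have "x \<bullet> (ridge_mat d \<gamma> m c v *\<^sub>v x) = (\<Sum>i<m. c * ((v i \<bullet> x) * (v i \<bullet> x))) + \<gamma> * (x \<bullet> x)"
    by (rule ridge_mat_form) (use v x in auto)
  ultimately show "0 < x \<bullet> (ridge_mat d \<gamma> m c v *\<^sub>v x)" by linarith
qed (simp_all add: ridge_mat_sym)

text \<open>Adding the tangent inequalities at a and at b shows that the first derivative is
  monotone, and a monotone function has a nonnegative derivative.\<close>

lemma second_deriv_nonneg_of_convex:
  fixes f :: "real \<Rightarrow> real"
  assumes f: "convex_on UNIV f" and d1: "\<And>z. f differentiable (at z)" and d2: "deriv f differentiable (at z)"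
  shows "0 \<le> deriv (deriv f) z"
proof -
  have D: "(f has_real_derivative deriv f z) (at z)" for z
    using d1 by (simp add: DERIV_deriv_iff_real_differentiable)
  have tangent: "deriv f c * (y - c) \<le> f y - f c" for c y
    by (rule convex_on_imp_above_tangent[OF f, of c y]) (use D in auto)
  have "mono (deriv f)"
  proof (rule monoI)
    fix a b :: real assume "a \<le> b"
    have "(deriv f b - deriv f a) * (b - a) \<ge> 0"
      using tangent[of a b] tangent[of b a] by (simp add: algebra_simps)
    thus "deriv f a \<le> deriv f b" using \<open>a \<le> b\<close> by (cases "a = b") (auto simp: zero_le_mult_iff)
  qed
  moreover have "(deriv f has_real_derivative deriv (deriv f) z) (at z)"
    using d2 by (simp add: DERIV_deriv_iff_real_differentiable)
  ultimately show ?thesis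
    by (metis mono_imp_mono_on mono_on_imp_deriv_nonneg interior_UNIV UNIV_I)
qed

section \<open>Gradient and Hessian of the objective\<close>

locale erm =
  fixes n d :: nat and x :: "nat \<Rightarrow> real vec" and l :: "nat \<Rightarrow> real \<Rightarrow> real" and \<gamma> :: real
  assumes n: "1 \<le> n" and d: "1 \<le> d" and \<gamma>: "0 < \<gamma>"
    and x: "\<And>j. j < n \<Longrightarrow> x j \<in> carrier_vec d"
    and l_convex: "\<And>j. j < n \<Longrightarrow> convex_on UNIV (l j)"
    and l_diff: "\<And>j z. j < n \<Longrightarrow> l j differentiable (at z)"
    and l'_diff: "\<And>j z. j < n \<Longrightarrow> deriv (l j) differentiable (at z)"
begin

abbreviation F :: "real vec \<Rightarrow> real" where "F \<equiv> erm_objective n x l \<gamma>"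

definition sdata :: "real vec \<Rightarrow> nat \<Rightarrow> real vec" where
  "sdata w j = sqrt (deriv (deriv (l j)) (x j \<bullet> w)) \<cdot>\<^sub>v x j"

lemma sdata_carrier: "j < n \<Longrightarrow> sdata w j \<in> carrier_vec d"
  using x by (simp add: sdata_def)

lemma l''_nonneg: "j < n \<Longrightarrow> 0 \<le> deriv (deriv (l j)) z"
  using second_deriv_nonneg_of_convex[OF l_convex l_diff l'_diff] by blast

lemma l_deriv: "j < n \<Longrightarrow> (l j has_real_derivative deriv (l j) z) (at z)"
  using l_diff by (simp add: DERIV_deriv_iff_real_differentiable)

lemma l'_deriv: "j < n \<Longrightarrow> (deriv (l j) has_real_derivative deriv (deriv (l j)) z) (at z)"
  using l'_diff by (simp add: DERIV_deriv_iff_real_differentiable)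

lemma add_unit_carrier: "w \<in> carrier_vec d \<Longrightarrow> w + h \<cdot>\<^sub>v unit_vec d i \<in> carrier_vec d"
  by simp

lemma inner_add_unit:
  "(w :: real vec) \<in> carrier_vec d \<Longrightarrow> y \<in> carrier_vec d \<Longrightarrow> i < d \<Longrightarrow> y \<bullet> (w + h \<cdot>\<^sub>v unit_vec d i) = y \<bullet> w + h * y $ i"
  by (simp add: scalar_prod_add_distrib[of _ d])

lemma F_line:
  assumes "w \<in> carrier_vec d" "i < d"
  shows "F (w + h \<cdot>\<^sub>v unit_vec d i)
    = (1 / real n) * (\<Sum>j<n. l j (x j \<bullet> w + h * x j $ i)) + \<gamma> / 2 * (w \<bullet> w + 2 * h * w $ i + h\<^sup>2)"
proof -
  have "(w + h \<cdot>\<^sub>v unit_vec d i) \<bullet> (w + h \<cdot>\<^sub>v unit_vec d i) = w \<bullet> w + 2 * h * w $ i + h\<^sup>2"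
    using assms inner_add_unit[OF assms(1) add_unit_carrier[OF assms(1)] assms(2), of h i h]
      inner_add_unit[OF assms(1) assms(1,2), of h] comm_scalar_prod[OF assms(1) add_unit_carrier[OF assms(1)], of h i]
    by (simp add: power2_eq_square algebra_simps)
  thus ?thesis using assms x
    by (simp add: erm_objective_def norm2_sq inner_add_unit cong: sum.cong_simp)
qed

text \<open>The derivative is recorded next to its value because an equation for
  \<open>deriv\<close> does not certify differentiability, which the first-order condition at the
  minimiser relies on.\<close>

lemma partial_deriv_F:
  assumes w: "w \<in> carrier_vec d" and i: "i < d"
  shows "((\<lambda>h. F (w + h \<cdot>\<^sub>v unit_vec d i)) has_real_derivative
      (1 / real n) * (\<Sum>j<n. deriv (l j) (x j \<bullet> w) * x j $ i) + \<gamma> * w $ i) (at 0)"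
    and "partial_deriv i F w = (1 / real n) * (\<Sum>j<n. deriv (l j) (x j \<bullet> w) * x j $ i) + \<gamma> * w $ i"
proof -
  have j: "((\<lambda>h. l j (x j \<bullet> w + h * x j $ i)) has_real_derivative deriv (l j) (x j \<bullet> w) * x j $ i) (at 0)"
    if "j < n" for j
    by (rule DERIV_chain2[of "l j"]) (use l_deriv[OF that] in \<open>auto intro!: derivative_eq_intros\<close>)
  show *: "((\<lambda>h. F (w + h \<cdot>\<^sub>v unit_vec d i)) has_real_derivative
      (1 / real n) * (\<Sum>j<n. deriv (l j) (x j \<bullet> w) * x j $ i) + \<gamma> * w $ i) (at 0)"
    unfolding F_line[OF w i]
    by (rule DERIV_add[OF DERIV_cmult[OF DERIV_sum]]) (auto intro!: j derivative_eq_intros)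
  show "partial_deriv i F w = (1 / real n) * (\<Sum>j<n. deriv (l j) (x j \<bullet> w) * x j $ i) + \<gamma> * w $ i"
    using DERIV_imp_deriv[OF *] w by (simp add: partial_deriv_def)
qed

lemma gradient_carrier: "w \<in> carrier_vec d \<Longrightarrow> gradient F w \<in> carrier_vec d"
  by (simp add: gradient_def)

lemma gradient_inner:
  assumes w: "w \<in> carrier_vec d" and y: "y \<in> carrier_vec d"
  shows "y \<bullet> gradient F w = (1 / real n) * (\<Sum>j<n. deriv (l j) (x j \<bullet> w) * (x j \<bullet> y)) + \<gamma> * (w \<bullet> y)"
proof -
  have "y \<bullet> gradient F w = (\<Sum>i<d. y $ i * partial_deriv i F w)"
    unfolding scalar_prod_sum[OF y gradient_carrier[OF w]] using w
    by (intro sum.cong refl) (simp add: gradient_def)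
  also have "\<dots> = (\<Sum>i<d. (\<Sum>j<n. (1 / real n) * (deriv (l j) (x j \<bullet> w) * (x j $ i * y $ i))) + \<gamma> * (w $ i * y $ i))"
    by (intro sum.cong refl) (simp add: partial_deriv_F[OF w] sum_distrib_left algebra_simps)
  also have "\<dots> = (\<Sum>j<n. \<Sum>i<d. (1 / real n) * (deriv (l j) (x j \<bullet> w) * (x j $ i * y $ i))) + \<gamma> * (\<Sum>i<d. w $ i * y $ i)"
    unfolding sum.distrib sum_distrib_left by (subst sum.swap) simp
  also have "\<dots> = (1 / real n) * (\<Sum>j<n. deriv (l j) (x j \<bullet> w) * (x j \<bullet> y)) + \<gamma> * (w \<bullet> y)"
  proof -
    have "(\<Sum>i<d. (1 / real n) * (deriv (l j) (x j \<bullet> w) * (x j $ i * y $ i)))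
        = (1 / real n) * (deriv (l j) (x j \<bullet> w) * (x j \<bullet> y))" if "j < n" for j
      using scalar_prod_sum[OF x[OF that] y] by (simp only: sum_distrib_left)
    thus ?thesis using scalar_prod_sum[OF w y] by (simp add: sum_distrib_left)
  qed
  finally show ?thesis .
qed

text \<open>Convexity enters through l'' \<ge> 0, which lets the two square roots in the scaled rows
  multiply back to l''.\<close>

lemma hessian_eq:
  assumes w: "w \<in> carrier_vec d"
  shows "hessian F w = ridge_mat d \<gamma> n (1 / real n) (sdata w)"
proof (intro eq_matI)
  fix i k assume "i < dim_row (ridge_mat d \<gamma> n (1 / real n) (sdata w))" "k < dim_col (ridge_mat d \<gamma> n (1 / real n) (sdata w))"
  hence ik: "i < d" "k < d" using ridge_mat_carrier by (metis carrier_matD)+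
  have j: "((\<lambda>h. deriv (l j) (x j \<bullet> w + h * x j $ i) * x j $ k) has_real_derivative
      deriv (deriv (l j)) (x j \<bullet> w) * x j $ i * x j $ k) (at 0)" if "j < n" for j
    by (rule DERIV_cmult_right, rule DERIV_chain2[of "deriv (l j)"])
       (use l'_deriv[OF that] in \<open>auto intro!: derivative_eq_intros\<close>)
  have eq: "partial_deriv k F (w + h \<cdot>\<^sub>v unit_vec d i)
      = (1 / real n) * (\<Sum>j<n. deriv (l j) (x j \<bullet> w + h * x j $ i) * x j $ k)
        + \<gamma> * (w $ k + h * (if i = k then 1 else 0))" for h
    unfolding partial_deriv_F(2)[OF add_unit_carrier[OF w] ik(2)]
    using w ik x by (simp add: inner_add_unit cong: sum.cong_simp)
  have "((\<lambda>h. partial_deriv k F (w + h \<cdot>\<^sub>v unit_vec d i)) has_real_derivative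
      (1 / real n) * (\<Sum>j<n. deriv (deriv (l j)) (x j \<bullet> w) * x j $ i * x j $ k) + \<gamma> * (if i = k then 1 else 0)) (at 0)"
    unfolding eq by (rule DERIV_add[OF DERIV_cmult[OF DERIV_sum]]) (auto intro!: j derivative_eq_intros)
  note D = DERIV_imp_deriv[OF this]
  have "hessian F w $$ (i, k) = partial_deriv i (partial_deriv k F) w"
    using w ik by (simp add: hessian_def)
  also have "\<dots> = deriv (\<lambda>h. partial_deriv k F (w + h \<cdot>\<^sub>v unit_vec d i)) 0"
    using w by (simp only: partial_deriv_def[of i "partial_deriv k F"] carrier_vecD)
  finally have "hessian F w $$ (i, k)
      = (1 / real n) * (\<Sum>j<n. deriv (deriv (l j)) (x j \<bullet> w) * x j $ i * x j $ k) + \<gamma> * (if i = k then 1 else 0)"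
    unfolding D .
  also have "(1 / real n) * (\<Sum>j<n. deriv (deriv (l j)) (x j \<bullet> w) * x j $ i * x j $ k)
      = (\<Sum>j<n. (1 / real n) * (sdata w j $ i * sdata w j $ k))"
    unfolding sum_distrib_left
  proof (rule sum.cong[OF refl])
    fix j assume "j \<in> {..<n}"
    hence j: "j < n" by simp
    have "sqrt (deriv (deriv (l j)) (x j \<bullet> w)) * sqrt (deriv (deriv (l j)) (x j \<bullet> w)) = deriv (deriv (l j)) (x j \<bullet> w)"
      using l''_nonneg[OF j] by simp
    thus "(1 / real n) * (deriv (deriv (l j)) (x j \<bullet> w) * x j $ i * x j $ k) = (1 / real n) * (sdata w j $ i * sdata w j $ k)"
      using x[OF j] ik by (simp add: sdata_def mult_ac)
  qed
  finally show "hessian F w $$ (i, k) = ridge_mat d \<gamma> n (1 / real n) (sdata w) $$ (i, k)"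
    using ik by (simp add: ridge_mat_nth)
qed (use w in \<open>simp_all add: hessian_def carrier_matD[OF ridge_mat_carrier]\<close>)

lemma hessian_carrier: "w \<in> carrier_vec d \<Longrightarrow> hessian F w \<in> carrier_mat d d"
  by (simp add: hessian_eq)

lemma hessian_pos_def: "w \<in> carrier_vec d \<Longrightarrow> pos_def d (hessian F w)"
  unfolding hessian_eq by (rule ridge_mat_pos_def) (use \<gamma> sdata_carrier in auto)

lemma hessian_inner:
  assumes "w \<in> carrier_vec d" "y \<in> carrier_vec d" "z \<in> carrier_vec d"
  shows "y \<bullet> (hessian F w *\<^sub>v z)
    = (1 / real n) * (\<Sum>j<n. deriv (deriv (l j)) (x j \<bullet> w) * (x j \<bullet> z) * (x j \<bullet> y)) + \<gamma> * (z \<bullet> y)"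
proof -
  have "(1 / real n) * ((sdata w j \<bullet> y) * (sdata w j \<bullet> z))
      = (1 / real n) * (deriv (deriv (l j)) (x j \<bullet> w) * (x j \<bullet> z) * (x j \<bullet> y))" if j: "j < n" for j
  proof -
    have "sqrt (deriv (deriv (l j)) (x j \<bullet> w)) * sqrt (deriv (deriv (l j)) (x j \<bullet> w)) = deriv (deriv (l j)) (x j \<bullet> w)"
      using l''_nonneg[OF j] by simp
    thus ?thesis using x[OF j] assms by (simp add: sdata_def mult_ac)
  qed
  hence "(\<Sum>j<n. (1 / real n) * ((sdata w j \<bullet> y) * (sdata w j \<bullet> z)))
      = (1 / real n) * (\<Sum>j<n. deriv (deriv (l j)) (x j \<bullet> w) * (x j \<bullet> z) * (x j \<bullet> y))"
    unfolding sum_distrib_left by (intro sum.cong) auto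
  moreover have "y \<bullet> (hessian F w *\<^sub>v z)
      = (\<Sum>j<n. (1 / real n) * ((sdata w j \<bullet> y) * (sdata w j \<bullet> z))) + \<gamma> * (y \<bullet> z)"
    unfolding hessian_eq[OF assms(1)] by (rule ridge_mat_form) (use sdata_carrier assms in auto)
  ultimately show ?thesis using comm_scalar_prod[OF assms(2,3)] by simp
qed

lemma gradient_minimizer:
  assumes ws: "ws \<in> carrier_vec d" and min: "\<And>w. w \<in> carrier_vec d \<Longrightarrow> F ws \<le> F w"
  shows "gradient F ws = 0\<^sub>v d"
proof (intro eq_vecI)
  fix i assume "i < dim_vec (0\<^sub>v d :: real vec)"
  hence i: "i < d" by simp
  have z: "ws + 0 \<cdot>\<^sub>v unit_vec d i = ws" using ws by (intro eq_vecI) auto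
  have "partial_deriv i F ws = 0"
    unfolding partial_deriv_F(2)[OF ws i]
    by (rule DERIV_local_min[OF partial_deriv_F(1)[OF ws i], of 1]) (use min ws z in auto)
  thus "gradient F ws $ i = 0\<^sub>v d $ i" using ws i by (simp add: gradient_def)
qed (use ws in \<open>simp add: gradient_def\<close>)

lemma gradient_along_segment:
  assumes ws: "ws \<in> carrier_vec d" and \<Delta>: "\<Delta> \<in> carrier_vec d" and y: "y \<in> carrier_vec d"
  shows "((\<lambda>t. y \<bullet> gradient F (ws + t \<cdot>\<^sub>v \<Delta>)) has_real_derivative y \<bullet> (hessian F (ws + t \<cdot>\<^sub>v \<Delta>) *\<^sub>v \<Delta>)) (at t)"
proof -
  have c: "ws + t \<cdot>\<^sub>v \<Delta> \<in> carrier_vec d" for t using ws \<Delta> by simp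
  have ip: "u \<bullet> (ws + t \<cdot>\<^sub>v \<Delta>) = u \<bullet> ws + t * (u \<bullet> \<Delta>)" "(ws + t \<cdot>\<^sub>v \<Delta>) \<bullet> u = ws \<bullet> u + t * (\<Delta> \<bullet> u)"
    if "u \<in> carrier_vec d" for u t
    using ws \<Delta> that by (simp_all add: scalar_prod_add_distrib[of _ d] add_scalar_prod_distrib[of _ d])
  have j: "((\<lambda>t. deriv (l j) (x j \<bullet> ws + t * (x j \<bullet> \<Delta>)) * (x j \<bullet> y)) has_real_derivative
      deriv (deriv (l j)) (x j \<bullet> ws + t * (x j \<bullet> \<Delta>)) * (x j \<bullet> \<Delta>) * (x j \<bullet> y)) (at t)" if "j < n" for j
    by (rule DERIV_cmult_right, rule DERIV_chain2[of "deriv (l j)"])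
       (use l'_deriv[OF that] in \<open>auto intro!: derivative_eq_intros\<close>)
  have g: "y \<bullet> gradient F (ws + t \<cdot>\<^sub>v \<Delta>)
      = (1 / real n) * (\<Sum>j<n. deriv (l j) (x j \<bullet> ws + t * (x j \<bullet> \<Delta>)) * (x j \<bullet> y)) + \<gamma> * (ws \<bullet> y + t * (\<Delta> \<bullet> y))" for t
    unfolding gradient_inner[OF c y] ip(2)[OF y] using x by (simp add: ip cong: sum.cong_simp)
  have h: "y \<bullet> (hessian F (ws + t \<cdot>\<^sub>v \<Delta>) *\<^sub>v \<Delta>)
      = (1 / real n) * (\<Sum>j<n. deriv (deriv (l j)) (x j \<bullet> ws + t * (x j \<bullet> \<Delta>)) * (x j \<bullet> \<Delta>) * (x j \<bullet> y)) + \<gamma> * (\<Delta> \<bullet> y)"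
    unfolding hessian_inner[OF c y \<Delta>] using x by (simp add: ip cong: sum.cong_simp)
  show ?thesis
    unfolding g h by (rule DERIV_add[OF DERIV_cmult[OF DERIV_sum]]) (auto intro!: j derivative_eq_intros)
qed

text \<open>A monotonicity argument stands in for the integral remainder. The remainder r is tested
  against itself, so a scalar function on [0,1] decides, and r \<bullet> r \<le> L/2 |r|
  |\<Delta>|^2 is then divided by |r|.\<close>

lemma gradient_taylor_bound:
  assumes ws: "ws \<in> carrier_vec d" and g0: "gradient F ws = 0\<^sub>v d" and w: "w \<in> carrier_vec d"
    and lip: "\<And>u v. u \<in> carrier_vec d \<Longrightarrow> v \<in> carrier_vec d \<Longrightarrow>
      spec_norm (hessian F u - hessian F v) \<le> L * norm2 (u - v)"
  shows "norm2 (gradient F w - hessian F w *\<^sub>v (w - ws)) \<le> L / 2 * (norm2 (w - ws))\<^sup>2"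
proof -
  define \<Delta> where "\<Delta> = w - ws"
  have \<Delta>: "\<Delta> \<in> carrier_vec d" using w ws by (simp add: \<Delta>_def)
  define r where "r = gradient F w - hessian F w *\<^sub>v \<Delta>"
  have H\<Delta>: "hessian F w *\<^sub>v \<Delta> \<in> carrier_vec d" by (rule mult_vec_carrier[OF hessian_carrier[OF w] \<Delta>])
  have r: "r \<in> carrier_vec d" using gradient_carrier[OF w] H\<Delta> by (simp add: r_def)
  define M where "M = L * norm2 r * (norm2 \<Delta>)\<^sup>2"
  \<comment> \<open>The derivative -M (1 - t) of the quadratic term outweighs the Hessian
    difference, since the point at parameter t has distance (1 - t) |\<Delta>| from w.\<close>
  define \<phi> where "\<phi> = (\<lambda>t. r \<bullet> gradient F (ws + t \<cdot>\<^sub>v \<Delta>) - t * (r \<bullet> (hessian F w *\<^sub>v \<Delta>)) + M / 2 * (1 - t)\<^sup>2)"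
  have w1: "ws + 1 \<cdot>\<^sub>v \<Delta> = w" and w0: "ws + 0 \<cdot>\<^sub>v \<Delta> = ws" using w ws by (auto simp: \<Delta>_def)
  have "\<phi> 1 \<le> \<phi> 0"
  proof (rule DERIV_nonpos_imp_nonincreasing[of 0 1 \<phi>])
    fix t :: real assume t: "0 \<le> t" "t \<le> 1"
    let ?wt = "ws + t \<cdot>\<^sub>v \<Delta>"
    have wt: "?wt \<in> carrier_vec d" using ws \<Delta> by simp
    have Ht\<Delta>: "hessian F ?wt *\<^sub>v \<Delta> \<in> carrier_vec d" by (rule mult_vec_carrier[OF hessian_carrier[OF wt] \<Delta>])
    let ?D = "hessian F ?wt - hessian F w"
    have Dc: "?D \<in> carrier_mat d d" using hessian_carrier[OF w] by (rule minus_carrier_mat)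
    have "r \<bullet> (hessian F ?wt *\<^sub>v \<Delta>) - r \<bullet> (hessian F w *\<^sub>v \<Delta>) = r \<bullet> (?D *\<^sub>v \<Delta>)"
      unfolding minus_mult_distrib_mat_vec[OF hessian_carrier[OF wt] hessian_carrier[OF w] \<Delta>]
      by (rule scalar_prod_minus_distrib[OF r Ht\<Delta> H\<Delta>, symmetric])
    also have "\<dots> \<le> norm2 r * norm2 (?D *\<^sub>v \<Delta>)"
      using cauchy_schwarz_vec[OF r mult_vec_carrier[OF Dc \<Delta>]] by linarith
    also have "\<dots> \<le> norm2 r * (spec_norm ?D * norm2 \<Delta>)"
      by (intro mult_left_mono norm2_mult_le_spec_norm[OF Dc \<Delta>] norm2_nonneg)
    also have "\<dots> \<le> norm2 r * ((L * norm2 (?wt - w)) * norm2 \<Delta>)"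
      by (intro mult_left_mono mult_right_mono lip wt w norm2_nonneg)
    also have "norm2 (?wt - w) = (1 - t) * norm2 \<Delta>"
    proof -
      have "?wt - w = (t - 1) \<cdot>\<^sub>v \<Delta>" using w ws by (intro eq_vecI) (auto simp: \<Delta>_def algebra_simps)
      hence "norm2 (?wt - w) = sqrt ((1 - t)\<^sup>2 * (\<Delta> \<bullet> \<Delta>))"
        using \<Delta> by (simp add: norm2_def power2_eq_square algebra_simps)
      thus ?thesis using t by (simp add: real_sqrt_mult norm2_def)
    qed
    finally have le: "r \<bullet> (hessian F ?wt *\<^sub>v \<Delta>) - r \<bullet> (hessian F w *\<^sub>v \<Delta>) - M * (1 - t) \<le> 0"
      by (simp add: M_def power2_eq_square mult_ac)
    have "(\<phi> has_real_derivative r \<bullet> (hessian F ?wt *\<^sub>v \<Delta>) - r \<bullet> (hessian F w *\<^sub>v \<Delta>) - M * (1 - t)) (at t)"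
      unfolding \<phi>_def
      by (rule DERIV_cong, (rule derivative_eq_intros gradient_along_segment[OF ws \<Delta> r] refl)+)
         (simp add: algebra_simps)
    thus "\<exists>y. (\<phi> has_real_derivative y) (at t) \<and> y \<le> 0" using le by blast
  qed simp
  hence "r \<bullet> gradient F w - r \<bullet> (hessian F w *\<^sub>v \<Delta>) \<le> M / 2"
    unfolding \<phi>_def w1 w0 g0 using r by simp
  hence "r \<bullet> r \<le> M / 2"
    using scalar_prod_minus_distrib[OF r gradient_carrier[OF w] H\<Delta>] by (simp add: r_def)
  hence rr: "norm2 r * norm2 r \<le> norm2 r * (L / 2 * (norm2 \<Delta>)\<^sup>2)"
    using norm2_sq[of r] by (simp add: M_def power2_eq_square mult_ac)
  have "norm2 r \<le> L / 2 * (norm2 \<Delta>)\<^sup>2"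
  proof (cases "norm2 r = 0")
    case False
    hence "0 < norm2 r" using norm2_nonneg[of r] by linarith
    thus ?thesis using rr by simp
  next
    case True
    \<comment> \<open>The sign of L is not given; the Lipschitz condition between w and ws yields
      that of L |\<Delta>|^2 directly.\<close>
    have "0 \<le> L * norm2 \<Delta> * norm2 \<Delta>"
    proof -
      have Dc: "hessian F w - hessian F ws \<in> carrier_mat d d" using hessian_carrier[OF ws] by (rule minus_carrier_mat)
      have "0 \<le> norm2 ((hessian F w - hessian F ws) *\<^sub>v \<Delta>)" by (rule norm2_nonneg)
      also have "\<dots> \<le> spec_norm (hessian F w - hessian F ws) * norm2 \<Delta>" by (rule norm2_mult_le_spec_norm[OF Dc \<Delta>])
      also have "\<dots> \<le> L * norm2 \<Delta> * norm2 \<Delta>"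
        unfolding \<Delta>_def by (intro mult_right_mono lip w ws norm2_nonneg)
      finally show ?thesis .
    qed
    thus ?thesis using True by (simp add: power2_eq_square mult_ac)
  qed
  thus ?thesis by (simp add: r_def \<Delta>_def)
qed

end

subsection \<open>Perturbed Newton directions in the energy norm\<close>

lemma norm2_triangle:
  assumes "x \<in> carrier_vec d" "y \<in> carrier_vec d"
  shows "norm2 (x + y) \<le> norm2 x + norm2 y"
proof (rule power2_le_imp_le)
  have "(norm2 (x + y))\<^sup>2 = (norm2 x)\<^sup>2 + 2 * (x \<bullet> y) + (norm2 y)\<^sup>2"
    using assms comm_scalar_prod[OF assms]
    by (simp add: norm2_sq add_scalar_prod_distrib[of _ d] scalar_prod_add_distrib[of _ d])
  also have "\<dots> \<le> (norm2 x + norm2 y)\<^sup>2"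
    using cauchy_schwarz_vec[OF assms] by (simp add: power2_sum)
  finally show "(norm2 (x + y))\<^sup>2 \<le> (norm2 x + norm2 y)\<^sup>2" .
qed (simp add: norm2_nonneg)

text \<open>R and S are H^(1/2) and H^(-1/2), taken as functions of H in one eigenbasis, so that all
  products are computed on the positive eigenvalues.\<close>

lemma pos_def_whitening:
  assumes H: "pos_def d H"
  obtains R S where "R \<in> carrier_mat d d" "S \<in> carrier_mat d d" "transpose_mat R = R" "transpose_mat S = S"
    "R * R = H" "R * S = 1\<^sub>m d" "S * R = 1\<^sub>m d" "H * (S * S) = 1\<^sub>m d"
proof -
  have Hc: "H \<in> carrier_mat d d" and Ht: "transpose_mat H = H" using H by (auto simp: pos_def_def)
  obtain u \<mu> where e: "eigenbasis d H u \<mu>" using symmetric_eigenbasis_exists[OF Hc Ht] by blast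
  have on: "orthonormal d d u" using e by (simp add: eigenbasis_def)
  have pos: "0 < \<mu> k" if k: "k < d" for k
  proof -
    have "u k \<in> carrier_vec d" "u k \<bullet> u k = 1" using on k by (auto simp: orthonormal_def)
    moreover from this have "u k \<noteq> 0\<^sub>v d" by auto
    ultimately show ?thesis using H eigenbasis_diag[OF Hc Ht e k] by (metis pos_def_def)
  qed
  have cong: "spectral_mat d u r = spectral_mat d u r'" if "\<And>k. k < d \<Longrightarrow> r k = r' k" for r r'
    unfolding spectral_mat_def using that by (intro cong_mat) (auto intro!: sum.cong)
  \<comment> \<open>The resolution of the identity, which is Parseval again.\<close>
  have one: "spectral_mat d u (\<lambda>k. 1) = 1\<^sub>m d"
    by (rule mat_eq_from_form[where d = d]) (auto simp: spectral_mat_form[OF on] parseval[OF on, symmetric])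
  let ?M = "spectral_mat d u"
  note mult = spectral_mat_mult[OF on]
  have HH: "H = ?M \<mu>" by (rule spectral_mat_eq[OF Hc Ht e])
  show ?thesis
  proof (rule that[of "?M (\<lambda>k. sqrt (\<mu> k))" "?M (\<lambda>k. 1 / sqrt (\<mu> k))"])
    show "?M (\<lambda>k. sqrt (\<mu> k)) * ?M (\<lambda>k. sqrt (\<mu> k)) = H"
      unfolding mult HH by (rule cong) (use pos in \<open>auto simp: less_imp_le\<close>)
    show "?M (\<lambda>k. sqrt (\<mu> k)) * ?M (\<lambda>k. 1 / sqrt (\<mu> k)) = 1\<^sub>m d"
      "?M (\<lambda>k. 1 / sqrt (\<mu> k)) * ?M (\<lambda>k. sqrt (\<mu> k)) = 1\<^sub>m d"
      unfolding mult one[symmetric] using pos by (auto intro!: cong simp: less_imp_neq[symmetric])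
    show "H * (?M (\<lambda>k. 1 / sqrt (\<mu> k)) * ?M (\<lambda>k. 1 / sqrt (\<mu> k))) = 1\<^sub>m d"
      unfolding mult HH one[symmetric]
      by (rule cong) (use pos in \<open>auto simp: less_imp_le less_imp_neq[symmetric]\<close>)
  qed (simp_all add: spectral_mat_sym)
qed

section \<open>The norm induced by a positive definite matrix\<close>

definition energy :: "real mat \<Rightarrow> real vec \<Rightarrow> real" where
  "energy H y = sqrt (y \<bullet> (H *\<^sub>v y))"

lemma energy_eq_norm2:
  assumes "R \<in> carrier_mat d d" "transpose_mat R = R" "R * R = H" "y \<in> carrier_vec d"
  shows "energy H y = norm2 (R *\<^sub>v y)"
proof -
  have "y \<bullet> ((R * R) *\<^sub>v y) = (R *\<^sub>v y) \<bullet> (R *\<^sub>v y)"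
    unfolding mult_mult_vec[OF assms(1,1,4)]
    by (rule symmetric_bilinear[OF assms(1,2,4) mult_vec_carrier[OF assms(1,4)]])
  thus ?thesis using assms(3) by (simp add: energy_def norm2_def)
qed

lemma energy_nonneg: "pos_def d H \<Longrightarrow> y \<in> carrier_vec d \<Longrightarrow> 0 \<le> energy H y"
  by (simp add: energy_def pos_def_nonneg)

lemma energy_sq: "pos_def d H \<Longrightarrow> y \<in> carrier_vec d \<Longrightarrow> (energy H y)\<^sup>2 = y \<bullet> (H *\<^sub>v y)"
  by (simp add: energy_def pos_def_nonneg)

lemma energy_triangle:
  assumes H: "pos_def d H" and y: "y \<in> carrier_vec d" and z: "z \<in> carrier_vec d"
  shows "energy H (y + z) \<le> energy H y + energy H z"
proof -
  obtain R S where R: "R \<in> carrier_mat d d" "transpose_mat R = R" "R * R = H"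
    using pos_def_whitening[OF H] by metis
  note en = energy_eq_norm2[OF R]
  have "R *\<^sub>v (y + z) = R *\<^sub>v y + R *\<^sub>v z" by (rule mult_add_distrib_mat_vec[OF R(1) y z])
  thus ?thesis
    using norm2_triangle[OF mult_vec_carrier[OF R(1) y] mult_vec_carrier[OF R(1) z]] y z by (simp add: en)
qed

text \<open>Passing into the energy norm and back costs the square root of the condition number.
  Errors are followed in the energy norm and converted at the two ends, so this factor does not
  accumulate over iterations.\<close>

lemma energy_sigma_bounds:
  assumes H: "pos_def d H" and d: "1 \<le> d" and y: "y \<in> carrier_vec d"
  shows "sqrt (sigma_min H) * norm2 y \<le> energy H y" "energy H y \<le> sqrt (sigma_max H) * norm2 y"
  using sigma_bounds(2,3)[OF H d y] by (simp_all add: energy_def norm2_def real_sqrt_mult[symmetric])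

text \<open>The hypothesis is applied at a y + b z and a y - b z, with a the energy of z and b that
  of y. Both summands then have equal energy, the cross terms of H cancel on addition, and \<eta> is
  not worsened.\<close>

lemma polarization_bound:
  assumes A: "A \<in> carrier_mat d d" "transpose_mat A = A" and H: "pos_def d H"
    and bound: "\<And>y. y \<in> carrier_vec d \<Longrightarrow> \<bar>y \<bullet> (A *\<^sub>v y)\<bar> \<le> \<eta> * (y \<bullet> (H *\<^sub>v y))"
    and y: "y \<in> carrier_vec d" and z: "z \<in> carrier_vec d"
  shows "\<bar>y \<bullet> (A *\<^sub>v z)\<bar> \<le> \<eta> * energy H y * energy H z"
proof -
  have Hc: "H \<in> carrier_mat d d" and Ht: "transpose_mat H = H" using H by (auto simp: pos_def_def)
  have expand: "(a \<cdot>\<^sub>v y + b \<cdot>\<^sub>v z) \<bullet> (M *\<^sub>v (a \<cdot>\<^sub>v y + b \<cdot>\<^sub>v z))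
      = a\<^sup>2 * (y \<bullet> (M *\<^sub>v y)) + 2 * a * b * (y \<bullet> (M *\<^sub>v z)) + b\<^sup>2 * (z \<bullet> (M *\<^sub>v z))"
    if M: "M \<in> carrier_mat d d" "transpose_mat M = M" for a b M
  proof -
    have My: "M *\<^sub>v y \<in> carrier_vec d" "M *\<^sub>v z \<in> carrier_vec d" using M y z by (auto intro: mult_vec_carrier)
    have "M *\<^sub>v (a \<cdot>\<^sub>v y + b \<cdot>\<^sub>v z) = a \<cdot>\<^sub>v (M *\<^sub>v y) + b \<cdot>\<^sub>v (M *\<^sub>v z)"
      using M(1) y z by (simp add: mult_add_distrib_mat_vec[of M d d] mult_mat_vec[of M d d])
    moreover have "z \<bullet> (M *\<^sub>v y) = y \<bullet> (M *\<^sub>v z)"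
      using symmetric_bilinear[OF M z y] comm_scalar_prod[OF My(2) y] by simp
    ultimately show ?thesis using y z My
      by (simp add: add_scalar_prod_distrib[of _ d] scalar_prod_add_distrib[of _ d] power2_eq_square algebra_simps)
  qed
  let ?a = "energy H z" and ?b = "energy H y" and ?B = "y \<bullet> (A *\<^sub>v z)"
  note sq = energy_sq[OF H y] energy_sq[OF H z]
  have 1: "\<bar>?a\<^sup>2 * (y \<bullet> (A *\<^sub>v y)) + 2 * ?a * c * ?B + c\<^sup>2 * (z \<bullet> (A *\<^sub>v z))\<bar>
      \<le> \<eta> * (?a\<^sup>2 * ?b\<^sup>2 + 2 * ?a * c * (y \<bullet> (H *\<^sub>v z)) + c\<^sup>2 * ?a\<^sup>2)" for c
    using bound[of "?a \<cdot>\<^sub>v y + c \<cdot>\<^sub>v z"] y z unfolding expand[OF A] expand[OF Hc Ht] sq by simp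
  have "4 * (?a * ?b) * \<bar>?B\<bar> \<le> 4 * (?a * ?b) * (\<eta> * ?a * ?b)"
  proof -
    define P where "P = ?a\<^sup>2 * (y \<bullet> (A *\<^sub>v y)) + ?b\<^sup>2 * (z \<bullet> (A *\<^sub>v z))"
    define Q where "Q = ?a * ?b * ?B"
    define C where "C = \<eta> * (?a * ?b * (y \<bullet> (H *\<^sub>v z)))"
    define E where "E = \<eta> * (?a\<^sup>2 * ?b\<^sup>2)"
    have "\<bar>P + 2 * Q\<bar> \<le> 2 * E + 2 * C" using 1[of ?b] by (simp add: P_def Q_def C_def E_def algebra_simps)
    moreover have "\<bar>P - 2 * Q\<bar> \<le> 2 * E - 2 * C" using 1[of "- ?b"] by (simp add: P_def Q_def C_def E_def algebra_simps)
    ultimately have "4 * \<bar>Q\<bar> \<le> 4 * E" by linarith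
    moreover have "\<bar>Q\<bar> = ?a * ?b * \<bar>?B\<bar>" using energy_nonneg[OF H y] energy_nonneg[OF H z] by (simp add: Q_def abs_mult)
    ultimately show ?thesis by (simp add: E_def power2_eq_square algebra_simps)
  qed
  \<comment> \<open>By definiteness, energy 0 means a zero vector; in all other cases the product of
    the energies can be divided out.\<close>
  moreover have "?thesis" if "?a = 0 \<or> ?b = 0"
  proof -
    have "y = 0\<^sub>v d \<or> z = 0\<^sub>v d"
      using that sq H y z by (metis less_irrefl pos_def_def power_zero_numeral)
    thus ?thesis
    proof
      assume "y = 0\<^sub>v d" thus ?thesis using that A z mult_vec_carrier[OF A(1) z] by auto
    next
      assume "z = 0\<^sub>v d" thus ?thesis using that A y symmetric_bilinear[OF A y z] mult_vec_carrier[OF A(1) y] by auto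
    qed
  qed
  ultimately show ?thesis
  proof (cases "?a = 0 \<or> ?b = 0")
    case False
    hence "0 < 4 * (?a * ?b)" using energy_nonneg[OF H y] energy_nonneg[OF H z] by simp
    hence "\<bar>?B\<bar> \<le> \<eta> * ?a * ?b"
      using \<open>4 * (?a * ?b) * \<bar>?B\<bar> \<le> 4 * (?a * ?b) * (\<eta> * ?a * ?b)\<close> by (rule mult_left_le_imp_le[rotated])
    thus ?thesis by (simp add: mult_ac)
  qed blast
qed

text \<open>Since Ht p = H q, the error e = q - p satisfies H e = (Ht - H) p, and testing with e
  bounds its energy by \<eta> times that of p. The inexactness is measured in the norm of Ht and
  carried over to that of H by comparing the forms with constants 7/8 and 9/8.\<close>

lemma newton_direction_error:
  assumes H: "pos_def d H" and Ht: "pos_def d Ht" and \<eta>: "0 \<le> \<eta>" "\<eta> \<le> 1/8" and e0: "0 \<le> \<epsilon>0"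
    and sub: "\<And>y. y \<in> carrier_vec d \<Longrightarrow> \<bar>y \<bullet> (Ht *\<^sub>v y) - y \<bullet> (H *\<^sub>v y)\<bar> \<le> \<eta> * (y \<bullet> (H *\<^sub>v y))"
    and q: "q \<in> carrier_vec d" and p: "p \<in> carrier_vec d" and p': "p' \<in> carrier_vec d"
    and pq: "Ht *\<^sub>v p = H *\<^sub>v q"
    and inexact: "norm2 (mat_sqrt Ht *\<^sub>v (p - p')) \<le> \<epsilon>0 / 2 * norm2 (mat_sqrt Ht *\<^sub>v p)"
  shows "energy H (q - p') \<le> 8 / 7 * (\<eta> + 2 / 3 * \<epsilon>0) * energy H q"
proof -
  have Hc: "H \<in> carrier_mat d d" "transpose_mat H = H" and Htc: "Ht \<in> carrier_mat d d" "transpose_mat Ht = Ht"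
    using H Ht by (auto simp: pos_def_def)
  define A where "A = Ht - H"
  have Ac: "A \<in> carrier_mat d d" "transpose_mat A = A"
    using Hc Htc by (auto simp: A_def transpose_minus[of _ d d])
  have mv: "M *\<^sub>v y \<in> carrier_vec d" if "M \<in> carrier_mat d d" "y \<in> carrier_vec d" for M and y :: "real vec"
    using that by (rule mult_vec_carrier)
  have Av: "A *\<^sub>v y = Ht *\<^sub>v y - H *\<^sub>v y" if "y \<in> carrier_vec d" for y
    unfolding A_def by (rule minus_mult_distrib_mat_vec[OF Htc(1) Hc(1) that])
  have bound: "\<bar>y \<bullet> (A *\<^sub>v y)\<bar> \<le> \<eta> * (y \<bullet> (H *\<^sub>v y))" if "y \<in> carrier_vec d" for y
    using sub[OF that] scalar_prod_minus_distrib[OF that mv[OF Htc(1) that] mv[OF Hc(1) that]] by (simp add: Av[OF that])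
  define e where "e = q - p"
  have e: "e \<in> carrier_vec d" using q p by (simp add: e_def)
  have "H *\<^sub>v e = A *\<^sub>v p"
    unfolding e_def Av[OF p] pq by (rule mult_minus_distrib_mat_vec[OF Hc(1) q p])
  hence "(energy H e)\<^sup>2 = e \<bullet> (A *\<^sub>v p)" using energy_sq[OF H e] by simp
  also have "\<dots> \<le> \<eta> * energy H e * energy H p" using polarization_bound[OF Ac H bound e p] by linarith
  finally have "energy H e * energy H e \<le> energy H e * (\<eta> * energy H p)" by (simp add: power2_eq_square mult_ac)
  hence eb: "energy H e \<le> \<eta> * energy H p"
    using energy_nonneg[OF H e] energy_nonneg[OF H p] \<eta>
    by (cases "energy H e = 0") (auto simp: mult_le_cancel_left)
  have neg: "energy H (- y) = energy H y" if "y \<in> carrier_vec d" for y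
  proof -
    have "- y = (- 1) \<cdot>\<^sub>v y" using that by (intro eq_vecI) auto
    thus ?thesis using that mv[OF Hc(1) that] by (simp add: energy_def mult_mat_vec[OF Hc(1)])
  qed
  have "p = q + (- e)" using q p by (intro eq_vecI) (auto simp: e_def)
  hence "energy H p \<le> energy H q + energy H e" using energy_triangle[OF H q, of "- e"] neg[OF e] e by simp
  moreover have "\<eta> * energy H p \<le> 1/8 * energy H p" using \<eta> energy_nonneg[OF H p] by (intro mult_right_mono) auto
  \<comment> \<open>In energies: |p| \<le> |q| + |e| and |e| \<le> |p| / 8.\<close>
  ultimately have pb: "energy H p \<le> 8 / 7 * energy H q" using eb by simp
  define f where "f = p - p'"
  have f: "f \<in> carrier_vec d" using p p' by (simp add: f_def)
  have "(norm2 (mat_sqrt Ht *\<^sub>v f))\<^sup>2 \<le> (\<epsilon>0 / 2 * norm2 (mat_sqrt Ht *\<^sub>v p))\<^sup>2"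
    using inexact norm2_nonneg by (intro power_mono) (auto simp: f_def)
  hence ff: "f \<bullet> (Ht *\<^sub>v f) \<le> (\<epsilon>0 / 2)\<^sup>2 * (p \<bullet> (Ht *\<^sub>v p))"
    unfolding power_mult_distrib norm2_mat_sqrt[OF Htc(1) pos_def_is_psd[OF Ht] f]
      norm2_mat_sqrt[OF Htc(1) pos_def_is_psd[OF Ht] p] .
  have \<eta>H: "\<eta> * (y \<bullet> (H *\<^sub>v y)) \<le> 1/8 * (y \<bullet> (H *\<^sub>v y))" if "y \<in> carrier_vec d" for y
    using \<eta> pos_def_nonneg[OF H that] by (intro mult_right_mono) auto
  have "7/8 * (f \<bullet> (H *\<^sub>v f)) \<le> f \<bullet> (Ht *\<^sub>v f)" using sub[OF f] \<eta>H[OF f] by linarith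
  also note ff
  also have "(\<epsilon>0 / 2)\<^sup>2 * (p \<bullet> (Ht *\<^sub>v p)) \<le> (\<epsilon>0 / 2)\<^sup>2 * (9/8 * (p \<bullet> (H *\<^sub>v p)))"
    using sub[OF p] \<eta>H[OF p] by (intro mult_left_mono) (linarith, simp)
  finally have "f \<bullet> (H *\<^sub>v f) \<le> 9 / 28 * (\<epsilon>0\<^sup>2 * (p \<bullet> (H *\<^sub>v p)))"
    by (simp add: power_divide)
  \<comment> \<open>The constant 9/28 = 1/4 * 9/8 * 8/7 is rounded up to the perfect square of
    2/3.\<close>
  also have "\<dots> \<le> 4 / 9 * (\<epsilon>0\<^sup>2 * (p \<bullet> (H *\<^sub>v p)))"
    using pos_def_nonneg[OF H p] by (intro mult_right_mono) auto
  also have "\<dots> = (2 / 3 * \<epsilon>0 * energy H p)\<^sup>2"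
    using energy_sq[OF H p] by (simp add: power_mult_distrib power_divide)
  finally have "(energy H f)\<^sup>2 \<le> (2 / 3 * \<epsilon>0 * energy H p)\<^sup>2" using energy_sq[OF H f] by simp
  hence fb: "energy H f \<le> 2 / 3 * \<epsilon>0 * energy H p"
    using e0 energy_nonneg[OF H p] by (intro power2_le_imp_le[of "energy H f"]) auto
  have "q - p' = e + f" using q p p' by (intro eq_vecI) (auto simp: e_def f_def)
  hence "energy H (q - p') \<le> energy H e + energy H f" using energy_triangle[OF H e f] by simp
  also have "\<dots> \<le> (\<eta> + 2 / 3 * \<epsilon>0) * energy H p" using eb fb by (simp add: algebra_simps)
  also have "\<dots> \<le> (\<eta> + 2 / 3 * \<epsilon>0) * (8 / 7 * energy H q)"
    using pb \<eta> e0 by (intro mult_left_mono) auto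
  finally show ?thesis by (simp add: algebra_simps)
qed


subsection \<open>Sub-sampled Newton steps\<close>

context erm
begin

lemma scaled_data_nth:
  "w \<in> carrier_vec d \<Longrightarrow> j < n \<Longrightarrow> k < d \<Longrightarrow> scaled_data n x l w $$ (j, k) = sdata w j $ k"
  using x[of j] by (simp add: scaled_data_def sdata_def)

lemma scaled_data_carrier: "w \<in> carrier_vec d \<Longrightarrow> scaled_data n x l w \<in> carrier_mat n d"
  by (simp add: scaled_data_def)

lemma scaled_data_row: "w \<in> carrier_vec d \<Longrightarrow> j < n \<Longrightarrow> Matrix.row (scaled_data n x l w) j = sdata w j"
  using sdata_carrier[of j w] by (intro eq_vecI) (auto simp: scaled_data_nth[symmetric] scaled_data_def)

lemma subsampled_hessian_eq:
  assumes w: "w \<in> carrier_vec d" and \<xi>: "\<And>i. i < s \<Longrightarrow> \<xi> i < n"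
  shows "subsampled_hessian n x l \<gamma> s \<xi> w = ridge_mat d \<gamma> s (1 / real s) (\<lambda>i. sdata w (\<xi> i))"
proof -
  define B where "B = subsample_rows s \<xi> (scaled_data n x l w)"
  have B: "B \<in> carrier_mat s d" using scaled_data_carrier[OF w] by (simp add: B_def subsample_rows_def)
  have Bn: "B $$ (i, k) = sdata w (\<xi> i) $ k" if "i < s" "k < d" for i k
    using that scaled_data_carrier[OF w] scaled_data_nth[OF w \<xi>[OF that(1)] that(2)]
    by (simp add: B_def subsample_rows_def)
  have BB: "transpose_mat B * B \<in> carrier_mat d d" using B by simp
  have BBn: "(transpose_mat B * B) $$ (a, b) = (\<Sum>i<s. sdata w (\<xi> i) $ a * sdata w (\<xi> i) $ b)" if "a < d" "b < d" for a b
    using that B by (subst mat_mult_nth[of _ d s _ d]) (auto simp: Bn)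
  have "subsampled_hessian n x l \<gamma> s \<xi> w = (1 / real s) \<cdot>\<^sub>m (transpose_mat B * B) + \<gamma> \<cdot>\<^sub>m 1\<^sub>m d"
    using w by (simp add: subsampled_hessian_def B_def Let_def)
  also have "\<dots> = ridge_mat d \<gamma> s (1 / real s) (\<lambda>i. sdata w (\<xi> i))"
  proof (rule eq_matI)
    fix a b assume "a < dim_row (ridge_mat d \<gamma> s (1 / real s) (\<lambda>i. sdata w (\<xi> i)))"
      "b < dim_col (ridge_mat d \<gamma> s (1 / real s) (\<lambda>i. sdata w (\<xi> i)))"
    hence ab: "a < d" "b < d" using ridge_mat_carrier by (metis carrier_matD)+
    have "(c \<cdot>\<^sub>m C + \<gamma> \<cdot>\<^sub>m 1\<^sub>m d) $$ (a, b) = c * C $$ (a, b) + \<gamma> * (if a = b then 1 else 0)"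
      if "C \<in> carrier_mat d d" for c C using ab that by simp
    from this[OF BB, of "1 / real s"] show "((1 / real s) \<cdot>\<^sub>m (transpose_mat B * B) + \<gamma> \<cdot>\<^sub>m 1\<^sub>m d) $$ (a, b)
        = ridge_mat d \<gamma> s (1 / real s) (\<lambda>i. sdata w (\<xi> i)) $$ (a, b)"
      unfolding ridge_mat_nth[OF ab] BBn[OF ab] sum_distrib_left by simp
  qed (use BB in \<open>auto simp: carrier_matD[OF ridge_mat_carrier]\<close>)
  finally show ?thesis .
qed

text \<open>Links leverage scores to the Hessian: the pseudoinverse inside them becomes the inverse
  Hessian divided by n.\<close>

lemma regularized_gram_eq:
  assumes w: "w \<in> carrier_vec d"
  shows "transpose_mat (scaled_data n x l w) * scaled_data n x l w + (real n * \<gamma>) \<cdot>\<^sub>m 1\<^sub>m d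
    = real n \<cdot>\<^sub>m hessian F w"
proof (rule eq_matI)
  let ?A = "scaled_data n x l w"
  note A = scaled_data_carrier[OF w]
  have AA: "transpose_mat ?A * ?A \<in> carrier_mat d d" using A by simp
  fix a b assume "a < dim_row (real n \<cdot>\<^sub>m hessian F w)" "b < dim_col (real n \<cdot>\<^sub>m hessian F w)"
  hence ab: "a < d" "b < d" using hessian_carrier[OF w] by auto
  have "(transpose_mat ?A * ?A) $$ (a, b) = (\<Sum>j<n. sdata w j $ a * sdata w j $ b)"
    using ab A by (subst mat_mult_nth[of _ d n _ d]) (auto simp: scaled_data_nth[OF w])
  moreover have "(transpose_mat ?A * ?A + (real n * \<gamma>) \<cdot>\<^sub>m 1\<^sub>m d) $$ (a, b)
      = (transpose_mat ?A * ?A) $$ (a, b) + real n * \<gamma> * (if a = b then 1 else 0)"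
    using ab AA by (simp del: index_mult_mat)
  moreover have "(real n \<cdot>\<^sub>m hessian F w) $$ (a, b) = real n * hessian F w $$ (a, b)"
    using ab hessian_carrier[OF w] by simp
  ultimately show "(transpose_mat ?A * ?A + (real n * \<gamma>) \<cdot>\<^sub>m 1\<^sub>m d) $$ (a, b) = (real n \<cdot>\<^sub>m hessian F w) $$ (a, b)"
    using n unfolding hessian_eq[OF w] ridge_mat_nth[OF ab] by (simp add: sum_divide_distrib[symmetric] algebra_simps)
qed (use hessian_carrier[OF w] scaled_data_carrier[OF w] in auto)

text \<open>The whitened rows have squared norm n times the ridge leverage score and average outer
  product bounded by the identity, so the concentration result applies to them.\<close>

lemma subsampled_hessian_concentration:
  assumes w: "w \<in> carrier_vec d" and s: "1 \<le> s" and \<eta>: "0 < \<eta>" "\<eta> \<le> 1" and \<delta>: "0 < \<delta>"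
    and size: "64 * (ridge_coherence \<gamma> (scaled_data n x l w) * eff_dim \<gamma> (scaled_data n x l w))
      * ln (1 + eff_dim \<gamma> (scaled_data n x l w) / \<delta>) \<le> real s * \<eta>\<^sup>2"
  obtains B where "B \<subseteq> PiE_dflt {..<s} 0 (\<lambda>_. {..<n})"
    "real (card B) \<le> \<delta> * real (card (PiE_dflt {..<s} 0 (\<lambda>_. {..<n} :: nat set)))"
    "\<And>\<xi> y. \<xi> \<in> PiE_dflt {..<s} 0 (\<lambda>_. {..<n}) - B \<Longrightarrow> y \<in> carrier_vec d \<Longrightarrow>
      \<bar>y \<bullet> (subsampled_hessian n x l \<gamma> s \<xi> w *\<^sub>v y) - y \<bullet> (hessian F w *\<^sub>v y)\<bar> \<le> \<eta> * (y \<bullet> (hessian F w *\<^sub>v y))"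
proof -
  let ?A = "scaled_data n x l w" and ?H = "hessian F w"
  note Hc = hessian_carrier[OF w]
  obtain R S where R: "R \<in> carrier_mat d d" "transpose_mat R = R" "R * R = ?H"
    and S: "S \<in> carrier_mat d d" "transpose_mat S = S"
    and inv: "R * S = 1\<^sub>m d" "S * R = 1\<^sub>m d" "?H * (S * S) = 1\<^sub>m d"
    using pos_def_whitening[OF hessian_pos_def[OF w]] by metis
  define v where "v = (\<lambda>j. S *\<^sub>v sdata w j)"
  have v: "v j \<in> carrier_vec d" if "j < n" for j
    unfolding v_def by (rule mult_vec_carrier[OF S(1) sdata_carrier[OF that]])
  have SS: "S * S \<in> carrier_mat d d" using S by simp
  have pinv: "pinv (transpose_mat ?A * ?A + (real n * \<gamma>) \<cdot>\<^sub>m 1\<^sub>m d) = (1 / real n) \<cdot>\<^sub>m (S * S)"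
    unfolding regularized_gram_eq[OF w]
  proof (rule pinv_eq_inverse)
    show "real n \<cdot>\<^sub>m ?H \<in> carrier_mat d d" "(1 / real n) \<cdot>\<^sub>m (S * S) \<in> carrier_mat d d" using Hc SS by auto
    have "(real n \<cdot>\<^sub>m ?H) * ((1 / real n) \<cdot>\<^sub>m (S * S)) = real n \<cdot>\<^sub>m (?H * ((1 / real n) \<cdot>\<^sub>m (S * S)))"
      by (rule mult_smult_assoc_mat[OF Hc smult_carrier_mat[OF SS]])
    also have "?H * ((1 / real n) \<cdot>\<^sub>m (S * S)) = (1 / real n) \<cdot>\<^sub>m (?H * (S * S))"
      by (rule mult_smult_distrib[OF Hc SS])
    also have "real n \<cdot>\<^sub>m ((1 / real n) \<cdot>\<^sub>m (?H * (S * S))) = 1\<^sub>m d"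
      unfolding inv using n by (intro eq_matI) auto
    finally show "(real n \<cdot>\<^sub>m ?H) * ((1 / real n) \<cdot>\<^sub>m (S * S)) = 1\<^sub>m d" .
  qed
  have leverage: "ridge_leverage \<gamma> ?A j = v j \<bullet> v j / real n" if j: "j < n" for j
  proof -
    note sc = sdata_carrier[OF j, of w]
    have "((1 / real n) \<cdot>\<^sub>m (S * S)) *\<^sub>v sdata w j = (1 / real n) \<cdot>\<^sub>v (S *\<^sub>v v j)"
      unfolding v_def mult_mult_vec[OF S(1) S(1) sc, symmetric]
      using SS sc by (intro eq_vecI) (auto simp: row_smult)
    moreover have "sdata w j \<bullet> (S *\<^sub>v v j) = v j \<bullet> v j"
      unfolding v_def by (rule symmetric_bilinear[OF S sc mult_vec_carrier[OF S(1) sc]])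
    ultimately show ?thesis
      using scaled_data_carrier[OF w] sc mult_vec_carrier[OF S(1) v[OF j]]
      by (simp add: ridge_leverage_def scaled_data_row[OF w j] pinv)
  qed
  have dimA: "dim_row ?A = n" using scaled_data_carrier[OF w] by simp
  \<comment> \<open>The product of coherence and effective dimension, written without the division
    by an effective dimension that could be 0. In that case, split off below, the logarithm
    vanishes.\<close>
  define m where "m = real n * Max (ridge_leverage \<gamma> ?A ` {..<n})"
  have Rv: "R *\<^sub>v y \<in> carrier_vec d" if "y \<in> carrier_vec d" for y using R(1) that by (rule mult_vec_carrier)
  have norm_R: "(R *\<^sub>v y) \<bullet> (R *\<^sub>v y) = y \<bullet> (?H *\<^sub>v y)" if y: "y \<in> carrier_vec d" for y
    using symmetric_bilinear[OF R(1,2) y Rv[OF y]] mult_mult_vec[OF R(1,1) y] R(3) by simp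
  have inner_R: "v j \<bullet> (R *\<^sub>v y) = sdata w j \<bullet> y" if y: "y \<in> carrier_vec d" and j: "j < n" for y j
  proof -
    have "v j \<bullet> (R *\<^sub>v y) = sdata w j \<bullet> (S *\<^sub>v (R *\<^sub>v y))"
      unfolding v_def by (rule symmetric_bilinear[OF S sdata_carrier[OF j] Rv[OF y], symmetric])
    also have "S *\<^sub>v (R *\<^sub>v y) = y" using mult_mult_vec[OF S(1) R(1) y] inv(2) y by simp
    finally show ?thesis .
  qed
  have H_form: "y \<bullet> (?H *\<^sub>v y) = (\<Sum>j<n. (sdata w j \<bullet> y)\<^sup>2) / real n + \<gamma> * (y \<bullet> y)" if y: "y \<in> carrier_vec d" for y
    unfolding hessian_eq[OF w]
    by (subst ridge_mat_form) (use y sdata_carrier in \<open>auto simp: power2_eq_square sum_divide_distrib\<close>)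
  interpret row_sampling d n s v m
  proof
    show "0 < n" "0 < s" using n s by auto
    show "v j \<in> carrier_vec d" if "j < n" for j using v[OF that] .
    show "v j \<bullet> v j \<le> m" if j: "j < n" for j
    proof -
      have "ridge_leverage \<gamma> ?A j \<le> Max (ridge_leverage \<gamma> ?A ` {..<n})" using j by (intro Max_ge) auto
      thus ?thesis using leverage[OF j] n by (simp add: m_def field_simps)
    qed
    fix z :: "real vec" assume z: "z \<in> carrier_vec d"
    \<comment> \<open>In the original coordinates the two sides of the claim differ by the ridge
      term n \<gamma> (y \<bullet> y).\<close>
    define y where "y = S *\<^sub>v z"
    have y: "y \<in> carrier_vec d" unfolding y_def by (rule mult_vec_carrier[OF S(1) z])
    have zy: "z = R *\<^sub>v y" using mult_mult_vec[OF R(1) S(1) z] inv(1) z by (simp add: y_def)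
    have "(\<Sum>j<n. (v j \<bullet> z)\<^sup>2) = (\<Sum>j<n. (sdata w j \<bullet> y)\<^sup>2)"
      unfolding zy using inner_R[OF y] by (intro sum.cong) auto
    also have "\<dots> \<le> real n * (y \<bullet> (?H *\<^sub>v y))"
      using n \<gamma> scalar_prod_self_nonneg[of y] by (simp add: H_form[OF y] field_simps)
    also have "y \<bullet> (?H *\<^sub>v y) = z \<bullet> z" unfolding zy norm_R[OF y] ..
    finally show "(\<Sum>j<n. (v j \<bullet> z)\<^sup>2) \<le> real n * (z \<bullet> z)" .
  qed
  have mean_sq_norm_eq: "mean_sq_norm = eff_dim \<gamma> ?A"
    unfolding mean_sq_norm_def eff_dim_def dimA using leverage by (simp add: sum_divide_distrib)
  have "64 * m * ln (1 + mean_sq_norm / \<delta>) \<le> real s * \<eta>\<^sup>2"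
  proof (cases "mean_sq_norm = 0")
    case False
    hence "m = ridge_coherence \<gamma> ?A * eff_dim \<gamma> ?A" unfolding mean_sq_norm_eq by (simp add: m_def ridge_coherence_def dimA)
    thus ?thesis using size unfolding mean_sq_norm_eq by simp
  qed simp
  note card_bad = card_bad_le[OF \<eta> \<delta> this]
  have good: "\<bar>y \<bullet> (subsampled_hessian n x l \<gamma> s \<xi> w *\<^sub>v y) - y \<bullet> (?H *\<^sub>v y)\<bar> \<le> \<eta> * (y \<bullet> (?H *\<^sub>v y))"
    if \<xi>: "\<xi> \<in> samples - bad \<eta>" and y: "y \<in> carrier_vec d" for \<xi> y
  proof -
    have \<xi>n: "\<And>i. i < s \<Longrightarrow> \<xi> i < n" using \<xi> sample_less by blast
    have "\<bar>(R *\<^sub>v y) \<bullet> (deviation \<xi> *\<^sub>v (R *\<^sub>v y))\<bar> \<le> \<eta> * real s * ((R *\<^sub>v y) \<bullet> (R *\<^sub>v y))"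
      using \<xi> Rv[OF y] by (auto simp: bad_def not_less)
    moreover have "(R *\<^sub>v y) \<bullet> (deviation \<xi> *\<^sub>v (R *\<^sub>v y))
        = (\<Sum>i<s. (sdata w (\<xi> i) \<bullet> y)\<^sup>2) - real s * ((\<Sum>j<n. (sdata w j \<bullet> y)\<^sup>2) / real n)"
      using \<xi> inner_R[OF y] \<xi>n by (simp add: deviation_quadratic[OF _ Rv[OF y]] cov_def)
    moreover have "y \<bullet> (subsampled_hessian n x l \<gamma> s \<xi> w *\<^sub>v y)
        = (\<Sum>i<s. (sdata w (\<xi> i) \<bullet> y)\<^sup>2) / real s + \<gamma> * (y \<bullet> y)"
      by (subst subsampled_hessian_eq[OF w], erule \<xi>n, subst ridge_mat_form) (use y sdata_carrier \<xi>n in \<open>auto simp: power2_eq_square sum_divide_distrib\<close>)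
    ultimately have "real s * \<bar>y \<bullet> (subsampled_hessian n x l \<gamma> s \<xi> w *\<^sub>v y) - y \<bullet> (?H *\<^sub>v y)\<bar>
        \<le> real s * (\<eta> * (y \<bullet> (?H *\<^sub>v y)))"
    proof -
      assume a: "\<bar>(R *\<^sub>v y) \<bullet> (deviation \<xi> *\<^sub>v (R *\<^sub>v y))\<bar> \<le> \<eta> * real s * ((R *\<^sub>v y) \<bullet> (R *\<^sub>v y))"
        and b: "(R *\<^sub>v y) \<bullet> (deviation \<xi> *\<^sub>v (R *\<^sub>v y))
          = (\<Sum>i<s. (sdata w (\<xi> i) \<bullet> y)\<^sup>2) - real s * ((\<Sum>j<n. (sdata w j \<bullet> y)\<^sup>2) / real n)"
        and c: "y \<bullet> (subsampled_hessian n x l \<gamma> s \<xi> w *\<^sub>v y)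
          = (\<Sum>i<s. (sdata w (\<xi> i) \<bullet> y)\<^sup>2) / real s + \<gamma> * (y \<bullet> y)"
      \<comment> \<open>The ridge terms cancel, and s times the difference of the two Hessians is Z
        seen through R.\<close>
      have "real s * (y \<bullet> (subsampled_hessian n x l \<gamma> s \<xi> w *\<^sub>v y) - y \<bullet> (?H *\<^sub>v y))
          = (R *\<^sub>v y) \<bullet> (deviation \<xi> *\<^sub>v (R *\<^sub>v y))"
        unfolding b c H_form[OF y] using s by (simp add: right_diff_distrib distrib_left)
      hence "real s * \<bar>y \<bullet> (subsampled_hessian n x l \<gamma> s \<xi> w *\<^sub>v y) - y \<bullet> (?H *\<^sub>v y)\<bar>
          = \<bar>(R *\<^sub>v y) \<bullet> (deviation \<xi> *\<^sub>v (R *\<^sub>v y))\<bar>"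
        by (metis abs_mult abs_of_nat)
      thus ?thesis using a norm_R[OF y] by (simp add: mult_ac)
    qed
    thus ?thesis by (rule mult_left_le_imp_le) (use s in simp)
  qed
  show ?thesis
    by (rule that[of "bad \<eta>"]) (use card_bad good in \<open>auto simp: samples_def bad_def\<close>)
qed

lemma subsampled_hessian_pos_def:
  assumes "w \<in> carrier_vec d" "\<And>i. i < s \<Longrightarrow> \<xi> i < n"
  shows "pos_def d (subsampled_hessian n x l \<gamma> s \<xi> w)"
proof -
  have "subsampled_hessian n x l \<gamma> s \<xi> w = ridge_mat d \<gamma> s (1 / real s) (\<lambda>i. sdata w (\<xi> i))"
    by (rule subsampled_hessian_eq) (use assms in auto)
  thus ?thesis using ridge_mat_pos_def[of s "\<lambda>i. sdata w (\<xi> i)" d "1 / real s" \<gamma>] \<gamma> sdata_carrier assms(2) by simp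
qed

text \<open>The factor 8/7 (\<epsilon>/2 + 2/3 \<epsilon>0) from
  \<open>newton_direction_error\<close>, applied with \<eta> = \<epsilon>/2 < 1/8, is below
  \<epsilon> + \<epsilon>0 and also below 8/7 (1/8 + 2/3) = 19/21. Both bounds are kept for later
  use.\<close>

lemma ssn_step_error:
  assumes w: "w \<in> carrier_vec d" and \<xi>: "\<And>i. i < s \<Longrightarrow> \<xi> i < n"
    and sub: "\<And>y. y \<in> carrier_vec d \<Longrightarrow>
      \<bar>y \<bullet> (subsampled_hessian n x l \<gamma> s \<xi> w *\<^sub>v y) - y \<bullet> (hessian F w *\<^sub>v y)\<bar> \<le> \<epsilon> / 2 * (y \<bullet> (hessian F w *\<^sub>v y))"
    and \<epsilon>: "0 < \<epsilon>" "\<epsilon> < 1/4" and \<epsilon>0: "0 < \<epsilon>0" "\<epsilon>0 < 1"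
    and step: "inexact_ssn_step n x l \<gamma> s \<epsilon>0 \<xi> w w'"
    and q: "q \<in> carrier_vec d" "hessian F w *\<^sub>v q = gradient F w"
  obtains p' where "p' \<in> carrier_vec d" "w' = w - p'"
    "energy (hessian F w) (q - p') \<le> min 1 (\<epsilon> + \<epsilon>0) * energy (hessian F w) q"
proof -
  let ?H = "hessian F w" and ?Ht = "subsampled_hessian n x l \<gamma> s \<xi> w"
  obtain p p' where p: "p \<in> carrier_vec d" "p' \<in> carrier_vec d" "?Ht *\<^sub>v p = gradient F w"
    "norm2 (mat_sqrt ?Ht *\<^sub>v (p - p')) \<le> \<epsilon>0 / 2 * norm2 (mat_sqrt ?Ht *\<^sub>v p)" "w' = w - p'"
    using step w by (auto simp: inexact_ssn_step_def Let_def)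
  have "energy ?H (q - p') \<le> 8 / 7 * (\<epsilon> / 2 + 2 / 3 * \<epsilon>0) * energy ?H q"
    by (rule newton_direction_error[OF hessian_pos_def[OF w] subsampled_hessian_pos_def[OF w \<xi>] _ _ _ sub q(1) p(1,2) _ p(4)])
       (use \<epsilon> \<epsilon>0 p(3) q(2) in auto)
  also have "\<dots> \<le> min 1 (\<epsilon> + \<epsilon>0) * energy ?H q"
    using \<epsilon> \<epsilon>0 by (intro mult_right_mono energy_nonneg[OF hessian_pos_def[OF w] q(1)]) auto
  finally show ?thesis using that p by blast
qed

text \<open>With q the exact Newton direction, the new error is (q - p') - e for e = q - \<Delta>,
  and H e is the Taylor remainder r. It enters twice, through e itself and through the energy of q,
  which is at most that of \<Delta> plus that of e; two halves of L make L.\<close>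

lemma second_order_step_bound:
  assumes ws: "ws \<in> carrier_vec d" "gradient F ws = 0\<^sub>v d" and w: "w \<in> carrier_vec d"
    and lip: "\<And>u v. u \<in> carrier_vec d \<Longrightarrow> v \<in> carrier_vec d \<Longrightarrow>
      spec_norm (hessian F u - hessian F v) \<le> L * norm2 (u - v)"
    and \<xi>: "\<And>i. i < s \<Longrightarrow> \<xi> i < n"
    and sub: "\<And>y. y \<in> carrier_vec d \<Longrightarrow>
      \<bar>y \<bullet> (subsampled_hessian n x l \<gamma> s \<xi> w *\<^sub>v y) - y \<bullet> (hessian F w *\<^sub>v y)\<bar> \<le> \<epsilon> / 2 * (y \<bullet> (hessian F w *\<^sub>v y))"
    and \<epsilon>: "0 < \<epsilon>" "\<epsilon> < 1/4" and \<epsilon>0: "0 < \<epsilon>0" "\<epsilon>0 < 1"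
    and step: "inexact_ssn_step n x l \<gamma> s \<epsilon>0 \<xi> w w'"
  shows "norm2 (w' - ws) \<le> (\<epsilon> + \<epsilon>0) * sqrt (cond_number (hessian F w)) * norm2 (w - ws)
    + L / sigma_min (hessian F w) * (norm2 (w - ws))\<^sup>2"
proof -
  let ?H = "hessian F w"
  note H = hessian_pos_def[OF w] and Hc = hessian_carrier[OF w] and gc = gradient_carrier[OF w]
  define \<sigma> where "\<sigma> = sigma_min ?H"
  have \<sigma>: "0 < \<sigma>" using sigma_bounds(1)[OF H d] by (simp add: \<sigma>_def)
  note eb = energy_sigma_bounds[OF H d, folded \<sigma>_def]
  obtain R S where S: "S \<in> carrier_mat d d" "?H * (S * S) = 1\<^sub>m d" using pos_def_whitening[OF H] by metis
  have SS: "S * S \<in> carrier_mat d d" using S by simp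
  define q where "q = (S * S) *\<^sub>v gradient F w"
  have q: "q \<in> carrier_vec d" unfolding q_def by (rule mult_vec_carrier[OF SS gc])
  have Hq: "?H *\<^sub>v q = gradient F w"
    using mult_mult_vec[OF Hc SS gc] S(2) gc by (simp add: q_def)
  obtain p' where p': "p' \<in> carrier_vec d" "w' = w - p'"
    and err: "energy ?H (q - p') \<le> min 1 (\<epsilon> + \<epsilon>0) * energy ?H q"
    using ssn_step_error[OF w \<xi> sub \<epsilon> \<epsilon>0 step q Hq] by blast
  define \<theta> where "\<theta> = min 1 (\<epsilon> + \<epsilon>0)"
  have \<theta>: "0 \<le> \<theta>" "\<theta> \<le> 1" "\<theta> \<le> \<epsilon> + \<epsilon>0" using \<epsilon> \<epsilon>0 by (auto simp: \<theta>_def)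
  define \<Delta> where "\<Delta> = w - ws"
  have \<Delta>: "\<Delta> \<in> carrier_vec d" using w ws by (simp add: \<Delta>_def)
  define r where "r = gradient F w - ?H *\<^sub>v \<Delta>"
  have H\<Delta>: "?H *\<^sub>v \<Delta> \<in> carrier_vec d" by (rule mult_vec_carrier[OF Hc \<Delta>])
  have r: "r \<in> carrier_vec d" using gc H\<Delta> by (simp add: r_def)
  have r_le: "norm2 r \<le> L / 2 * (norm2 \<Delta>)\<^sup>2"
    unfolding r_def \<Delta>_def by (rule gradient_taylor_bound[OF ws w lip])
  define e where "e = q - \<Delta>"
  have e: "e \<in> carrier_vec d" using q \<Delta> by (simp add: e_def)
  have He: "?H *\<^sub>v e = r" unfolding e_def r_def mult_minus_distrib_mat_vec[OF Hc q \<Delta>] Hq ..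
  have en0: "0 \<le> energy ?H e" using energy_nonneg[OF H e] .
  \<comment> \<open>The squared energy of e is e \<bullet> r. Cauchy-Schwarz and the bound of
    \<open>norm2 e\<close> by the energy then let one factor of the energy cancel.\<close>
  have "(energy ?H e)\<^sup>2 \<le> norm2 e * norm2 r"
    using energy_sq[OF H e] cauchy_schwarz_vec[OF e r] by (simp add: He)
  also have "norm2 e \<le> energy ?H e / sqrt \<sigma>" using eb(1)[OF e] \<sigma> by (simp add: field_simps)
  hence "norm2 e * norm2 r \<le> energy ?H e / sqrt \<sigma> * norm2 r" by (rule mult_right_mono) (rule norm2_nonneg)
  finally have "energy ?H e * energy ?H e \<le> energy ?H e * (norm2 r / sqrt \<sigma>)" by (simp add: power2_eq_square)
  hence ee: "energy ?H e \<le> norm2 r / sqrt \<sigma>"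
    using en0 \<sigma> norm2_nonneg[of r]
    by (cases "energy ?H e = 0") (simp, metis less_eq_real_def mult_le_cancel_left_pos)
  have "q = \<Delta> + e" using q \<Delta> by (intro eq_vecI) (auto simp: e_def)
  hence "energy ?H q \<le> energy ?H \<Delta> + energy ?H e" using energy_triangle[OF H \<Delta> e] by simp
  hence "energy ?H q \<le> sqrt (sigma_max ?H) * norm2 \<Delta> + norm2 r / sqrt \<sigma>"
    using eb(2)[OF \<Delta>] ee by linarith
  hence "energy ?H (q - p') \<le> \<theta> * (sqrt (sigma_max ?H) * norm2 \<Delta> + norm2 r / sqrt \<sigma>)"
    using err mult_left_mono[OF _ \<theta>(1)] by (fastforce simp: \<theta>_def[symmetric])
  moreover have "w' - ws = (q - p') + (- 1) \<cdot>\<^sub>v e"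
    using q p' w ws by (intro eq_vecI) (auto simp: e_def \<Delta>_def)
  moreover have "energy ?H ((- 1) \<cdot>\<^sub>v e) = energy ?H e"
    using e r by (simp add: energy_def mult_mat_vec[OF Hc e] He)
  ultimately have "energy ?H (w' - ws) \<le> \<theta> * (sqrt (sigma_max ?H) * norm2 \<Delta> + norm2 r / sqrt \<sigma>) + norm2 r / sqrt \<sigma>"
    using energy_triangle[OF H, of "q - p'" "(- 1) \<cdot>\<^sub>v e"] q p' e ee by simp
  \<comment> \<open>The two bounds on \<theta> are used separately: \<epsilon> + \<epsilon>0 on the
    linear term, 1 on the remainder.\<close>
  also have "\<dots> \<le> (\<epsilon> + \<epsilon>0) * (sqrt (sigma_max ?H) * norm2 \<Delta>) + 2 * (norm2 r / sqrt \<sigma>)"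
  proof -
    have "0 \<le> sqrt (sigma_max ?H) * norm2 \<Delta>" using eb(2)[OF \<Delta>] energy_nonneg[OF H \<Delta>] by linarith
    hence "\<theta> * (sqrt (sigma_max ?H) * norm2 \<Delta>) \<le> (\<epsilon> + \<epsilon>0) * (sqrt (sigma_max ?H) * norm2 \<Delta>)"
      using \<theta> by (intro mult_right_mono) auto
    moreover have "\<theta> * (norm2 r / sqrt \<sigma>) \<le> 1 * (norm2 r / sqrt \<sigma>)"
      using \<theta> \<sigma> norm2_nonneg[of r] by (intro mult_right_mono) auto
    ultimately show ?thesis by (simp add: distrib_left)
  qed
  finally have fin: "energy ?H (w' - ws) \<le> (\<epsilon> + \<epsilon>0) * (sqrt (sigma_max ?H) * norm2 \<Delta>) + 2 * (norm2 r / sqrt \<sigma>)" .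
  have w'c: "w' - ws \<in> carrier_vec d" using p' w ws by simp
  have "norm2 (w' - ws) \<le> energy ?H (w' - ws) / sqrt \<sigma>" using eb(1)[OF w'c] \<sigma> by (simp add: field_simps)
  also have "\<dots> \<le> ((\<epsilon> + \<epsilon>0) * (sqrt (sigma_max ?H) * norm2 \<Delta>) + 2 * (norm2 r / sqrt \<sigma>)) / sqrt \<sigma>"
    using fin \<sigma> by (intro divide_right_mono) auto
  also have "\<dots> = (\<epsilon> + \<epsilon>0) * sqrt (cond_number ?H) * norm2 \<Delta> + 2 * norm2 r / \<sigma>"
    using \<sigma> by (simp add: cond_number_def \<sigma>_def[symmetric] real_sqrt_divide add_divide_distrib)
  also have "2 * norm2 r / \<sigma> \<le> L / \<sigma> * (norm2 \<Delta>)\<^sup>2" using r_le \<sigma> by (simp add: field_simps)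
  finally show ?thesis by (simp add: \<Delta>_def \<sigma>_def)
qed

text \<open>Constant second derivatives make both Hessians independent of the iterate, so a sample
  that is good at \<open>w0\<close> stays good at all iterations, and the contraction in one fixed
  energy norm can be iterated.\<close>

lemma quadratic_iterates_bound:
  assumes quad: "\<And>j. j < n \<Longrightarrow> \<exists>a b c. \<forall>z. l j z = a * z\<^sup>2 + b * z + c"
    and ws: "ws \<in> carrier_vec d" "gradient F ws = 0\<^sub>v d" and w0: "w0 \<in> carrier_vec d"
    and \<xi>: "\<And>i. i < s \<Longrightarrow> \<xi> i < n"
    and sub: "\<And>y. y \<in> carrier_vec d \<Longrightarrow>
      \<bar>y \<bullet> (subsampled_hessian n x l \<gamma> s \<xi> w0 *\<^sub>v y) - y \<bullet> (hessian F w0 *\<^sub>v y)\<bar> \<le> \<epsilon> / 2 * (y \<bullet> (hessian F w0 *\<^sub>v y))"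
    and \<epsilon>: "0 < \<epsilon>" "\<epsilon> < 1/4" and \<epsilon>0: "0 < \<epsilon>0" "\<epsilon>0 < 1"
    and w: "w 0 = w0" and step: "\<And>t. inexact_ssn_step n x l \<gamma> s \<epsilon>0 \<xi> (w t) (w (Suc t))"
  shows "norm2 (w t - ws) \<le> (\<epsilon> + \<epsilon>0) ^ t * sqrt (cond_number (hessian F w0)) * norm2 (w0 - ws)"
proof -
  let ?H = "hessian F w0"
  note H = hessian_pos_def[OF w0]
  have l'': "deriv (deriv (l j)) z = deriv (deriv (l j)) z'" if j: "j < n" for j z z'
  proof -
    obtain a b c where "\<forall>z. l j z = a * z\<^sup>2 + b * z + c" using quad[OF j] by blast
    hence l: "l j = (\<lambda>z. a * z\<^sup>2 + b * z + c)" by auto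
    have "deriv (l j) = (\<lambda>z. 2 * a * z + b)"
      unfolding l by (intro ext DERIV_imp_deriv) (auto intro!: derivative_eq_intros)
    moreover have "deriv (\<lambda>z. 2 * a * z + b) z = 2 * a" for z
      by (intro DERIV_imp_deriv) (auto intro!: derivative_eq_intros)
    ultimately show ?thesis by simp
  qed
  have sdata_const: "sdata u j = sdata w0 j" if "j < n" for u j
    unfolding sdata_def using l''[OF that] by metis
  have H_const: "hessian F u = ?H" if u: "u \<in> carrier_vec d" for u
    unfolding hessian_eq[OF u] hessian_eq[OF w0] ridge_mat_def gram_mat_def
    by (intro arg_cong2[where f = "(+)"] cong_mat) (auto simp: sdata_const[of _ u] intro!: sum.cong)
  have Ht_eq: "subsampled_hessian n x l \<gamma> s \<xi> u = ridge_mat d \<gamma> s (1 / real s) (\<lambda>i. sdata u (\<xi> i))"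
    if "u \<in> carrier_vec d" for u
    by (rule subsampled_hessian_eq[OF that \<xi>])
  have Ht_const: "subsampled_hessian n x l \<gamma> s \<xi> u = subsampled_hessian n x l \<gamma> s \<xi> w0" if u: "u \<in> carrier_vec d" for u
    unfolding Ht_eq[OF u] Ht_eq[OF w0] ridge_mat_def gram_mat_def
    by (intro arg_cong2[where f = "(+)"] cong_mat) (auto simp: sdata_const[of _ u] \<xi> intro!: sum.cong)
  \<comment> \<open>The Taylor bound with L = 0: for a constant Hessian the gradient is exactly
    linear around the minimiser.\<close>
  have grad: "gradient F u = ?H *\<^sub>v (u - ws)" if u: "u \<in> carrier_vec d" for u
  proof -
    let ?r = "gradient F u - ?H *\<^sub>v (u - ws)"
    have "spec_norm (?H - ?H) = 0"
    proof -
      have "norm2 ((?H - ?H) *\<^sub>v v) = 0" if v: "v \<in> carrier_vec d" for v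
      proof -
        have "(?H - ?H) *\<^sub>v v = 0\<^sub>v d"
          unfolding minus_mult_distrib_mat_vec[OF hessian_carrier[OF w0] hessian_carrier[OF w0] v]
          using mult_vec_carrier[OF hessian_carrier[OF w0] v] by simp
        thus ?thesis by (simp add: norm2_def)
      qed
      moreover have "dim_col (?H - ?H) = d" using hessian_carrier[OF w0] by simp
      moreover have "0\<^sub>v d \<in> {v \<in> carrier_vec d. norm2 v \<le> 1}" by (simp add: norm2_def)
      hence "{v \<in> carrier_vec d. norm2 v \<le> 1} \<noteq> {}" by blast
      ultimately show ?thesis unfolding spec_norm_def by (subst SUP_cong[OF refl, of _ _ "\<lambda>_. 0"]) auto
    qed
    hence "norm2 (gradient F u - hessian F u *\<^sub>v (u - ws)) \<le> 0 / 2 * (norm2 (u - ws))\<^sup>2"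
      by (intro gradient_taylor_bound[OF ws u]) (simp add: H_const)
    hence "norm2 ?r = 0" using norm2_nonneg[of ?r] by (simp add: H_const[OF u])
    moreover have us: "u - ws \<in> carrier_vec d" using u ws by simp
    have r: "?r \<in> carrier_vec d" "?H *\<^sub>v (u - ws) \<in> carrier_vec d"
      using gradient_carrier[OF u] mult_vec_carrier[OF hessian_carrier[OF w0] us] by auto
    ultimately have r0: "?r = 0\<^sub>v d" using scalar_prod_self_eq_0_iff[OF r(1)] by (simp add: norm2_def)
    have "gradient F u = ?r + ?H *\<^sub>v (u - ws)" using gradient_carrier[OF u] r hessian_carrier[OF w0]
      by (intro eq_vecI) auto
    thus ?thesis using r0 r by simp
  qed
  \<comment> \<open>The invariant includes the dimension of \<open>w t\<close>, because the step
    relation fixes dimensions only relative to the current iterate.\<close>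
  have inv: "w t \<in> carrier_vec d \<and> energy ?H (w t - ws) \<le> (\<epsilon> + \<epsilon>0) ^ t * energy ?H (w0 - ws)" for t
  proof (induction t)
    case 0 thus ?case using w w0 by simp
  next
    case (Suc t)
    hence wt: "w t \<in> carrier_vec d" and en: "energy ?H (w t - ws) \<le> (\<epsilon> + \<epsilon>0) ^ t * energy ?H (w0 - ws)" by auto
    have q: "w t - ws \<in> carrier_vec d" using wt ws by simp
    obtain p' where p': "p' \<in> carrier_vec d" "w (Suc t) = w t - p'"
      "energy (hessian F (w t)) ((w t - ws) - p') \<le> min 1 (\<epsilon> + \<epsilon>0) * energy (hessian F (w t)) (w t - ws)"
      using ssn_step_error[OF wt \<xi> _ \<epsilon> \<epsilon>0 step q] sub grad[OF wt] unfolding H_const[OF wt] Ht_const[OF wt] by metis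
    have "w (Suc t) - ws = (w t - ws) - p'" using p' wt ws by (intro eq_vecI) auto
    hence "energy ?H (w (Suc t) - ws) \<le> min 1 (\<epsilon> + \<epsilon>0) * energy ?H (w t - ws)"
      using p'(3) by (simp add: H_const[OF wt])
    also have "\<dots> \<le> (\<epsilon> + \<epsilon>0) * energy ?H (w t - ws)" using energy_nonneg[OF H q] by (intro mult_right_mono) auto
    also have "\<dots> \<le> (\<epsilon> + \<epsilon>0) * ((\<epsilon> + \<epsilon>0) ^ t * energy ?H (w0 - ws))"
      using en \<epsilon> \<epsilon>0 by (intro mult_left_mono) auto
    finally show ?case using p' wt by (simp add: mult_ac)
  qed
  define \<sigma> where "\<sigma> = sigma_min ?H"
  have \<sigma>: "0 < \<sigma>" using sigma_bounds(1)[OF H d] by (simp add: \<sigma>_def)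
  note eb = energy_sigma_bounds[OF H d, folded \<sigma>_def]
  have c: "w t - ws \<in> carrier_vec d" "w0 - ws \<in> carrier_vec d" using inv[of t] ws w0 by auto
  have "norm2 (w t - ws) \<le> energy ?H (w t - ws) / sqrt \<sigma>" using eb(1)[OF c(1)] \<sigma> by (simp add: field_simps)
  also have "\<dots> \<le> (\<epsilon> + \<epsilon>0) ^ t * energy ?H (w0 - ws) / sqrt \<sigma>" using inv[of t] \<sigma> by (intro divide_right_mono) auto
  also have "\<dots> \<le> (\<epsilon> + \<epsilon>0) ^ t * (sqrt (sigma_max ?H) * norm2 (w0 - ws)) / sqrt \<sigma>"
    using eb(2)[OF c(2)] \<sigma> \<epsilon> \<epsilon>0 by (intro divide_right_mono mult_left_mono) auto
  finally show ?thesis by (simp add: cond_number_def \<sigma>_def[symmetric] real_sqrt_divide)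
qed

end

section \<open>From counting to probability\<close>

lemma prob_ge_of_card:
  assumes S: "finite S" "S \<noteq> {}" and B: "B \<subseteq> S" "real (card B) \<le> \<delta> * real (card S)"
    and E: "S - B \<subseteq> E"
  shows "1 - \<delta> \<le> measure_pmf.prob (pmf_of_set S) E"
proof -
  have "card S - card B = card (S - B)" using B(1) S(1) by (simp add: card_Diff_subset finite_subset)
  also have "\<dots> \<le> card (S \<inter> E)" using E S(1) by (intro card_mono) auto
  finally have "real (card S) - real (card B) \<le> real (card (S \<inter> E))" by linarith
  hence "(1 - \<delta>) * real (card S) \<le> real (card (S \<inter> E))" using B(2) by (simp add: algebra_simps)
  thus ?thesis using S by (simp add: measure_pmf_of_set field_simps card_gt_0_iff)
qed

text \<open>A product of uniform laws is uniform on the product set, so probabilities of samples are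
  ratios of cardinalities.\<close>

lemma uniform_sample_eq:
  fixes n s :: nat
  assumes "1 \<le> n"
  defines "S \<equiv> PiE_dflt {..<s} 0 (\<lambda>_. {..<n})"
  shows "uniform_sample n s = pmf_of_set S" "finite S" "S \<noteq> {}" "set_pmf (uniform_sample n s) = S"
proof -
  have ne: "{..<n} \<noteq> {}" using assms(1) by (auto simp: lessThan_empty_iff)
  show eq: "uniform_sample n s = pmf_of_set S"
    unfolding uniform_sample_def S_def by (rule Pi_pmf_of_set) (use ne in auto)
  show fin: "finite S" unfolding S_def by (rule finite_PiE_dflt) auto
  have "(\<lambda>i. 0) \<in> S" using assms(1) by (auto simp: S_def PiE_dflt_def)
  thus "S \<noteq> {}" by blast
  thus "set_pmf (uniform_sample n s) = S" using eq fin by simp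
qed

theorem corollary7:
  shows "\<exists>C > (0 :: real). \<forall>(n :: nat) (d :: nat) (x :: nat \<Rightarrow> real vec) (l :: nat \<Rightarrow> real \<Rightarrow> real)
      (\<gamma> :: real) (w_star :: real vec) (s :: nat) (\<epsilon> :: real) (\<epsilon>0 :: real) (\<delta> :: real).
    1 \<le> n \<and> 1 \<le> d \<and> 1 \<le> s \<and> 0 < \<gamma>
    \<and> (\<forall>j<n. x j \<in> carrier_vec d)
    \<and> (\<forall>j<n. convex_on UNIV (l j)
            \<and> (\<forall>z. l j differentiable (at z)) \<and> (\<forall>z. deriv (l j) differentiable (at z)))
    \<and> w_star \<in> carrier_vec d
    \<and> (\<forall>w \<in> carrier_vec d. w \<noteq> w_star
          \<longrightarrow> erm_objective n x l \<gamma> w_star < erm_objective n x l \<gamma> w)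
    \<and> 0 < \<epsilon>0 \<and> \<epsilon>0 < 1 \<and> 0 < \<epsilon> \<and> \<epsilon> < 1 / 4 \<and> 0 < \<delta> \<and> \<delta> < 1
    \<longrightarrow>
    (\<forall>(w0 :: real vec) (w :: (nat \<Rightarrow> nat) \<Rightarrow> nat \<Rightarrow> real vec).
       (\<forall>j<n. \<exists>a b c. \<forall>z. l j z = a * z\<^sup>2 + b * z + c)
       \<and> w0 \<in> carrier_vec d
       \<and> C * (ridge_coherence \<gamma> (scaled_data n x l w0) * eff_dim \<gamma> (scaled_data n x l w0) / \<epsilon>\<^sup>2)
           * ln (1 + eff_dim \<gamma> (scaled_data n x l w0) / \<delta>) \<le> real s
       \<and> (\<forall>\<omega> \<in> set_pmf (uniform_sample n s). w \<omega> 0 = w0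
             \<and> (\<forall>t. inexact_ssn_step n x l \<gamma> s \<epsilon>0 \<omega> (w \<omega> t) (w \<omega> (Suc t))))
       \<longrightarrow> 1 - \<delta> \<le> measure_pmf.prob (uniform_sample n s)
             {\<omega>. \<forall>t. norm2 (w \<omega> t - w_star)
                \<le> (\<epsilon> + \<epsilon>0) ^ t * sqrt (cond_number (hessian (erm_objective n x l \<gamma>) w0))
                   * norm2 (w0 - w_star)})
    \<and>
    (\<forall>(L :: real) (wt :: real vec) (w_next :: (nat \<Rightarrow> nat) \<Rightarrow> real vec).
       (\<forall>u \<in> carrier_vec d. \<forall>v \<in> carrier_vec d.
          spec_norm (hessian (erm_objective n x l \<gamma>) u - hessian (erm_objective n x l \<gamma>) v)
            \<le> L * norm2 (u - v))
       \<and> wt \<in> carrier_vec d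
       \<and> C * (ridge_coherence \<gamma> (scaled_data n x l wt) * eff_dim \<gamma> (scaled_data n x l wt) / \<epsilon>\<^sup>2)
           * ln (1 + eff_dim \<gamma> (scaled_data n x l wt) / \<delta>) \<le> real s
       \<and> (\<forall>\<omega> \<in> set_pmf (uniform_sample n s). inexact_ssn_step n x l \<gamma> s \<epsilon>0 \<omega> wt (w_next \<omega>))
       \<longrightarrow> 1 - \<delta> \<le> measure_pmf.prob (uniform_sample n s)
             {\<omega>. norm2 (w_next \<omega> - w_star)
                \<le> (\<epsilon> + \<epsilon>0) * sqrt (cond_number (hessian (erm_objective n x l \<gamma>) wt))
                     * norm2 (wt - w_star)
                   + L / sigma_min (hessian (erm_objective n x l \<gamma>) wt)
                     * (norm2 (wt - w_star))\<^sup>2})"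
\<comment> \<open>256 = 4 * 64: the concentration bound with constant 64 is applied at \<eta> =
  \<epsilon>/2, and squaring the half costs the 4.\<close>
proof (intro exI[of _ 256] conjI allI impI)
  fix n d :: nat and x :: "nat \<Rightarrow> real vec" and l :: "nat \<Rightarrow> real \<Rightarrow> real"
    and \<gamma> :: real and w_star :: "real vec" and s :: nat and \<epsilon> \<epsilon>0 \<delta> :: real
  assume *: "1 \<le> n \<and> 1 \<le> d \<and> 1 \<le> s \<and> 0 < \<gamma>
    \<and> (\<forall>j<n. x j \<in> carrier_vec d)
    \<and> (\<forall>j<n. convex_on UNIV (l j)
            \<and> (\<forall>z. l j differentiable (at z)) \<and> (\<forall>z. deriv (l j) differentiable (at z)))
    \<and> w_star \<in> carrier_vec d
    \<and> (\<forall>w \<in> carrier_vec d. w \<noteq> w_star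
          \<longrightarrow> erm_objective n x l \<gamma> w_star < erm_objective n x l \<gamma> w)
    \<and> 0 < \<epsilon>0 \<and> \<epsilon>0 < 1 \<and> 0 < \<epsilon> \<and> \<epsilon> < 1 / 4 \<and> 0 < \<delta> \<and> \<delta> < 1"
  interpret erm n d x l \<gamma> by unfold_locales (use * in auto)
  have s: "1 \<le> s" and \<epsilon>0: "0 < \<epsilon>0" "\<epsilon>0 < 1" and \<epsilon>: "0 < \<epsilon>" "\<epsilon> < 1 / 4" and \<delta>: "0 < \<delta>"
    and ws: "w_star \<in> carrier_vec d" using * by auto
  have "F w_star \<le> F u" if "u \<in> carrier_vec d" for u
    using * that by (cases "u = w_star") (auto intro: less_imp_le)
  note g0 = gradient_minimizer[OF ws this]
  let ?S = "PiE_dflt {..<s} 0 (\<lambda>_. {..<n}) :: (nat \<Rightarrow> nat) set"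
  note U = uniform_sample_eq[OF n, of s]
  have less: "\<xi> i < n" if "\<xi> \<in> ?S" "i < s" for \<xi> i using that by (auto simp: PiE_dflt_def)
  \<comment> \<open>E only has to contain the good samples, so one counting argument serves both
    claims, whichever admissible inexact directions the iterates take.\<close>
  have prob: "1 - \<delta> \<le> measure_pmf.prob (uniform_sample n s) E"
    if w: "w \<in> carrier_vec d"
      and size: "256 * (ridge_coherence \<gamma> (scaled_data n x l w) * eff_dim \<gamma> (scaled_data n x l w) / \<epsilon>\<^sup>2)
           * ln (1 + eff_dim \<gamma> (scaled_data n x l w) / \<delta>) \<le> real s"
      and E: "\<And>\<xi>. \<xi> \<in> ?S \<Longrightarrow> (\<And>y. y \<in> carrier_vec d \<Longrightarrow>
        \<bar>y \<bullet> (subsampled_hessian n x l \<gamma> s \<xi> w *\<^sub>v y) - y \<bullet> (hessian F w *\<^sub>v y)\<bar> \<le> \<epsilon> / 2 * (y \<bullet> (hessian F w *\<^sub>v y)))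
        \<Longrightarrow> \<xi> \<in> E" for w E
  proof -
    have "64 * (ridge_coherence \<gamma> (scaled_data n x l w) * eff_dim \<gamma> (scaled_data n x l w))
        * ln (1 + eff_dim \<gamma> (scaled_data n x l w) / \<delta>) \<le> real s * (\<epsilon> / 2)\<^sup>2"
      using size \<epsilon> by (simp add: field_simps power_divide)
    moreover have "0 < \<epsilon> / 2" "\<epsilon> / 2 \<le> 1" using \<epsilon> by auto
    ultimately obtain B where "B \<subseteq> ?S" "real (card B) \<le> \<delta> * real (card ?S)"
      and "\<And>\<xi> y. \<xi> \<in> ?S - B \<Longrightarrow> y \<in> carrier_vec d \<Longrightarrow>
        \<bar>y \<bullet> (subsampled_hessian n x l \<gamma> s \<xi> w *\<^sub>v y) - y \<bullet> (hessian F w *\<^sub>v y)\<bar> \<le> \<epsilon> / 2 * (y \<bullet> (hessian F w *\<^sub>v y))"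
      using subsampled_hessian_concentration[OF w s _ _ \<delta>, of "\<epsilon> / 2"] by metis
    thus ?thesis unfolding U(1) using E by (intro prob_ge_of_card[OF U(2,3)]) auto
  qed
  {
    fix w0 :: "real vec" and w :: "(nat \<Rightarrow> nat) \<Rightarrow> nat \<Rightarrow> real vec"
    assume A: "(\<forall>j<n. \<exists>a b c. \<forall>z. l j z = a * z\<^sup>2 + b * z + c)
       \<and> w0 \<in> carrier_vec d
       \<and> 256 * (ridge_coherence \<gamma> (scaled_data n x l w0) * eff_dim \<gamma> (scaled_data n x l w0) / \<epsilon>\<^sup>2)
           * ln (1 + eff_dim \<gamma> (scaled_data n x l w0) / \<delta>) \<le> real s
       \<and> (\<forall>\<omega> \<in> set_pmf (uniform_sample n s). w \<omega> 0 = w0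
             \<and> (\<forall>t. inexact_ssn_step n x l \<gamma> s \<epsilon>0 \<omega> (w \<omega> t) (w \<omega> (Suc t))))"
    show "1 - \<delta> \<le> measure_pmf.prob (uniform_sample n s)
             {\<omega>. \<forall>t. norm2 (w \<omega> t - w_star)
                \<le> (\<epsilon> + \<epsilon>0) ^ t * sqrt (cond_number (hessian (erm_objective n x l \<gamma>) w0))
                   * norm2 (w0 - w_star)}"
    proof (rule prob[of w0])
      fix \<xi> assume \<xi>: "\<xi> \<in> ?S" and sub: "\<And>y. y \<in> carrier_vec d \<Longrightarrow>
        \<bar>y \<bullet> (subsampled_hessian n x l \<gamma> s \<xi> w0 *\<^sub>v y) - y \<bullet> (hessian F w0 *\<^sub>v y)\<bar> \<le> \<epsilon> / 2 * (y \<bullet> (hessian F w0 *\<^sub>v y))"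
      have "norm2 (w \<xi> t - w_star) \<le> (\<epsilon> + \<epsilon>0) ^ t * sqrt (cond_number (hessian F w0)) * norm2 (w0 - w_star)" for t
        by (rule quadratic_iterates_bound[OF _ ws g0 _ less[OF \<xi>] sub \<epsilon> \<epsilon>0]) (use A \<xi> U(4) in auto)
      thus "\<xi> \<in> {\<omega>. \<forall>t. norm2 (w \<omega> t - w_star) \<le> (\<epsilon> + \<epsilon>0) ^ t * sqrt (cond_number (hessian F w0)) * norm2 (w0 - w_star)}"
        by blast
    qed (use A in auto)
  next
    fix L :: real and wt :: "real vec" and w_next :: "(nat \<Rightarrow> nat) \<Rightarrow> real vec"
    assume A: "(\<forall>u \<in> carrier_vec d. \<forall>v \<in> carrier_vec d.
          spec_norm (hessian (erm_objective n x l \<gamma>) u - hessian (erm_objective n x l \<gamma>) v)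
            \<le> L * norm2 (u - v))
       \<and> wt \<in> carrier_vec d
       \<and> 256 * (ridge_coherence \<gamma> (scaled_data n x l wt) * eff_dim \<gamma> (scaled_data n x l wt) / \<epsilon>\<^sup>2)
           * ln (1 + eff_dim \<gamma> (scaled_data n x l wt) / \<delta>) \<le> real s
       \<and> (\<forall>\<omega> \<in> set_pmf (uniform_sample n s). inexact_ssn_step n x l \<gamma> s \<epsilon>0 \<omega> wt (w_next \<omega>))"
    show "1 - \<delta> \<le> measure_pmf.prob (uniform_sample n s)
             {\<omega>. norm2 (w_next \<omega> - w_star)
                \<le> (\<epsilon> + \<epsilon>0) * sqrt (cond_number (hessian (erm_objective n x l \<gamma>) wt))
                     * norm2 (wt - w_star)
                   + L / sigma_min (hessian (erm_objective n x l \<gamma>) wt)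
                     * (norm2 (wt - w_star))\<^sup>2}"
    proof (rule prob[of wt])
      fix \<xi> assume \<xi>: "\<xi> \<in> ?S" and sub: "\<And>y. y \<in> carrier_vec d \<Longrightarrow>
        \<bar>y \<bullet> (subsampled_hessian n x l \<gamma> s \<xi> wt *\<^sub>v y) - y \<bullet> (hessian F wt *\<^sub>v y)\<bar> \<le> \<epsilon> / 2 * (y \<bullet> (hessian F wt *\<^sub>v y))"
      have "norm2 (w_next \<xi> - w_star) \<le> (\<epsilon> + \<epsilon>0) * sqrt (cond_number (hessian F wt)) * norm2 (wt - w_star)
          + L / sigma_min (hessian F wt) * (norm2 (wt - w_star))\<^sup>2"
        by (rule second_order_step_bound[OF ws g0 _ _ less[OF \<xi>] sub \<epsilon> \<epsilon>0]) (use A \<xi> U(4) in auto)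
      thus "\<xi> \<in> {\<omega>. norm2 (w_next \<omega> - w_star) \<le> (\<epsilon> + \<epsilon>0) * sqrt (cond_number (hessian F wt)) * norm2 (wt - w_star)
          + L / sigma_min (hessian F wt) * (norm2 (wt - w_star))\<^sup>2}"
        by blast
    qed (use A in auto)
  }
qed simp

end
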